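(* Let $N=2$ and let $V=V^*\in L^1(0,1)$ be such that $k_1=k_2=1$ and $k_\alpha=2$ for all $\alpha\ge 3$. Then $\mathcal E_1\cap\mathcal E_2=\{0\}$, $\mathcal F_1=\mathcal E_2$ and $\mathcal F_2=\mathcal E_1$.
   Context: Here $V=V^*\in L^1(0,1)$ means that $V$ is an integrable function on $(0,1)$ with values in the Hermitian complex $N\times N$ matrices. Let $H$ be the self-adjoint operator in $L^2(0,1)^N$ given by $H\psi=-\psi''+V(x)\psi$ with boundary conditions $\psi(0)=\psi(1)=0$. Let $\lambda_1<\lambda_2<\dots<\lambda_\alpha<\dots$ be its distinct eigenvalues, and let $k_\alpha\in[1,N]$ be the multiplicity of $\lambda_\alpha$, i.e. the dimension of the corresponding eigenspace. $\varphi(x,\lambda)$ is the $N\times N$ matrix-valued solution of $-\varphi''+V\varphi=\lambda\varphi$ with $\varphi(0,\lambda)=0$, $\varphi'(0,\lambda)=I$ (the identity matrix), where $'=\partial/\partial x$. Set $S_\alpha=\int_0^1\varphi(t,\lambda_\alpha)^*\varphi(t,\lambda_\alpha)\,dt>0$ and $\mathcal E_\alpha=\mathrm{Ker}\,\varphi(1,\lambda_\alpha)\subset\mathbb C^N$ (one has $\dim\mathcal E_\alpha=k_\alpha$). The "forbidden subspace" is $\mathcal F_\alpha=\mathbb C^N\ominus S_\alpha(\mathcal E_\alpha)$, where $\mathbb C^N\ominus\mathcal S$ denotes the orthogonal complement of $\mathcal S$ in $\mathbb C^N$. *)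

theory Defs
  imports "HOL-Analysis.Analysis" "HOL-Library.Function_Algebras"
begin

definition conj_transpose :: "complex^'n^'m \<Rightarrow> complex^'m^'n" where
  "conj_transpose A = map_matrix cnj (transpose A)"

definition hermitian :: "complex^'n^'n \<Rightarrow> bool" where
  "hermitian A \<longleftrightarrow> conj_transpose A = A"

text \<open>Integrable matrix potentials with Hermitian values. As elements of \<open>L\<^sup>1\<close> are only
  determined almost everywhere, so is the symmetry.\<close>

definition hermitian_potential :: "(real \<Rightarrow> complex^'n^'n) \<Rightarrow> bool" where
  "hermitian_potential V \<longleftrightarrow> V absolutely_integrable_on {0<..<1} \<and>
     (AE x in lebesgue. x \<in> {0<..<1} \<longrightarrow> hermitian (V x))"

text \<open>\<open>ac_deriv g g'\<close>: the function \<open>g\<close> is absolutely continuous on \<open>[0,1]\<close> and \<open>g'\<close> is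
  (a representative of) its \<open>L\<^sup>1\<close> derivative.\<close>

definition ac_deriv :: "(real \<Rightarrow> 'a::euclidean_space) \<Rightarrow> (real \<Rightarrow> 'a) \<Rightarrow> bool" where
  "ac_deriv g g' \<longleftrightarrow> g' absolutely_integrable_on {0..1} \<and>
     (\<forall>x\<in>{0..1}. g x = g 0 + integral {0..x} g')"

definition square_integrable01 :: "(real \<Rightarrow> 'a::euclidean_space) \<Rightarrow> bool" where
  "square_integrable01 f \<longleftrightarrow> f \<in> borel_measurable (lebesgue_on {0..1}) \<and>
     integrable (lebesgue_on {0..1}) (\<lambda>x. (norm (f x))\<^sup>2)"

text \<open>The graph of the operator \<open>H\<close>: \<open>schrodinger_op V \<psi> f\<close> says that \<open>\<psi>\<close> is in the domain of
  \<open>H\<close> and that \<open>H \<psi> = f\<close> almost everywhere. An element of the domain is represented by its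
  continuous representative on \<open>[0,1]\<close>, extended by zero to the real line, so that it is a
  uniquely determined function.\<close>

definition schrodinger_op ::
  "(real \<Rightarrow> complex^'n^'n) \<Rightarrow> (real \<Rightarrow> complex^'n) \<Rightarrow> (real \<Rightarrow> complex^'n) \<Rightarrow> bool" where
  "schrodinger_op V \<psi> f \<longleftrightarrow>
     (\<forall>x. x \<notin> {0..1} \<longrightarrow> \<psi> x = 0) \<and> \<psi> 0 = 0 \<and> \<psi> 1 = 0 \<and>
     square_integrable01 \<psi> \<and> square_integrable01 f \<and>
     (\<exists>\<psi>' \<psi>''. ac_deriv \<psi> \<psi>' \<and> ac_deriv \<psi>' \<psi>'' \<and>
        (AE x in lebesgue. x \<in> {0<..<1} \<longrightarrow> f x = - \<psi>'' x + V x *v \<psi> x))"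

definition eigenspace :: "(real \<Rightarrow> complex^'n^'n) \<Rightarrow> complex \<Rightarrow> (real \<Rightarrow> complex^'n) set" where
  "eigenspace V \<mu> = {\<psi>. schrodinger_op V \<psi> (\<lambda>x. \<mu> *s \<psi> x)}"

definition eigenvalues :: "(real \<Rightarrow> complex^'n^'n) \<Rightarrow> complex set" where
  "eigenvalues V = {\<mu>. \<exists>\<psi>\<in>eigenspace V \<mu>. \<psi> \<noteq> (\<lambda>x. 0)}"

definition fun_scale :: "complex \<Rightarrow> (real \<Rightarrow> complex^'n) \<Rightarrow> real \<Rightarrow> complex^'n" where
  "fun_scale c \<psi> = (\<lambda>x. c *s \<psi> x)"

lemma vector_space_fun_scale: "vector_space (fun_scale :: complex \<Rightarrow> (real \<Rightarrow> complex^'n) \<Rightarrow> _)"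
  by unfold_locales (auto simp: fun_scale_def fun_eq_iff vec_eq_iff algebra_simps)

definition eigenvalue_multiplicity :: "(real \<Rightarrow> complex^'n^'n) \<Rightarrow> complex \<Rightarrow> nat" where
  "eigenvalue_multiplicity V \<mu> = vector_space.dim fun_scale (eigenspace V \<mu>)"

text \<open>The matrix solution \<open>\<phi>(\<sqdot>,\<mu>)\<close>; only its values on \<open>[0,1]\<close> matter, and it is extended by
  zero for uniqueness.\<close>

definition fundamental_solution ::
  "(real \<Rightarrow> complex^'n^'n) \<Rightarrow> complex \<Rightarrow> real \<Rightarrow> complex^'n^'n" where
  "fundamental_solution V \<mu> = (THE \<phi>.
     (\<forall>x. x \<notin> {0..1} \<longrightarrow> \<phi> x = 0) \<and>
     (\<exists>\<phi>' \<phi>''. ac_deriv \<phi> \<phi>' \<and> ac_deriv \<phi>' \<phi>'' \<and> \<phi> 0 = 0 \<and> \<phi>' 0 = mat 1 \<and>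
        (AE x in lebesgue. x \<in> {0<..<1} \<longrightarrow> - \<phi>'' x + V x ** \<phi> x = mat \<mu> ** \<phi> x)))"

definition gram_matrix :: "(real \<Rightarrow> complex^'n^'n) \<Rightarrow> complex \<Rightarrow> complex^'n^'n" where
  "gram_matrix V \<mu> = integral {0..1}
     (\<lambda>t. conj_transpose (fundamental_solution V \<mu> t) ** fundamental_solution V \<mu> t)"

definition kernel_subspace :: "(real \<Rightarrow> complex^'n^'n) \<Rightarrow> complex \<Rightarrow> (complex^'n) set" where
  "kernel_subspace V \<mu> = {h. fundamental_solution V \<mu> 1 *v h = 0}"

text \<open>Orthogonality is with respect to the Hermitian inner product; the library's
  \<open>orthogonal_comp\<close> uses the real inner product of \<open>complex^'n\<close>.\<close>

definition hermitian_comp :: "(complex^'n) set \<Rightarrow> (complex^'n) set" where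
  "hermitian_comp S = {v. \<forall>w\<in>S. (\<Sum>i\<in>UNIV. v $ i * cnj (w $ i)) = 0}"

definition forbidden_subspace :: "(real \<Rightarrow> complex^'n^'n) \<Rightarrow> complex \<Rightarrow> (complex^'n) set" where
  "forbidden_subspace V \<mu> =
     hermitian_comp ((\<lambda>h. gram_matrix V \<mu> *v h) ` kernel_subspace V \<mu>)"

end

theory Submission
  imports Defs "HOL-Complex_Analysis.Conformal_Mappings"
begin

text \<open>
  Let \<open>D(\<mu>) = \<phi>(1,\<mu>)\<close>. This is an entire \<open>2 \<times> 2\<close> matrix function, and the zeros of \<open>det D\<close> are the
  eigenvalues. At an eigenvalue of multiplicity two the whole matrix vanishes and \<open>det D\<close> has a zero
  of order exactly two; at the two simple eigenvalues \<open>det D\<close> has a zero of order exactly one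
  (\<open>det_double_zero_bound\<close>, \<open>det_simple_zero_bound\<close>). Moreover \<open>D(\<mu>)\<close> is close to
  \<open>(sin \<surd>\<mu> / \<surd>\<mu>) I\<close>, so on the circles \<open>\<bar>\<surd>\<mu>\<bar> = \<pi> (n + 1/2)\<close> a product of two entries of a column
  \<open>D(\<mu>) h\<close> is at most a constant times \<open>\<bar>det D(\<mu>)\<bar>\<close> (\<open>fundamental_solution_circle_bound\<close>).

  Let \<open>a\<close> and \<open>b\<close> be the two simple eigenvalues in either order, let \<open>h\<close> span \<open>E\<^sub>a\<close>, let \<open>k\<close> span \<open>E\<^sub>b\<close>
  and put \<open>u(\<mu>) = D(\<mu>) k\<close>. Since \<open>u\<close> vanishes at every eigenvalue except possibly \<open>a\<close>, the quotient
  \<open>u\<^sub>i u\<^sub>j (\<mu> - a) / ((\<mu> - b) det D)\<close> is entire. It is bounded on the circles, hence a constant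
  \<open>c\<^sub>i\<^sub>j\<close> (\<open>quadratic_column_identity\<close>). This is where the exact number of simple eigenvalues enters.
  The rest compares orders of vanishing at \<open>a\<close> in the identity
  \<open>u\<^sub>i u\<^sub>j (\<mu> - a) = c\<^sub>i\<^sub>j (\<mu> - b) det D\<close>, whose right-hand side vanishes to first order there unless
  \<open>c\<^sub>i\<^sub>j = 0\<close> (\<open>vanishing_by_order\<close>):

  \<^item> If \<open>u(a) = 0\<close>, the left-hand side has a zero of order at least three, so \<open>c\<^sub>i\<^sub>i = 0\<close> and \<open>u = 0\<close>
    identically, which contradicts \<open>det D \<noteq> 0\<close>. Hence \<open>u(a) \<noteq> 0\<close>, that is, \<open>E\<^sub>a \<inter> E\<^sub>b = {0}\<close>.

  \<^item> Let \<open>w = \<phi>'(1,a) h\<close>. Lagrange's identity gives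
    \<open>\<langle>u(\<mu>), w\<rangle> = (\<mu> - a) \<integral> \<langle>\<phi>(t,\<mu>) k, \<phi>(t,a) h\<rangle> dt\<close>. Contracting the identity twice with \<open>w\<close> therefore
    again produces a zero of order at least three on the left, so \<open>\<langle>u(\<mu>), w\<rangle> = 0\<close> for all \<open>\<mu>\<close>. The integral
    thus vanishes for \<open>\<mu> \<noteq> a\<close> and, by continuity, for \<open>\<mu> = a\<close>, where it equals \<open>\<langle>k, S\<^sub>a h\<rangle>\<close>. So
    \<open>E\<^sub>b\<close> is contained in \<open>F\<^sub>a\<close>, and both are lines because \<open>S\<^sub>a h \<noteq> 0\<close>.

  The analytic input is elementary but has to be developed for potentials that are only integrable:
  the product rule for absolutely continuous functions, existence and a priori bounds for solutions
  by a weighted supremum norm, and holomorphic dependence on the spectral parameter.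
\<close>

section \<open>Absolutely continuous functions\<close>

text \<open>Estimates that are clear on short intervals and can be concatenated hold on \<open>[0,x]\<close>: chain them along
  an equidistant partition.\<close>

lemma local_to_global_on_interval:
  fixes P :: "real \<Rightarrow> real \<Rightarrow> bool"
  assumes "\<delta> > 0"
    and trans: "\<And>s t u. P s t \<Longrightarrow> P t u \<Longrightarrow> P s u"
    and loc: "\<And>s t. 0 \<le> s \<Longrightarrow> s \<le> t \<Longrightarrow> t \<le> 1 \<Longrightarrow> t - s < \<delta> \<Longrightarrow> P s t"
    and x: "x \<in> {0..1}"
  shows "P 0 x"
proof -
  obtain n :: nat where n: "inverse (real (Suc n)) < \<delta>"
    using reals_Archimedean[OF \<open>\<delta> > 0\<close>] by blast
  define p where "p k = x * real k / real (Suc n)" for k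
  have "P 0 (p k)" if "k \<le> Suc n" for k
    using that
  proof (induction k)
    case 0
    show ?case using loc[of 0 0] \<open>\<delta> > 0\<close> by (simp add: p_def)
  next
    case (Suc k)
    have "p k \<le> p (Suc k)" using x by (simp add: p_def divide_right_mono mult_left_mono)
    moreover have "p (Suc k) \<le> 1"
    proof -
      have "x * real (Suc k) \<le> 1 * real (Suc n)"
        using x Suc.prems by (intro mult_mono) auto
      then show ?thesis by (simp add: p_def divide_simps)
    qed
    moreover have "p (Suc k) - p k < \<delta>"
    proof -
      have "p (Suc k) - p k = x * inverse (real (Suc n))"
        by (simp add: p_def divide_inverse distrib_left distrib_right)
      also have "\<dots> \<le> 1 * inverse (real (Suc n))"
        using x by (intro mult_right_mono) auto
      finally show ?thesis using n by simp
    qed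
    moreover have "0 \<le> p k" using x by (simp add: p_def)
    ultimately have "P (p k) (p (Suc k))" by (intro loc)
    moreover have "P 0 (p k)" using Suc by simp
    ultimately show ?case using trans by blast
  qed
  from this[of "Suc n"] show ?thesis by (simp add: p_def)
qed

lemma ac_derivD:
  assumes "ac_deriv g g'"
  shows "g' absolutely_integrable_on {0..1}"
    and "x \<in> {0..1} \<Longrightarrow> g x = g 0 + integral {0..x} g'"
  using assms unfolding ac_deriv_def by blast+

lemma ac_deriv_continuous:
  fixes g :: "real \<Rightarrow> 'a::euclidean_space"
  assumes "ac_deriv g g'"
  shows "continuous_on {0..1} g"
proof -
  have "continuous_on {0..1} (\<lambda>x. g 0 + integral {0..x} g')"
    using ac_derivD(1)[OF assms]
    by (intro continuous_intros indefinite_integral_continuous_1) (auto simp: absolutely_integrable_on_def)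
  then show ?thesis
    by (rule continuous_on_eq) (rule ac_derivD(2)[OF assms, symmetric])
qed

lemma absolutely_integrable_subinterval01:
  fixes f :: "real \<Rightarrow> 'a::euclidean_space"
  assumes "f absolutely_integrable_on {0..1::real}" "0 \<le> s" "t \<le> 1"
  shows "f absolutely_integrable_on {s..t}"
  using assms by (intro absolutely_integrable_on_subinterval[OF assms(1)]) auto

lemma integrable_subinterval01:
  fixes f :: "real \<Rightarrow> 'a::euclidean_space"
  assumes "f absolutely_integrable_on {0..1::real}" "0 \<le> s" "t \<le> 1"
  shows "f integrable_on {s..t}"
  using absolutely_integrable_subinterval01[OF assms] by (simp add: absolutely_integrable_on_def)

lemma ac_deriv_increment:
  assumes "ac_deriv g g'" "0 \<le> s" "s \<le> t" "t \<le> 1"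
  shows "g t - g s = integral {s..t} g'"
proof -
  have "integral {0..s} g' + integral {s..t} g' = integral {0..t} g'"
    using assms ac_derivD(1)[OF assms(1)]
    by (intro Henstock_Kurzweil_Integration.integral_combine integrable_subinterval01) auto
  with ac_derivD(2)[OF assms(1), of s] ac_derivD(2)[OF assms(1), of t] assms
  show ?thesis by (simp add: algebra_simps)
qed

lemma absolutely_integrable_bilinear_right:
  fixes h :: "'a::euclidean_space \<Rightarrow> 'b::euclidean_space \<Rightarrow> 'c::euclidean_space"
  assumes "bounded_bilinear h" "continuous_on {0..1::real} f" "g absolutely_integrable_on {0..1}"
  shows "(\<lambda>x. h (f x) (g x)) absolutely_integrable_on {0..1}"
proof (rule absolutely_integrable_bounded_measurable_product[where h=h and f=f, OF _ _ _ _ assms(3)])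
  show "bilinear h" using assms(1) by (simp add: bilinear_conv_bounded_bilinear)
  show "f \<in> borel_measurable (lebesgue_on {0..1})"
    by (rule continuous_imp_measurable_on_sets_lebesgue[OF assms(2)]) simp
  show "bounded (f ` {0..1})"
    by (intro compact_imp_bounded compact_continuous_image assms(2)) simp
qed simp

lemma absolutely_integrable_bilinear_left:
  fixes h :: "'a::euclidean_space \<Rightarrow> 'b::euclidean_space \<Rightarrow> 'c::euclidean_space"
  assumes "bounded_bilinear h" "continuous_on {0..1::real} f" "g absolutely_integrable_on {0..1}"
  shows "(\<lambda>x. h (g x) (f x)) absolutely_integrable_on {0..1}"
  using absolutely_integrable_bilinear_right[OF bounded_bilinear.flip[OF assms(1)] assms(2,3)] .

text \<open>Let \<open>R\<close> be the difference of the product and of the integral of the claimed derivative. Its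
  increment over \<open>[s,t]\<close> is at most the oscillation of \<open>F\<close> and \<open>G\<close> on \<open>[s,t]\<close> times
  \<open>\<integral> (\<bar>f\<bar> + \<bar>g\<bar>)\<close>. Adding up over a fine partition shows that \<open>R\<close> is constant. No pointwise derivative
  is used, so integrability of \<open>f\<close> and \<open>g\<close> suffices.\<close>

lemma ac_deriv_bilinear:
  fixes h :: "'a::euclidean_space \<Rightarrow> 'b::euclidean_space \<Rightarrow> 'c::euclidean_space"
  assumes h: "bounded_bilinear h" and F: "ac_deriv F f" and G: "ac_deriv G g"
  shows "ac_deriv (\<lambda>x. h (F x) (G x)) (\<lambda>x. h (f x) (G x) + h (F x) (g x))"
proof -
  interpret h: bounded_bilinear h by (fact h)
  obtain K where K: "K > 0" "\<And>a b. norm (h a b) \<le> norm a * norm b * K" using h.pos_bounded by blast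
  note cF = ac_deriv_continuous[OF F] and cG = ac_deriv_continuous[OF G]
  note af = ac_derivD(1)[OF F] and ag = ac_derivD(1)[OF G]
  let ?p = "\<lambda>x. h (f x) (G x) + h (F x) (g x)"
  have p1: "(\<lambda>x. h (f x) (G x)) absolutely_integrable_on {0..1}"
    by (rule absolutely_integrable_bilinear_left[OF h cG af])
  have p2: "(\<lambda>x. h (F x) (g x)) absolutely_integrable_on {0..1}"
    by (rule absolutely_integrable_bilinear_right[OF h cF ag])
  have p: "?p absolutely_integrable_on {0..1}" using p1 p2 by (rule set_integral_add)
  define R where "R x = h (F x) (G x) - integral {0..x} ?p" for x
  define A where "A s t = integral {s..t} (\<lambda>x. norm (f x) + norm (g x))" for s t
  have nfg: "(\<lambda>x. norm (f x) + norm (g x)) absolutely_integrable_on {0..1}"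
    using af ag by (intro set_integral_add absolutely_integrable_norm[unfolded o_def])
  \<comment> \<open>The values \<open>G t\<close> and \<open>F s\<close> at the end points are constants under the integral sign.\<close>
  have incr: "R t - R s = integral {s..t} (\<lambda>r. h (f r) (G t - G r) + h (F s - F r) (g r))"
    if st: "0 \<le> s" "s \<le> t" "t \<le> 1" for s t
  proof -
    have i: "f integrable_on {s..t}" "g integrable_on {s..t}"
      "(\<lambda>x. h (f x) (G x)) integrable_on {s..t}" "(\<lambda>x. h (F x) (g x)) integrable_on {s..t}"
      using integrable_subinterval01 st af ag p1 p2 by blast+
    have "integral {0..s} ?p + integral {s..t} ?p = integral {0..t} ?p"
      using st by (intro Henstock_Kurzweil_Integration.integral_combine integrable_subinterval01 p) auto
    then have "R t - R s = h (F t - F s) (G t) + h (F s) (G t - G s) - integral {s..t} ?p"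
      by (simp add: R_def h.diff_left h.diff_right algebra_simps)
    also have "h (F t - F s) (G t) = integral {s..t} (\<lambda>r. h (f r) (G t))"
      using integral_linear[OF i(1) h.bounded_linear_left, of "G t"] ac_deriv_increment[OF F st]
      by (simp add: o_def)
    also have "h (F s) (G t - G s) = integral {s..t} (\<lambda>r. h (F s) (g r))"
      using integral_linear[OF i(2) h.bounded_linear_right, of "F s"] ac_deriv_increment[OF G st]
      by (simp add: o_def)
    also have "integral {s..t} ?p = integral {s..t} (\<lambda>x. h (f x) (G x)) + integral {s..t} (\<lambda>x. h (F x) (g x))"
      using i by (intro integral_add)
    also have "integral {s..t} (\<lambda>r. h (f r) (G t)) + integral {s..t} (\<lambda>r. h (F s) (g r)) - \<dots>
       = integral {s..t} (\<lambda>r. (h (f r) (G t) + h (F s) (g r)) - (h (f r) (G r) + h (F r) (g r)))"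
      using i integrable_linear[OF i(1) h.bounded_linear_left, of "G t"]
        integrable_linear[OF i(2) h.bounded_linear_right, of "F s"]
      by (simp add: o_def integral_diff integral_add integrable_add)
    finally show ?thesis by (simp add: h.diff_left h.diff_right algebra_simps)
  qed
  have small: "norm (R x - R 0) \<le> e * K * A 0 x" if e: "e > 0" and x: "x \<in> {0..1}" for e x
  proof -
    have "uniformly_continuous_on {0..1} F" "uniformly_continuous_on {0..1} G"
      using cF cG by (auto intro: compact_uniformly_continuous)
    then obtain d1 d2 where d: "d1 > 0" "d2 > 0"
      "\<And>s t. s \<in> {0..1} \<Longrightarrow> t \<in> {0..1} \<Longrightarrow> dist t s < d1 \<Longrightarrow> dist (F t) (F s) < e"
      "\<And>s t. s \<in> {0..1} \<Longrightarrow> t \<in> {0..1} \<Longrightarrow> dist t s < d2 \<Longrightarrow> dist (G t) (G s) < e"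
      using e unfolding uniformly_continuous_on_def by metis
    define P where "P s t \<longleftrightarrow> 0 \<le> s \<and> s \<le> t \<and> t \<le> 1 \<and> norm (R t - R s) \<le> e * K * A s t" for s t
    have "P 0 x"
    proof (rule local_to_global_on_interval[where \<delta>="min d1 d2"])
      show "P s u" if "P s t" "P t u" for s t u
      proof -
        have "A s t + A t u = A s u" unfolding A_def using that unfolding P_def
          by (intro Henstock_Kurzweil_Integration.integral_combine integrable_subinterval01 nfg) auto
        then have "e * K * A s u = e * K * A s t + e * K * A t u" by (metis distrib_left)
        moreover have "norm (R u - R s) \<le> norm (R u - R t) + norm (R t - R s)"
          by (metis diff_add_cancel add_diff_eq norm_triangle_ineq)
        ultimately show ?thesis using that unfolding P_def by auto
      qed
      show "P s t" if st: "0 \<le> s" "s \<le> t" "t \<le> 1" "t - s < min d1 d2" for s t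
      proof -
        have "norm (R t - R s) \<le> integral {s..t} (\<lambda>r. (e * K) * (norm (f r) + norm (g r)))"
          unfolding incr[OF st(1-3)]
        proof (rule Henstock_Kurzweil_Integration.integral_norm_bound_integral)
          have "(\<lambda>r. h (f r) (G t - G r) + h (F s - F r) (g r)) absolutely_integrable_on {0..1}"
            by (intro set_integral_add absolutely_integrable_bilinear_right[OF h] absolutely_integrable_bilinear_left[OF h] af ag continuous_intros cF cG)
          then show "(\<lambda>r. h (f r) (G t - G r) + h (F s - F r) (g r)) integrable_on {s..t}"
            using integrable_subinterval01 st by blast
          show "(\<lambda>r. (e * K) * (norm (f r) + norm (g r))) integrable_on {s..t}"
            using integrable_subinterval01[OF nfg] st by (intro integrable_on_mult_right) auto
        next
          fix r assume r: "r \<in> {s..t}"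
          have "norm (G t - G r) < e" "norm (F s - F r) < e"
            using d(3)[of s r] d(4)[of r t] r st by (auto simp: dist_norm norm_minus_commute)
          then have "norm (h (f r) (G t - G r)) \<le> norm (f r) * e * K"
             "norm (h (F s - F r) (g r)) \<le> e * norm (g r) * K"
            using K(1) by (auto intro!: order_trans[OF K(2)] mult_right_mono mult_left_mono)
          then show "norm (h (f r) (G t - G r) + h (F s - F r) (g r)) \<le> e * K * (norm (f r) + norm (g r))"
            by (intro order_trans[OF norm_triangle_ineq]) (simp add: algebra_simps)
        qed
        then show ?thesis using st by (simp add: P_def A_def)
      qed
    qed (use d x in auto)
    then show ?thesis by (simp add: P_def)
  qed
  have "R x = R 0" if x: "x \<in> {0..1}" for x
  proof (rule ccontr)
    assume ne: "R x \<noteq> R 0"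
    have A0: "A 0 x \<ge> 0" unfolding A_def by (rule Henstock_Kurzweil_Integration.integral_nonneg) (use integrable_subinterval01[OF nfg] x in auto)
    have "norm (R x - R 0) \<le> (norm (R x - R 0) / (2 * (K * A 0 x + 1))) * K * A 0 x"
      using ne A0 K(1) by (intro small x divide_pos_pos) (auto intro!: add_nonneg_pos)
    also have "\<dots> = norm (R x - R 0) * ((K * A 0 x) / (2 * (K * A 0 x + 1)))" by simp
    also have "\<dots> \<le> norm (R x - R 0) * (1/2)"
    proof (rule mult_left_mono)
      have "K * A 0 x \<ge> 0" using K(1) A0 by simp
      then show "(K * A 0 x) / (2 * (K * A 0 x + 1)) \<le> 1/2" by (simp add: divide_simps)
    qed simp
    finally show False using ne by simp
  qed
  then have val: "h (F x) (G x) = h (F 0) (G 0) + integral {0..x} ?p" if "x \<in> {0..1}" for x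
  proof -
    have "h (F x) (G x) = R x + integral {0..x} ?p" by (simp only: R_def diff_add_cancel)
    also have "R x = R 0" by (rule \<open>\<And>x. x \<in> {0..1} \<Longrightarrow> R x = R 0\<close>[OF that])
    also have "R 0 = h (F 0) (G 0)" unfolding R_def by (simp only: integral_refl[of "0::real", unfolded cbox_interval] diff_0_right)
    finally show ?thesis .
  qed
  show ?thesis unfolding ac_deriv_def
  proof (rule conjI[OF p], rule ballI)
    fix x :: real assume "x \<in> {0..1}"
    then show "h (F x) (G x) = h (F 0) (G 0) + integral {0..x} ?p" by (rule val)
  qed
qed

text \<open>In the supremum norm with weight \<open>1/w\<close> the Volterra operator \<open>u \<mapsto> \<integral> q u\<close> has norm at most \<open>1/2\<close>. The
  weight is \<open>w = exp (4 \<integral> q)\<close>. The factor \<open>4\<close> instead of \<open>2\<close> leaves room for \<open>w\<close> to vary by a factor of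
  \<open>2\<close> on short intervals, so that crude local estimates can be concatenated.\<close>

lemma exponential_weight:
  assumes q: "q absolutely_integrable_on {0..1::real}" and pos: "\<And>x. x \<in> {0..1} \<Longrightarrow> q x \<ge> 0"
  obtains w :: "real \<Rightarrow> real" where "continuous_on {0..1} w" "\<And>x. w x > 0" "w 0 = 1"
    "\<And>x. x \<in> {0..1} \<Longrightarrow> integral {0..x} (\<lambda>t. q t * w t) \<le> w x / 2"
    "\<And>s t. 0 \<le> s \<Longrightarrow> s \<le> t \<Longrightarrow> t \<le> 1 \<Longrightarrow> w s \<le> w t"
proof
  define a where "a x = integral {0..x} q" for x
  define w where "w x = exp (4 * a x)" for x
  have aq: "ac_deriv a q" using q by (auto simp: ac_deriv_def a_def)
  have ca: "continuous_on {0..1} a" by (rule ac_deriv_continuous[OF aq])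
  show cw: "continuous_on {0..1} w" unfolding w_def by (intro continuous_intros ca)
  show "w x > 0" for x by (simp add: w_def)
  show w0: "w 0 = 1" by (simp add: w_def a_def)
  have mono: "a s \<le> a t" if "0 \<le> s" "s \<le> t" "t \<le> 1" for s t
  proof -
    have "integral {s..t} q \<ge> 0"
      using that pos by (intro Henstock_Kurzweil_Integration.integral_nonneg integrable_subinterval01[OF q]) auto
    then show ?thesis using ac_deriv_increment[OF aq that] by linarith
  qed
  then show "w s \<le> w t" if "0 \<le> s" "s \<le> t" "t \<le> 1" for s t using that by (simp add: w_def)
  have qw: "(\<lambda>t. q t * w t) absolutely_integrable_on {0..1}"
    by (rule absolutely_integrable_bilinear_left[OF bounded_bilinear_mult cw q])
  fix x :: real assume x: "x \<in> {0..1}"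
  have "uniformly_continuous_on {0..1} a" using ca by (auto intro: compact_uniformly_continuous)
  then obtain d where d: "d > 0" "\<And>s t. s \<in> {0..1} \<Longrightarrow> t \<in> {0..1} \<Longrightarrow> dist t s < d \<Longrightarrow> dist (a t) (a s) < 1/8"
    unfolding uniformly_continuous_on_def by (metis zero_less_divide_1_iff zero_less_numeral)
  define P where "P s t \<longleftrightarrow> 0 \<le> s \<and> s \<le> t \<and> t \<le> 1 \<and> integral {s..t} (\<lambda>t. q t * w t) \<le> (w t - w s) / 2" for s t
  have "P 0 x"
  proof (rule local_to_global_on_interval[OF d(1) _ _ x])
    show "P s u" if "P s t" "P t u" for s t u
    proof -
      have "integral {s..t} (\<lambda>t. q t * w t) + integral {t..u} (\<lambda>t. q t * w t) = integral {s..u} (\<lambda>t. q t * w t)"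
        using that unfolding P_def
        by (intro Henstock_Kurzweil_Integration.integral_combine integrable_subinterval01 qw) auto
      then show ?thesis using that by (auto simp: P_def)
    qed
    show "P s t" if st: "0 \<le> s" "s \<le> t" "t \<le> 1" "t - s < d" for s t
    proof -
      have "integral {s..t} (\<lambda>r. q r * w r) \<le> integral {s..t} (\<lambda>r. q r * w t)"
        using st integrable_subinterval01[OF q] integrable_subinterval01[OF qw] pos mono
        by (intro integral_le integrable_on_mult_left) (auto simp: w_def intro!: mult_left_mono)
      also have "\<dots> = (a t - a s) * w t" using ac_deriv_increment[OF aq st(1-3)] by simp
      also have "\<dots> \<le> (a t - a s) * (2 * w s)"
      proof (rule mult_left_mono)
        have "dist (a t) (a s) < 1/8" using st by (intro d(2)) (auto simp: dist_norm)
        then have "a t - a s \<le> 1/8" unfolding dist_norm real_norm_def by linarith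
        then have "exp (4 * (a t - a s)) \<le> exp (1/2)"
          unfolding exp_le_cancel_iff by argo
        moreover have "exp (1/2::real) \<le> 2"
        proof -
          have "exp (1/2::real) \<le> 1 + 1/2 + (1/2)^2" by (intro exp_bound) auto
          then show ?thesis by (simp add: power2_eq_square)
        qed
        ultimately have "exp (4 * (a t - a s)) \<le> 2" by (rule order_trans)
        then have "exp (4 * (a t - a s)) * w s \<le> 2 * w s"
          by (rule mult_right_mono) (simp add: w_def)
        then show "w t \<le> 2 * w s" by (simp add: w_def algebra_simps flip: exp_add)
        show "0 \<le> a t - a s" using mono st by simp
      qed
      also have "\<dots> \<le> (w t - w s) / 2"
      proof -
        have "1 + 4 * (a t - a s) \<le> exp (4 * (a t - a s))" by (rule exp_ge_add_one_self)
        then have "w s * (1 + 4 * (a t - a s)) \<le> w s * exp (4 * (a t - a s))"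
          by (intro mult_left_mono) (auto simp: w_def)
        also have "\<dots> = w t" by (simp add: w_def flip: exp_add)
        finally show ?thesis by (simp add: algebra_simps)
      qed
      finally show ?thesis using st by (simp add: P_def)
    qed
  qed
  then show "integral {0..x} (\<lambda>t. q t * w t) \<le> w x / 2"
    unfolding P_def w0 by argo
qed

text \<open>Evaluate the integral inequality at a point where \<open>u / w\<close> is maximal, \<open>w\<close> being the exponential weight:
  the integral absorbs only half of the left-hand side.\<close>

lemma gronwall_constant:
  assumes q: "q absolutely_integrable_on {0..1::real}" and pos: "\<And>x. x \<in> {0..1} \<Longrightarrow> q x \<ge> 0"
  obtains K :: real where "K > 0"
    "\<And>u c x. continuous_on {0..1} u \<Longrightarrow> (\<And>x. x \<in> {0..1} \<Longrightarrow> u x \<ge> 0) \<Longrightarrow> c \<ge> 0 \<Longrightarrow>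
       (\<And>x. x \<in> {0..1} \<Longrightarrow> u x \<le> c + integral {0..x} (\<lambda>t. q t * u t)) \<Longrightarrow> x \<in> {0..1} \<Longrightarrow> u x \<le> K * c"
proof -
  obtain w where w: "continuous_on {0..1} w" "\<And>x. w x > 0" "w 0 = 1"
    "\<And>x. x \<in> {0..1} \<Longrightarrow> integral {0..x} (\<lambda>t. q t * w t) \<le> w x / 2"
    "\<And>s t. 0 \<le> s \<Longrightarrow> s \<le> t \<Longrightarrow> t \<le> 1 \<Longrightarrow> w s \<le> w t"
    using exponential_weight[OF q pos] by blast
  show ?thesis
  proof (rule that[of "2 * w 1"])
    show "2 * w 1 > 0" using w(2) by simp
    fix u :: "real \<Rightarrow> real" and c x :: real
    assume u: "continuous_on {0..1} u" "\<And>x. x \<in> {0..1} \<Longrightarrow> u x \<ge> 0" and c: "c \<ge> 0"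
      and le: "\<And>x. x \<in> {0..1} \<Longrightarrow> u x \<le> c + integral {0..x} (\<lambda>t. q t * u t)" and x: "x \<in> {0..1}"
    have "continuous_on {0..1} (\<lambda>x. u x / w x)" using w(2) by (intro continuous_intros u w(1)) (auto simp: less_imp_neq[symmetric])
    from continuous_attains_sup[OF _ _ this]
    obtain x0 where x0: "x0 \<in> {0..1}" "\<And>x. x \<in> {0..1} \<Longrightarrow> u x / w x \<le> u x0 / w x0" by auto
    define M where "M = u x0 / w x0"
    have uM: "u t \<le> M * w t" if "t \<in> {0..1}" for t
      using x0(2)[OF that] w(2)[of t] by (simp add: M_def[symmetric] pos_divide_le_eq)
    have "u x0 \<le> c + integral {0..x0} (\<lambda>t. q t * u t)" by (rule le[OF x0(1)])
    also have "integral {0..x0} (\<lambda>t. q t * u t) \<le> integral {0..x0} (\<lambda>t. M * (q t * w t))"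
    proof (rule integral_le)
      show "(\<lambda>t. q t * u t) integrable_on {0..x0}"
        using x0(1) by (intro integrable_subinterval01 absolutely_integrable_bilinear_left[OF bounded_bilinear_mult u(1) q]) auto
      show "(\<lambda>t. M * (q t * w t)) integrable_on {0..x0}"
        using x0(1) by (intro integrable_on_mult_right integrable_subinterval01 absolutely_integrable_bilinear_left[OF bounded_bilinear_mult w(1) q]) auto
      show "q t * u t \<le> M * (q t * w t)" if "t \<in> {0..x0}" for t
        using mult_left_mono[OF uM pos, of t t] that x0(1) by (simp add: algebra_simps)
    qed
    also have "\<dots> \<le> M * (w x0 / 2)"
      unfolding integral_mult_right using w(2)[of x0] u(2)[OF x0(1)]
      by (intro mult_left_mono w(4) x0(1)) (auto simp: M_def)
    also have "\<dots> = u x0 / 2" using w(2)[of x0] by (simp add: M_def)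
    finally have u0: "u x0 \<le> 2 * c" by simp
    have "1 \<le> w x0" using w(3) w(5)[of 0 x0] x0(1) by auto
    moreover have "M \<le> u x0 / 1" unfolding M_def
      using \<open>1 \<le> w x0\<close> u(2)[OF x0(1)] by (intro divide_left_mono) auto
    ultimately have "M \<le> 2 * c" using u0 by simp
    moreover have "u x \<le> M * w x" by (rule uM[OF x])
    moreover have "M * w x \<le> 2 * c * w 1" using x c w(2)[of x] w(5)[of x 1] \<open>M \<le> 2 * c\<close>
      by (intro mult_mono) auto
    ultimately show "u x \<le> 2 * w 1 * c" by (simp add: algebra_simps)
  qed
qed

lemma ac_deriv_linear:
  fixes f :: "'a::euclidean_space \<Rightarrow> 'b::euclidean_space"
  assumes "bounded_linear f" "ac_deriv g g'"
  shows "ac_deriv (\<lambda>x. f (g x)) (\<lambda>x. f (g' x))"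
  unfolding ac_deriv_def
proof (intro conjI ballI)
  interpret f: bounded_linear f by fact
  note ai = ac_derivD(1)[OF assms(2)]
  show "(\<lambda>x. f (g' x)) absolutely_integrable_on {0..1}"
    using absolutely_integrable_linear[OF ai assms(1)] by (simp add: o_def)
  fix x :: real assume x: "x \<in> {0..1}"
  have "integral {0..x} (f \<circ> g') = f (integral {0..x} g')"
    by (rule integral_linear[OF integrable_subinterval01[OF ai] assms(1)]) (use x in auto)
  then show "f (g x) = f (g 0) + integral {0..x} (\<lambda>x. f (g' x))"
    by (subst ac_derivD(2)[OF assms(2) x]) (simp add: o_def f.add)
qed

lemma ac_deriv_add:
  fixes f g :: "real \<Rightarrow> 'b::euclidean_space"
  assumes "ac_deriv f f'" "ac_deriv g g'"
  shows "ac_deriv (\<lambda>x. f x + g x) (\<lambda>x. f' x + g' x)"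
  unfolding ac_deriv_def
proof (intro conjI ballI)
  note ai = ac_derivD(1)[OF assms(1)] ac_derivD(1)[OF assms(2)]
  show "(\<lambda>x. f' x + g' x) absolutely_integrable_on {0..1}"
    using ai by (rule set_integral_add)
  fix x :: real assume x: "x \<in> {0..1}"
  have "integral {0..x} (\<lambda>x. f' x + g' x) = integral {0..x} f' + integral {0..x} g'"
    using x by (intro integral_add integrable_subinterval01 ai) auto
  then show "f x + g x = f 0 + g 0 + integral {0..x} (\<lambda>x. f' x + g' x)"
    by (subst ac_derivD(2)[OF assms(1) x], subst ac_derivD(2)[OF assms(2) x]) simp
qed

lemma ac_deriv_diff:
  fixes f g :: "real \<Rightarrow> 'b::euclidean_space"
  assumes "ac_deriv f f'" "ac_deriv g g'"
  shows "ac_deriv (\<lambda>x. f x - g x) (\<lambda>x. f' x - g' x)"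
  using ac_deriv_add[OF assms(1) ac_deriv_linear[OF bounded_linear_minus[OF bounded_linear_ident] assms(2)]]
  by simp

lemma ac_deriv_cong_AE:
  fixes g :: "real \<Rightarrow> 'b::euclidean_space"
  assumes g: "ac_deriv g g'" and ae: "AE x in lebesgue. x \<in> {0<..<1} \<longrightarrow> g' x = h x"
  shows "ac_deriv g h"
proof -
  obtain N where N: "N \<in> null_sets lebesgue" "{x. \<not> (x \<in> {0<..<1} \<longrightarrow> g' x = h x)} \<subseteq> N"
    using ae unfolding eventually_ae_filter by auto
  let ?N = "N \<union> {0,1::real}"
  have neg: "negligible ?N"
    by (rule negligible_Un) (use N(1) negligible_iff_null_sets[of N] in simp_all)
  have eq: "h x = g' x" if x: "x \<in> {0..1} - ?N" for x
  proof -
    have "x \<in> {0<..<1}" "x \<notin> N" using x by auto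
    then show ?thesis using N(2) by fastforce
  qed
  show ?thesis unfolding ac_deriv_def
  proof (intro conjI ballI)
    show "h absolutely_integrable_on {0..1}"
      by (rule absolutely_integrable_spike[OF ac_derivD(1)[OF g] neg eq])
    fix x :: real assume x: "x \<in> {0..1}"
    have "integral {0..x} g' = integral {0..x} h"
      by (rule integral_spike[OF neg]) (use eq x in auto)
    then show "g x = g 0 + integral {0..x} h" by (subst ac_derivD(2)[OF g x]) simp
  qed
qed

section \<open>Existence and a priori bounds for differential equations with integrable coefficients\<close>

text \<open>Picard iteration: in the weighted norm each step halves the distance of consecutive iterates, so they
  converge uniformly, and the limit is a fixed point because the right-hand side is Lipschitz with
  integrable constant.\<close>

lemma caratheodory_exists:
  fixes A :: "real \<Rightarrow> 'a::euclidean_space \<Rightarrow> 'a"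
  assumes q: "q absolutely_integrable_on {0..1::real}" and pos: "\<And>x. x \<in> {0..1} \<Longrightarrow> q x \<ge> 0"
    and lip: "\<And>t u v. t \<in> {0..1} \<Longrightarrow> norm (A t u - A t v) \<le> q t * norm (u - v)"
    and int: "\<And>Y. continuous_on {0..1} Y \<Longrightarrow> (\<lambda>t. A t (Y t)) absolutely_integrable_on {0..1}"
  obtains Y where "ac_deriv Y (\<lambda>t. A t (Y t))" "Y 0 = y0"
proof -
  obtain w where w: "continuous_on {0..1} w" "\<And>x. w x > 0" "w 0 = 1"
    "\<And>x. x \<in> {0..1} \<Longrightarrow> integral {0..x} (\<lambda>t. q t * w t) \<le> w x / 2"
    "\<And>s t. 0 \<le> s \<Longrightarrow> s \<le> t \<Longrightarrow> t \<le> 1 \<Longrightarrow> w s \<le> w t"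
    using exponential_weight[OF q pos] by blast
  define T where "T Y x = y0 + integral {0..x} (\<lambda>t. A t (Y t))" for Y x
  have acT: "ac_deriv (T Y) (\<lambda>t. A t (Y t))" if "continuous_on {0..1} Y" for Y
    unfolding ac_deriv_def T_def using int[OF that] by simp
  have contT: "continuous_on {0..1} (T Y)" if "continuous_on {0..1} Y" for Y
    by (rule ac_deriv_continuous[OF acT[OF that]])
  have Tdiff: "norm (T Y x - T Z x) \<le> integral {0..x} (\<lambda>t. q t * b t)"
    if Y: "continuous_on {0..1} Y" and Z: "continuous_on {0..1} Z" and b: "continuous_on {0..1} b"
      and le: "\<And>t. t \<in> {0..1} \<Longrightarrow> norm (Y t - Z t) \<le> b t" and x: "x \<in> {0..1}" for Y Z b x
  proof -
    have i: "(\<lambda>t. A t (Y t)) integrable_on {0..x}" "(\<lambda>t. A t (Z t)) integrable_on {0..x}"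
      using x by (auto intro!: integrable_subinterval01 int Y Z)
    have "norm (integral {0..x} (\<lambda>t. A t (Y t) - A t (Z t))) \<le> integral {0..x} (\<lambda>t. q t * b t)"
    proof (rule Henstock_Kurzweil_Integration.integral_norm_bound_integral)
      show "(\<lambda>t. A t (Y t) - A t (Z t)) integrable_on {0..x}" by (intro integrable_diff i)
      show "(\<lambda>t. q t * b t) integrable_on {0..x}"
        by (rule integrable_subinterval01[OF absolutely_integrable_bilinear_left[OF bounded_bilinear_mult b q]]) (use x in auto)
      fix t assume "t \<in> {0..x}"
      then have t: "t \<in> {0..1}" using x by auto
      have "norm (A t (Y t) - A t (Z t)) \<le> q t * norm (Y t - Z t)" by (rule lip[OF t])
      also have "\<dots> \<le> q t * b t" by (intro mult_left_mono le t pos)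
      finally show "norm (A t (Y t) - A t (Z t)) \<le> q t * b t" .
    qed
    then show ?thesis using i by (simp add: T_def integral_diff)
  qed
  define S where "S n = (T ^^ n) (\<lambda>x. y0)" for n
  have S_Suc: "S (Suc n) = T (S n)" for n by (simp add: S_def)
  have contS: "continuous_on {0..1} (S n)" for n
    by (induction n) (auto simp: S_Suc contT, simp add: S_def)
  have "continuous_on {0..1} (\<lambda>x. norm (S 1 x - S 0 x))" by (intro continuous_intros contS)
  from continuous_attains_sup[OF _ _ this] obtain x0 where
    x0: "\<And>x. x \<in> {0..1} \<Longrightarrow> norm (S 1 x - S 0 x) \<le> norm (S 1 x0 - S 0 x0)"
    by (metis atLeastAtMost_iff compact_Icc empty_iff order_refl zero_le_one)
  define M where "M = norm (S 1 x0 - S 0 x0)"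
  have M0: "M \<ge> 0" by (simp add: M_def)
  have step: "norm (S (Suc n) x - S n x) \<le> M * (1/2)^n * w x" if "x \<in> {0..1}" for n x
    using that
  proof (induction n arbitrary: x)
    case 0
    have "1 \<le> w x" using w(3) w(5)[of 0 x] 0 by simp
    then have "M * 1 \<le> M * w x" using M0 by (intro mult_left_mono)
    then show ?case using x0[OF 0] by (simp add: M_def)
  next
    case (Suc n)
    have "norm (T (S (Suc n)) x - T (S n) x) \<le> integral {0..x} (\<lambda>t. q t * (M * (1/2)^n * w t))"
      by (intro Tdiff contS continuous_intros w(1) Suc.IH Suc.prems)
    also have "\<dots> = integral {0..x} (\<lambda>t. (M * (1/2)^n) * (q t * w t))"
      by (simp add: algebra_simps)
    also have "\<dots> = (M * (1/2)^n) * integral {0..x} (\<lambda>t. q t * w t)" by (rule integral_mult_right)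
    also have "\<dots> \<le> (M * (1/2)^n) * (w x / 2)"
      by (intro mult_left_mono w(4) Suc.prems) (simp add: M0)
    finally show ?case by (simp add: S_Suc)
  qed
  have "uniform_limit {0..1} (\<lambda>n x. \<Sum>i<n. S (Suc i) x - S i x) (\<lambda>x. \<Sum>i. S (Suc i) x - S i x) sequentially"
  proof (rule Weierstrass_m_test)
    fix n x assume x: "x \<in> {0..1::real}"
    have "M * (1/2)^n * w x \<le> M * (1/2)^n * w 1"
      using x M0 by (intro mult_left_mono w(5)) auto
    then show "norm (S (Suc n) x - S n x) \<le> M * (1/2)^n * w 1" using step[OF x, of n] by simp
  next
    show "summable (\<lambda>n. M * (1/2)^n * w 1)"
      by (intro summable_mult summable_mult2 summable_geometric) simp
  qed
  then have ul: "uniform_limit {0..1} (\<lambda>n x. S n x - S 0 x) (\<lambda>x. \<Sum>i. S (Suc i) x - S i x) sequentially"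
    using sum_lessThan_telescope[of "\<lambda>i. S i x" for x] by simp
  define Y where "Y x = S 0 x + (\<Sum>i. S (Suc i) x - S i x)" for x
  have ulY: "uniform_limit {0..1} S Y sequentially"
    using uniform_limit_add[OF uniform_limit_const ul, of "S 0"] unfolding Y_def[abs_def] by simp
  have contY: "continuous_on {0..1} Y"
    by (rule uniform_limit_theorem[OF always_eventually[OF allI[OF contS]] ulY]) simp
  have fix_pt: "T Y x = Y x" if x: "x \<in> {0..1}" for x
  proof -
    have "norm (T Y x - Y x) \<le> 0"
    proof (rule field_le_epsilon)
      fix e :: real assume e: "e > 0"
      define I where "I = integral {0..x} q"
      have I0: "I \<ge> 0" unfolding I_def
        by (rule Henstock_Kurzweil_Integration.integral_nonneg) (use x integrable_subinterval01[OF q] pos in auto)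
      define d where "d = e / (I + 1)"
      have d: "d > 0" using e I0 by (simp add: d_def)
      obtain N where N: "\<And>n t. n \<ge> N \<Longrightarrow> t \<in> {0..1} \<Longrightarrow> dist (S n t) (Y t) < d"
        using uniform_limitD[OF ulY d] unfolding eventually_sequentially by blast
      have "norm (T Y x - T (S N) x) \<le> integral {0..x} (\<lambda>t. q t * d)"
        by (intro Tdiff contY contS continuous_intros x) (use N[of N] in \<open>force simp: dist_norm norm_minus_commute\<close>)
      moreover have "\<dots> = I * d" by (simp add: I_def)
      moreover have "norm (S (Suc N) x - Y x) < d" using N[of "Suc N" x] x by (simp add: dist_norm)
      moreover have "norm (T Y x - Y x) \<le> norm (T Y x - T (S N) x) + norm (S (Suc N) x - Y x)"
        by (metis S_Suc add_diff_eq diff_add_cancel norm_triangle_ineq)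
      moreover have "(I + 1) * d = e" using I0 by (simp add: d_def)
      then have "I * d + d = e" by (simp only: distrib_right mult_1)
      ultimately show "norm (T Y x - Y x) \<le> 0 + e" by linarith
    qed
    then show ?thesis by simp
  qed
  show ?thesis
  proof (rule that[of "T Y"])
    show "T Y 0 = y0" by (simp add: T_def)
    have ai: "(\<lambda>t. A t (T Y t)) absolutely_integrable_on {0..1}" by (intro int contT contY)
    have val: "T Y x = T Y 0 + integral {0..x} (\<lambda>t. A t (T Y t))" if x: "x \<in> {0..1}" for x
    proof -
      have "integral {0..x} (\<lambda>t. A t (T Y t)) = integral {0..x} (\<lambda>t. A t (Y t))"
        by (rule integral_cong) (use fix_pt x in auto)
      then show ?thesis by (simp add: T_def)
    qed
    show "ac_deriv (T Y) (\<lambda>t. A t (T Y t))"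
      unfolding ac_deriv_def by (intro conjI ballI) (rule ai, erule val)
  qed
qed

lemma second_order_exists:
  fixes Q :: "real \<Rightarrow> 'a::euclidean_space \<Rightarrow> 'a"
  assumes q: "q absolutely_integrable_on {0..1::real}" and pos: "\<And>x. x \<in> {0..1} \<Longrightarrow> q x \<ge> 0"
    and lip: "\<And>t u v. t \<in> {0..1} \<Longrightarrow> norm (Q t u - Q t v) \<le> q t * norm (u - v)"
    and int: "\<And>Y. continuous_on {0..1} Y \<Longrightarrow> (\<lambda>t. Q t (Y t)) absolutely_integrable_on {0..1}"
  obtains y y' where "ac_deriv y y'" "ac_deriv y' (\<lambda>t. Q t (y t))" "y 0 = a" "y' 0 = b"
proof -
  have n1: "norm (fst z) \<le> norm z" and n2: "norm (snd z) \<le> norm z" for z :: "'a \<times> 'a"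
    by (cases z; simp add: norm_fst_le norm_snd_le)+
  obtain Y where Y: "ac_deriv Y (\<lambda>t. (snd (Y t), Q t (fst (Y t))))" "Y 0 = (a, b)"
  proof (rule caratheodory_exists[where A = "\<lambda>t z. (snd z, Q t (fst z))" and q = "\<lambda>t. 1 + q t" and ?y0.0 = "(a, b)"])
    show "(\<lambda>t. 1 + q t) absolutely_integrable_on {0..1}"
      by (intro set_integral_add q absolutely_integrable_on_const) simp
    show "0 \<le> 1 + q x" if "x \<in> {0..1}" for x using pos[OF that] by simp
    show "norm ((snd u, Q t (fst u)) - (snd v, Q t (fst v))) \<le> (1 + q t) * norm (u - v)"
      if t: "t \<in> {0..1}" for t and u v :: "'a \<times> 'a"
    proof -
      have "norm ((snd u, Q t (fst u)) - (snd v, Q t (fst v))) \<le> norm (snd (u - v)) + norm (Q t (fst u) - Q t (fst v))"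
        by (simp add: norm_Pair_le)
      also have "\<dots> \<le> norm (u - v) + q t * norm (fst (u - v))"
        using lip[OF t, of "fst u" "fst v"] by (intro add_mono n2) simp
      also have "\<dots> \<le> norm (u - v) + q t * norm (u - v)"
        by (intro add_left_mono mult_left_mono n1 pos t)
      finally show ?thesis by (simp add: algebra_simps)
    qed
    show "(\<lambda>t. (snd (Y t), Q t (fst (Y t)))) absolutely_integrable_on {0..1}"
      if c: "continuous_on {0..1} Y" for Y :: "real \<Rightarrow> 'a \<times> 'a"
    proof -
      have "(\<lambda>t. snd (Y t)) absolutely_integrable_on {0..1}"
        by (intro absolutely_integrable_continuous_real continuous_intros c)
      moreover have "(\<lambda>t. Q t (fst (Y t))) absolutely_integrable_on {0..1}"
        by (intro int continuous_intros c)
      moreover have "bounded_linear (\<lambda>u::'a. (u, 0::'a))" "bounded_linear (\<lambda>u::'a. (0::'a, u))"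
        by (intro bounded_linear_Pair bounded_linear_ident bounded_linear_zero)+
      ultimately have "(\<lambda>t. (snd (Y t), 0) + (0, Q t (fst (Y t)))) absolutely_integrable_on {0..1}"
        using absolutely_integrable_linear[where f = "\<lambda>t. snd (Y t)" and h = "\<lambda>u::'a. (u, 0::'a)"]
          absolutely_integrable_linear[where f = "\<lambda>t. Q t (fst (Y t))" and h = "\<lambda>u::'a. (0::'a, u)"]
        by (intro set_integral_add) (simp_all add: o_def)
      then show ?thesis by simp
    qed
  qed auto
  show ?thesis
  proof (rule that)
    show "ac_deriv (\<lambda>t. fst (Y t)) (\<lambda>t. snd (Y t))"
      using ac_deriv_linear[OF bounded_linear_fst Y(1)] by simp
    show "ac_deriv (\<lambda>t. snd (Y t)) (\<lambda>t. Q t (fst (Y t)))"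
      using ac_deriv_linear[OF bounded_linear_snd Y(1)] by simp
  qed (use Y(2) in auto)
qed

lemma integral_norm_bound_AE:
  fixes f :: "real \<Rightarrow> 'b::euclidean_space"
  assumes f: "f integrable_on {s..t}" and g: "g integrable_on {s..t}" and st: "0 \<le> s" "t \<le> 1"
    and ae: "AE x in lebesgue. x \<in> {0<..<1} \<longrightarrow> norm (f x) \<le> g x"
  shows "norm (integral {s..t} f) \<le> integral {s..t} g"
proof -
  obtain N where N: "N \<in> null_sets lebesgue" "{x. \<not> (x \<in> {0<..<1} \<longrightarrow> norm (f x) \<le> g x)} \<subseteq> N"
    using ae unfolding eventually_ae_filter by auto
  let ?N = "N \<union> {0,1::real}"
  have neg: "negligible ?N"
    by (rule negligible_Un) (use N(1) negligible_iff_null_sets[of N] in simp_all)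
  have le: "norm (f x) \<le> g x" if x: "x \<in> {0..1} - ?N" for x
  proof -
    have "x \<in> {0<..<1}" "x \<notin> N" using x by auto
    then show ?thesis using N(2) by blast
  qed
  define f1 where "f1 x = (if x \<in> ?N then 0 else f x)" for x
  define g1 where "g1 x = (if x \<in> ?N then 0 else g x)" for x
  have "integral {s..t} f = integral {s..t} f1" "integral {s..t} g = integral {s..t} g1"
    by (rule integral_spike[OF neg], simp add: f1_def g1_def)+
  moreover have "norm (integral {s..t} f1) \<le> integral {s..t} g1"
  proof (rule Henstock_Kurzweil_Integration.integral_norm_bound_integral)
    show "f1 integrable_on {s..t}" by (rule integrable_spike[OF f neg]) (simp add: f1_def)
    show "g1 integrable_on {s..t}" by (rule integrable_spike[OF g neg]) (simp add: g1_def)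
    show "norm (f1 x) \<le> g1 x" if "x \<in> {s..t}" for x
      using le[of x] that st by (auto simp: f1_def g1_def)
  qed
  ultimately show ?thesis by simp
qed

text \<open>This one estimate serves for uniqueness (\<open>r = 0\<close> and zero data), for Lipschitz dependence on the
  spectral parameter and for the quadratic remainder of its linearization. The constant must therefore
  be independent of the solution.\<close>

lemma second_order_bound:
  assumes q: "q absolutely_integrable_on {0..1::real}" and pos: "\<And>x. x \<in> {0..1} \<Longrightarrow> q x \<ge> 0"
  obtains K :: real where "K > 0"
    "\<And>(y :: real \<Rightarrow> 'a::euclidean_space) y' y'' r x. ac_deriv y y' \<Longrightarrow> ac_deriv y' y'' \<Longrightarrow> r \<ge> 0 \<Longrightarrow>
       (AE x in lebesgue. x \<in> {0<..<1} \<longrightarrow> norm (y'' x) \<le> q x * norm (y x) + r) \<Longrightarrow>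
       x \<in> {0..1} \<Longrightarrow> norm (y x) + norm (y' x) \<le> K * (norm (y 0) + norm (y' 0) + r)"
proof -
  have q1: "(\<lambda>t. 1 + q t) absolutely_integrable_on {0..1}"
    by (intro set_integral_add q absolutely_integrable_on_const) simp
  have pos1: "0 \<le> 1 + q x" if "x \<in> {0..1}" for x using pos[OF that] by simp
  obtain K :: real where K: "K > 0"
    "\<And>u c x. continuous_on {0..1} u \<Longrightarrow> (\<And>x. x \<in> {0..1} \<Longrightarrow> u x \<ge> 0) \<Longrightarrow> c \<ge> 0 \<Longrightarrow>
       (\<And>x. x \<in> {0..1} \<Longrightarrow> u x \<le> c + integral {0..x} (\<lambda>t. (1 + q t) * u t)) \<Longrightarrow> x \<in> {0..1} \<Longrightarrow> u x \<le> K * c"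
    using gronwall_constant[OF q1 pos1] by blast
  show ?thesis
  proof (rule that[OF K(1)])
    fix y :: "real \<Rightarrow> 'a" and y' y'' and r x :: real
    assume y: "ac_deriv y y'" "ac_deriv y' y''" and r: "r \<ge> 0" and
      ae: "AE x in lebesgue. x \<in> {0<..<1} \<longrightarrow> norm (y'' x) \<le> q x * norm (y x) + r" and x: "x \<in> {0..1}"
    note c = ac_deriv_continuous[OF y(1)] ac_deriv_continuous[OF y(2)]
    show "norm (y x) + norm (y' x) \<le> K * (norm (y 0) + norm (y' 0) + r)"
    proof (rule K(2)[OF _ _ _ _ x])
      show "continuous_on {0..1} (\<lambda>x. norm (y x) + norm (y' x))" by (intro continuous_intros c)
      fix x :: real assume x: "x \<in> {0..1}"
      have cn: "continuous_on {0..1} (\<lambda>t. norm (y t))" "continuous_on {0..1} (\<lambda>t. norm (y' t))"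
        by (intro continuous_intros c)+
      have i1: "(\<lambda>t. norm (y t)) integrable_on {0..x}" "(\<lambda>t. norm (y' t)) integrable_on {0..x}"
        using x by (auto intro!: integrable_continuous_real continuous_on_subset[OF cn(1)] continuous_on_subset[OF cn(2)])
      have i2: "(\<lambda>t. q t * norm (y t)) integrable_on {0..x}" "(\<lambda>t. q t * norm (y' t)) integrable_on {0..x}"
        using x by (auto intro!: integrable_subinterval01 absolutely_integrable_bilinear_left[OF bounded_bilinear_mult _ q] cn)
      have i3: "y' integrable_on {0..x}" "y'' integrable_on {0..x}"
        using x by (auto intro!: integrable_subinterval01 ac_derivD(1)[OF y(1)] ac_derivD(1)[OF y(2)])
      have i4: "(\<lambda>t. q t * norm (y t) + r) integrable_on {0..x}" by (intro integrable_add i2 integrable_const_ivl)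
      have "norm (integral {0..x} y') \<le> integral {0..x} (\<lambda>t. norm (y' t))"
        by (intro Henstock_Kurzweil_Integration.integral_norm_bound_integral i1 i3) simp
      moreover have "norm (integral {0..x} y'') \<le> integral {0..x} (\<lambda>t. q t * norm (y t) + r)"
        by (rule integral_norm_bound_AE[OF i3(2) i4]) (use x ae in auto)
      moreover have "integral {0..x} (\<lambda>t. q t * norm (y t) + r) = integral {0..x} (\<lambda>t. q t * norm (y t)) + r * x"
        using x by (subst integral_add[OF i2(1)]) auto
      moreover have "r * x \<le> r" using r x by (simp add: mult_left_le)
      moreover have "norm (y x) \<le> norm (y 0) + norm (integral {0..x} y')"
        by (subst ac_derivD(2)[OF y(1) x]) (rule norm_triangle_ineq)
      moreover have "norm (y' x) \<le> norm (y' 0) + norm (integral {0..x} y'')"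
        by (subst ac_derivD(2)[OF y(2) x]) (rule norm_triangle_ineq)
      moreover have "integral {0..x} (\<lambda>t. norm (y' t)) + integral {0..x} (\<lambda>t. q t * norm (y t))
        \<le> integral {0..x} (\<lambda>t. (1 + q t) * (norm (y t) + norm (y' t)))"
      proof -
        have "integral {0..x} (\<lambda>t. norm (y' t)) + integral {0..x} (\<lambda>t. q t * norm (y t))
           = integral {0..x} (\<lambda>t. norm (y' t) + q t * norm (y t))"
          by (rule integral_add[symmetric]) (fact i1 i2)+
        also have "\<dots> \<le> integral {0..x} (\<lambda>t. (1 + q t) * (norm (y t) + norm (y' t)))"
        proof (rule integral_le)
          show "(\<lambda>t. norm (y' t) + q t * norm (y t)) integrable_on {0..x}" by (intro integrable_add i1 i2)
          have "(\<lambda>t. norm (y t) + norm (y' t) + (q t * norm (y t) + q t * norm (y' t))) integrable_on {0..x}"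
            by (intro integrable_add i1 i2)
          then show "(\<lambda>t. (1 + q t) * (norm (y t) + norm (y' t))) integrable_on {0..x}"
            by (simp add: algebra_simps)
          show "norm (y' t) + q t * norm (y t) \<le> (1 + q t) * (norm (y t) + norm (y' t))"
            if "t \<in> {0..x}" for t using pos[of t] that x by (simp add: algebra_simps)
        qed
        finally show ?thesis .
      qed
      ultimately show "norm (y x) + norm (y' x) \<le> norm (y 0) + norm (y' 0) + r +
         integral {0..x} (\<lambda>t. (1 + q t) * (norm (y t) + norm (y' t)))" by linarith
    qed (use r in auto)
  qed
qed

section \<open>Complex vectors and the Hermitian inner product\<close>

lemma norm_complex_vector_smult: "norm (c *s v) = cmod c * norm (v :: complex^'n)"
  by (simp add: norm_vec_def L2_set_right_distrib norm_mult)

lemma bounded_bilinear_vector_smult: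
  "bounded_bilinear ((*s) :: complex \<Rightarrow> complex^'n \<Rightarrow> complex^'n)"
  by unfold_locales
    (auto simp: vec_eq_iff algebra_simps norm_complex_vector_smult intro!: exI[of _ 1])

lemma bounded_bilinear_matrix_vector_mult:
  "bounded_bilinear ((*v) :: complex^'n^'m \<Rightarrow> complex^'n \<Rightarrow> complex^'m)"
  unfolding bilinear_conv_bounded_bilinear[symmetric] bilinear_def
  by (auto intro!: linearI simp: vec_eq_iff matrix_vector_mult_def sum.distrib scaleR_sum_right algebra_simps)

lemma bounded_bilinear_matrix_matrix_mult:
  "bounded_bilinear ((**) :: complex^'n^'m \<Rightarrow> complex^'k^'n \<Rightarrow> complex^'k^'m)"
  unfolding bilinear_conv_bounded_bilinear[symmetric] bilinear_def
  by (auto intro!: linearI simp: vec_eq_iff matrix_matrix_mult_def sum.distrib scaleR_sum_right algebra_simps)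

definition cinner :: "complex^'n \<Rightarrow> complex^'n \<Rightarrow> complex" where
  "cinner v w = (\<Sum>i\<in>UNIV. v $ i * cnj (w $ i))"

lemma bounded_bilinear_cinner: "bounded_bilinear (cinner :: complex^'n \<Rightarrow> complex^'n \<Rightarrow> complex)"
  unfolding bilinear_conv_bounded_bilinear[symmetric] bilinear_def
  by (auto intro!: linearI simp: cinner_def sum.distrib scaleR_sum_right algebra_simps)

lemma cinner_smult_left: "cinner (c *s v) w = c * cinner v w"
  by (simp add: cinner_def sum_distrib_left mult.assoc)

lemma cinner_smult_right: "cinner v (c *s w) = cnj c * cinner v w"
  by (simp add: cinner_def sum_distrib_left algebra_simps)

lemma cinner_hermitian:
  assumes "hermitian A"
  shows "cinner (A *v v) w = cinner v (A *v w)"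
proof -
  have A: "cnj (A $ j $ i) = A $ i $ j" for i j
    using assms by (auto simp: hermitian_def conj_transpose_def vec_eq_iff transpose_def map_matrix_def)
  have "cinner (A *v v) w = (\<Sum>i\<in>UNIV. \<Sum>j\<in>UNIV. A $ i $ j * v $ j * cnj (w $ i))"
    by (simp add: cinner_def matrix_vector_mult_def sum_distrib_right)
  also have "\<dots> = (\<Sum>j\<in>UNIV. \<Sum>i\<in>UNIV. A $ i $ j * v $ j * cnj (w $ i))" by (rule sum.swap)
  also have "\<dots> = cinner v (A *v w)"
    by (simp add: cinner_def matrix_vector_mult_def sum_distrib_left A algebra_simps)
  finally show ?thesis .
qed

section \<open>The inhomogeneous Schroedinger equation\<close>

text \<open>The source term \<open>f\<close> makes differences of solutions for different spectral parameters, and derivatives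
  with respect to the parameter, solutions of the same kind of equation.\<close>

definition schrodinger_solution ::
  "(real \<Rightarrow> complex^'n^'n) \<Rightarrow> complex \<Rightarrow> (real \<Rightarrow> complex^'n) \<Rightarrow>
    (real \<Rightarrow> complex^'n) \<Rightarrow> (real \<Rightarrow> complex^'n) \<Rightarrow> (real \<Rightarrow> complex^'n) \<Rightarrow> bool" where
  "schrodinger_solution V \<mu> f y y' y'' \<longleftrightarrow> ac_deriv y y' \<and> ac_deriv y' y'' \<and>
     (AE x in lebesgue. x \<in> {0<..<1} \<longrightarrow> y'' x = V x *v y x - \<mu> *s y x - f x)"

lemma schrodinger_solution_diff:
  assumes "schrodinger_solution V \<mu> f y y' y''" "schrodinger_solution V \<mu> g z z' z''"
  shows "schrodinger_solution V \<mu> (\<lambda>x. f x - g x) (\<lambda>x. y x - z x) (\<lambda>x. y' x - z' x) (\<lambda>x. y'' x - z'' x)"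
proof -
  have "AE x in lebesgue. x \<in> {0<..<1} \<longrightarrow> y'' x - z'' x = V x *v (y x - z x) - \<mu> *s (y x - z x) - (f x - g x)"
    using assms[unfolded schrodinger_solution_def, THEN conjunct2, THEN conjunct2]
  proof eventually_elim
    case (elim x)
    show ?case
    proof
      assume x: "x \<in> {0<..<1}"
      note e = elim(1)[rule_format, OF x] elim(2)[rule_format, OF x]
      show "y'' x - z'' x = V x *v (y x - z x) - \<mu> *s (y x - z x) - (f x - g x)"
        unfolding e matrix_vector_mult_diff_distrib vector_ssub_ldistrib by (simp add: algebra_simps)
    qed
  qed
  then show ?thesis using assms unfolding schrodinger_solution_def by (simp add: ac_deriv_diff)
qed

lemma schrodinger_solution_smult:
  assumes "schrodinger_solution V \<mu> f y y' y''"
  shows "schrodinger_solution V \<mu> (\<lambda>x. c *s f x) (\<lambda>x. c *s y x) (\<lambda>x. c *s y' x) (\<lambda>x. c *s y'' x)"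
proof -
  have ae: "AE x in lebesgue. x \<in> {0<..<1} \<longrightarrow> c *s y'' x = V x *v (c *s y x) - \<mu> *s (c *s y x) - c *s f x"
    using assms[unfolded schrodinger_solution_def, THEN conjunct2, THEN conjunct2]
  proof eventually_elim
    case (elim x)
    show ?case
    proof
      assume x: "x \<in> {0<..<1}"
      show "c *s y'' x = V x *v (c *s y x) - \<mu> *s (c *s y x) - c *s f x"
        unfolding elim[rule_format, OF x] vector_scalar_commute vector_ssub_ldistrib
        by (simp add: mult.commute)
    qed
  qed
  have "bounded_linear ((*s) c :: complex^'n \<Rightarrow> complex^'n)"
    by (rule bounded_bilinear.bounded_linear_right[OF bounded_bilinear_vector_smult])
  note ac = ac_deriv_linear[OF this]
  show ?thesis using assms ae ac[of y y'] ac[of y' y''] unfolding schrodinger_solution_def by (elim conjE, intro conjI)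
qed

text \<open>A change of the spectral parameter is traded for a source term.\<close>

lemma schrodinger_solution_shift_parameter:
  assumes "schrodinger_solution V \<mu> f y y' y''"
  shows "schrodinger_solution V \<nu> (\<lambda>x. f x + (\<mu> - \<nu>) *s y x) y y' y''"
proof -
  have "AE x in lebesgue. x \<in> {0<..<1} \<longrightarrow> y'' x = V x *v y x - \<nu> *s y x - (f x + (\<mu> - \<nu>) *s y x)"
    using assms[unfolded schrodinger_solution_def, THEN conjunct2, THEN conjunct2]
    by eventually_elim (auto simp: vec_eq_iff algebra_simps)
  then show ?thesis using assms unfolding schrodinger_solution_def by simp
qed

lemma potential_absolutely_integrable:
  assumes "hermitian_potential V"
  shows "V absolutely_integrable_on {0..1}"
  using assms absolutely_integrable_on_open_interval[where f = V and a = 0 and b = 1, unfolded box_real cbox_interval] unfolding hermitian_potential_def by simp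

lemma schrodinger_solution_bound:
  fixes V :: "real \<Rightarrow> complex^'n^'n"
  assumes V: "hermitian_potential V"
  obtains K :: real where "K > 0"
    "\<And>\<mu> f y y' y'' r x. cmod \<mu> \<le> \<rho> \<Longrightarrow> schrodinger_solution V \<mu> f y y' y'' \<Longrightarrow> r \<ge> 0 \<Longrightarrow>
      (\<And>x. x \<in> {0..1} \<Longrightarrow> norm (f x) \<le> r) \<Longrightarrow> x \<in> {0..1} \<Longrightarrow>
      norm (y x) + norm (y' x) \<le> K * (norm (y 0) + norm (y' 0) + r)"
proof -
  obtain C where C: "C > 0" "\<And>(A::complex^'n^'n) v. norm (A *v v) \<le> norm A * norm v * C"
    using bounded_bilinear.pos_bounded[OF bounded_bilinear_matrix_vector_mult] by blast
  define q where "q t = C * norm (V t) + \<bar>\<rho>\<bar>" for t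
  have q: "q absolutely_integrable_on {0..1}" unfolding q_def
    using absolutely_integrable_norm[OF potential_absolutely_integrable[OF V]]
    by (intro set_integral_add absolutely_integrable_on_const set_integrable_mult_right) (auto simp: o_def)
  have pos: "q x \<ge> 0" for x using C(1) by (simp add: q_def)
  obtain K :: real where K: "K > 0"
    "\<And>(y :: real \<Rightarrow> complex^'n) y' y'' r x. ac_deriv y y' \<Longrightarrow> ac_deriv y' y'' \<Longrightarrow> r \<ge> 0 \<Longrightarrow>
       (AE x in lebesgue. x \<in> {0<..<1} \<longrightarrow> norm (y'' x) \<le> q x * norm (y x) + r) \<Longrightarrow>
       x \<in> {0..1} \<Longrightarrow> norm (y x) + norm (y' x) \<le> K * (norm (y 0) + norm (y' 0) + r)"
    using second_order_bound[OF q pos] by blast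
  show ?thesis
  proof (rule that[OF K(1)])
    fix \<mu> f and y y' y'' :: "real \<Rightarrow> complex^'n" and r x
    assume \<mu>: "cmod \<mu> \<le> \<rho>" and s: "schrodinger_solution V \<mu> f y y' y''" and r: "r \<ge> (0::real)"
      and f: "\<And>x. x \<in> {0..1} \<Longrightarrow> norm (f x) \<le> r" and x: "x \<in> {0..1::real}"
    have ptw: "norm (V x *v y x - \<mu> *s y x - f x) \<le> q x * norm (y x) + r" if "x \<in> {0<..<1}" for x
    proof -
      have "norm (V x *v y x - \<mu> *s y x - f x) \<le> norm (V x *v y x) + norm (\<mu> *s y x) + norm (f x)"
        by (meson norm_triangle_ineq4 norm_triangle_le_diff order_trans add_right_mono)
      also have "\<dots> \<le> norm (V x) * norm (y x) * C + \<bar>\<rho>\<bar> * norm (y x) + r"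
        using \<mu> that unfolding norm_complex_vector_smult
        by (intro add_mono C(2) mult_right_mono f) auto
      finally show ?thesis by (simp add: q_def algebra_simps)
    qed
    have "AE x in lebesgue. x \<in> {0<..<1} \<longrightarrow> norm (y'' x) \<le> q x * norm (y x) + r"
      using s unfolding schrodinger_solution_def by (elim conjE AE_mp) (simp add: ptw)
    then show "norm (y x) + norm (y' x) \<le> K * (norm (y 0) + norm (y' 0) + r)"
      using s r x unfolding schrodinger_solution_def by (intro K(2)) auto
  qed
qed

lemma schrodinger_solution_unique:
  fixes V :: "real \<Rightarrow> complex^'n^'n"
  assumes V: "hermitian_potential V"
    and y: "schrodinger_solution V \<mu> f y y' y''" and z: "schrodinger_solution V \<mu> f z z' z''"
    and init: "y 0 = z 0" "y' 0 = z' 0" and x: "x \<in> {0..1}"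
  shows "y x = z x" "y' x = z' x"
proof -
  obtain K :: real where K:
    "\<And>f y y' y'' r x. schrodinger_solution V \<mu> f y y' y'' \<Longrightarrow> r \<ge> 0 \<Longrightarrow>
      (\<And>x. x \<in> {0..1} \<Longrightarrow> norm (f x) \<le> r) \<Longrightarrow> x \<in> {0..1} \<Longrightarrow>
      norm (y x) + norm (y' x) \<le> K * (norm (y 0) + norm (y' 0) + r)"
    using schrodinger_solution_bound[OF V, of "cmod \<mu>"] by (metis order_refl)
  have "norm (y x - z x) + norm (y' x - z' x) \<le> K * (norm (y 0 - z 0) + norm (y' 0 - z' 0) + 0)"
    by (rule K[OF schrodinger_solution_diff[OF y z] _ _ x]) auto
  also have "\<dots> = 0" using init by simp
  finally have "norm (y x - z x) + norm (y' x - z' x) \<le> 0" .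
  then have "norm (y x - z x) = 0" "norm (y' x - z' x) = 0"
    using norm_ge_zero[of "y x - z x"] norm_ge_zero[of "y' x - z' x"] by linarith+
  then show "y x = z x" "y' x = z' x" by simp_all
qed

lemma schrodinger_solution_exists:
  fixes V :: "real \<Rightarrow> complex^'n^'n"
  assumes V: "hermitian_potential V" and f: "continuous_on {0..1} f"
  obtains y y' y'' where "schrodinger_solution V \<mu> f y y' y''" "y 0 = a" "y' 0 = b"
proof -
  obtain C where C: "C > 0" "\<And>(A::complex^'n^'n) v. norm (A *v v) \<le> norm A * norm v * C"
    using bounded_bilinear.pos_bounded[OF bounded_bilinear_matrix_vector_mult] by blast
  note aV = potential_absolutely_integrable[OF V]
  define q where "q t = C * norm (V t) + cmod \<mu>" for t
  obtain y y' where y: "ac_deriv y y'" "ac_deriv y' (\<lambda>t. V t *v y t - \<mu> *s y t - f t)" "y 0 = a" "y' 0 = b"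
  proof (rule second_order_exists[where Q = "\<lambda>t u. V t *v u - \<mu> *s u - f t" and q = q and a = a and b = b])
    show "q absolutely_integrable_on {0..1}" unfolding q_def
      using absolutely_integrable_norm[OF aV]
      by (intro set_integral_add absolutely_integrable_on_const set_integrable_mult_right) (auto simp: o_def)
    show "q x \<ge> 0" for x using C(1) by (simp add: q_def)
    fix t :: real and u v
    have "norm (V t *v u - \<mu> *s u - f t - (V t *v v - \<mu> *s v - f t)) = norm (V t *v (u - v) - \<mu> *s (u - v))"
      by (simp add: matrix_vector_mult_diff_distrib vector_ssub_ldistrib algebra_simps)
    also have "\<dots> \<le> norm (V t *v (u - v)) + norm (\<mu> *s (u - v))" by (rule norm_triangle_ineq4)
    also have "\<dots> \<le> norm (V t) * norm (u - v) * C + cmod \<mu> * norm (u - v)"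
      unfolding norm_complex_vector_smult by (intro add_right_mono C(2))
    also have "\<dots> = q t * norm (u - v)" by (simp add: q_def algebra_simps)
    finally show "norm (V t *v u - \<mu> *s u - f t - (V t *v v - \<mu> *s v - f t)) \<le> q t * norm (u - v)" .
  next
    fix Y :: "real \<Rightarrow> complex^'n" assume Y: "continuous_on {0..1} Y"
    have "(\<lambda>t. \<mu> *s Y t) absolutely_integrable_on {0..1}"
      by (intro absolutely_integrable_continuous_real bounded_bilinear.continuous_on[OF bounded_bilinear_vector_smult]
        Y continuous_on_const)
    with absolutely_integrable_continuous_real[OF f]
      absolutely_integrable_bilinear_left[OF bounded_bilinear_matrix_vector_mult Y aV]
    show "(\<lambda>t. V t *v Y t - \<mu> *s Y t - f t) absolutely_integrable_on {0..1}"
      by (intro set_integral_diff)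
  qed auto
  from y(1,2) have "schrodinger_solution V \<mu> f y y' (\<lambda>t. V t *v y t - \<mu> *s y t - f t)"
    by (simp add: schrodinger_solution_def)
  then show ?thesis using y(3,4) by (rule that)
qed

text \<open>The Wronskian \<open>\<langle>y, z'\<rangle> - \<langle>y', z\<rangle>\<close> has derivative \<open>\<langle>y, z''\<rangle> - \<langle>y'', z\<rangle>\<close>, in which \<open>V\<close> cancels because it is
  Hermitian almost everywhere.\<close>

lemma lagrange_identity:
  fixes V :: "real \<Rightarrow> complex^'n^'n"
  assumes V: "hermitian_potential V"
    and y: "schrodinger_solution V \<mu> (\<lambda>x. 0) y y' y''" and z: "schrodinger_solution V \<nu> (\<lambda>x. 0) z z' z''"
  shows "cinner (y 1) (z' 1) - cinner (y' 1) (z 1) - (cinner (y 0) (z' 0) - cinner (y' 0) (z 0))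
    = (\<mu> - cnj \<nu>) * integral {0..1} (\<lambda>t. cinner (y t) (z t))"
proof -
  interpret c: bounded_bilinear "cinner :: complex^'n \<Rightarrow> complex^'n \<Rightarrow> complex" by (rule bounded_bilinear_cinner)
  note yd = y[unfolded schrodinger_solution_def] and zd = z[unfolded schrodinger_solution_def]
  have "ac_deriv (\<lambda>x. cinner (y x) (z' x) - cinner (y' x) (z x))
     (\<lambda>x. cinner (y' x) (z' x) + cinner (y x) (z'' x) - (cinner (y'' x) (z x) + cinner (y' x) (z' x)))"
    using yd zd by (intro ac_deriv_diff ac_deriv_bilinear[OF bounded_bilinear_cinner]) auto
  then have "ac_deriv (\<lambda>x. cinner (y x) (z' x) - cinner (y' x) (z x)) (\<lambda>x. (\<mu> - cnj \<nu>) * cinner (y x) (z x))"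
  proof (rule ac_deriv_cong_AE)
    have "AE x in lebesgue. x \<in> {0<..<1} \<longrightarrow> hermitian (V x)" using V by (simp add: hermitian_potential_def)
    then show "AE x in lebesgue. x \<in> {0<..<1} \<longrightarrow>
       cinner (y' x) (z' x) + cinner (y x) (z'' x) - (cinner (y'' x) (z x) + cinner (y' x) (z' x)) =
       (\<mu> - cnj \<nu>) * cinner (y x) (z x)"
      using yd[THEN conjunct2, THEN conjunct2] zd[THEN conjunct2, THEN conjunct2]
    proof eventually_elim
      case (elim x)
      show ?case
      proof
        assume x: "x \<in> {0<..<1}"
        show "cinner (y' x) (z' x) + cinner (y x) (z'' x) - (cinner (y'' x) (z x) + cinner (y' x) (z' x)) =
          (\<mu> - cnj \<nu>) * cinner (y x) (z x)"
          unfolding elim(2)[rule_format, OF x] elim(3)[rule_format, OF x]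
          by (simp add: c.diff_left c.diff_right c.zero_left c.zero_right cinner_smult_left cinner_smult_right
            cinner_hermitian[OF elim(1)[rule_format, OF x]] algebra_simps)
      qed
    qed
  qed
  from ac_derivD(2)[OF this, of 1] show ?thesis by simp
qed

section \<open>The fundamental solution and its dependence on the spectral parameter\<close>

lemma ac_deriv_cong:
  assumes "ac_deriv g g'" "\<And>x. x \<in> {0..1} \<Longrightarrow> h x = g x"
  shows "ac_deriv h g'"
  unfolding ac_deriv_def
proof (intro conjI ballI)
  show "g' absolutely_integrable_on {0..1}" by (rule ac_derivD(1)[OF assms(1)])
  fix x :: real assume x: "x \<in> {0..1}"
  have "g x = g 0 + integral {0..x} g'" by (rule ac_derivD(2)[OF assms(1) x])
  then show "h x = h 0 + integral {0..x} g'" using assms(2)[OF x] assms(2)[of 0] by simp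
qed

lemma mat_vector_mult: "mat c *v v = c *s (v :: complex^'n)"
  by (simp add: vec_eq_iff matrix_vector_mult_def mat_def if_distrib if_distribR cong: if_cong)

text \<open>The condition that characterizes \<open>fundamental_solution\<close>, with the first derivative made explicit.\<close>

definition fundamental_pair ::
  "(real \<Rightarrow> complex^'n^'n) \<Rightarrow> complex \<Rightarrow> (real \<Rightarrow> complex^'n^'n) \<Rightarrow> (real \<Rightarrow> complex^'n^'n) \<Rightarrow> bool" where
  "fundamental_pair V \<mu> \<phi> \<phi>' \<longleftrightarrow>
     (\<exists>\<phi>''. ac_deriv \<phi> \<phi>' \<and> ac_deriv \<phi>' \<phi>'' \<and> \<phi> 0 = 0 \<and> \<phi>' 0 = mat 1 \<and>
        (AE x in lebesgue. x \<in> {0<..<1} \<longrightarrow> - \<phi>'' x + V x ** \<phi> x = mat \<mu> ** \<phi> x))"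

lemma fundamental_pair_column:
  fixes V :: "real \<Rightarrow> complex^'n^'n"
  assumes "fundamental_pair V \<mu> \<phi> \<phi>'"
  obtains y'' where "schrodinger_solution V \<mu> (\<lambda>x. 0) (\<lambda>x. \<phi> x *v h) (\<lambda>x. \<phi>' x *v h) y''"
proof -
  obtain \<phi>'' where p: "ac_deriv \<phi> \<phi>'" "ac_deriv \<phi>' \<phi>''"
     "AE x in lebesgue. x \<in> {0<..<1} \<longrightarrow> - \<phi>'' x + V x ** \<phi> x = mat \<mu> ** \<phi> x"
    using assms unfolding fundamental_pair_def by blast
  have bl: "bounded_linear (\<lambda>M::complex^'n^'n. M *v h)"
    by (rule bounded_bilinear.bounded_linear_left[OF bounded_bilinear_matrix_vector_mult])
  have "AE x in lebesgue. x \<in> {0<..<1} \<longrightarrow> \<phi>'' x *v h = V x *v (\<phi> x *v h) - \<mu> *s (\<phi> x *v h) - 0"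
    using p(3)
  proof eventually_elim
    case (elim x)
    show ?case
    proof
      assume "x \<in> {0<..<1}"
      then have "\<phi>'' x = V x ** \<phi> x - mat \<mu> ** \<phi> x" using elim by (simp add: algebra_simps)
      then show "\<phi>'' x *v h = V x *v (\<phi> x *v h) - \<mu> *s (\<phi> x *v h) - 0"
        by (simp add: matrix_vector_mult_diff_rdistrib mat_vector_mult flip: matrix_vector_mul_assoc)
    qed
  qed
  then have "schrodinger_solution V \<mu> (\<lambda>x. 0) (\<lambda>x. \<phi> x *v h) (\<lambda>x. \<phi>' x *v h) (\<lambda>x. \<phi>'' x *v h)"
    using ac_deriv_linear[OF bl p(1)] ac_deriv_linear[OF bl p(2)] by (simp add: schrodinger_solution_def)
  then show ?thesis by (rule that)
qed

lemma fundamental_pair_exists: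
  fixes V :: "real \<Rightarrow> complex^'n^'n"
  assumes V: "hermitian_potential V"
  obtains \<phi> \<phi>' where "fundamental_pair V \<mu> \<phi> \<phi>'" "\<And>x. x \<notin> {0..1} \<Longrightarrow> \<phi> x = 0"
proof -
  obtain C where C: "C > 0" "\<And>(A::complex^'n^'n) (B::complex^'n^'n). norm (A ** B) \<le> norm A * norm B * C"
    using bounded_bilinear.pos_bounded[OF bounded_bilinear_matrix_matrix_mult] by blast
  note aV = potential_absolutely_integrable[OF V]
  define W where "W t = V t - mat \<mu>" for t
  have aW: "W absolutely_integrable_on {0..1}" unfolding W_def
    by (intro set_integral_diff aV absolutely_integrable_on_const) simp
  obtain y y' where y: "ac_deriv y y'" "ac_deriv y' (\<lambda>t. W t ** y t)" "y 0 = 0" "y' 0 = mat 1"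
  proof (rule second_order_exists[where Q = "\<lambda>t u. W t ** u" and q = "\<lambda>t. C * norm (W t)" and a = 0 and b = "mat 1"])
    show "(\<lambda>t. C * norm (W t)) absolutely_integrable_on {0..1}"
      using absolutely_integrable_norm[OF aW] by (intro set_integrable_mult_right) (simp add: o_def)
    show "C * norm (W x) \<ge> 0" for x using C(1) by simp
    show "norm (W t ** u - W t ** v) \<le> C * norm (W t) * norm (u - v)" for t and u v :: "complex^'n^'n"
      using C(2)[of "W t" "u - v"]
      by (simp add: bounded_bilinear.diff_right[OF bounded_bilinear_matrix_matrix_mult] algebra_simps)
    show "(\<lambda>t. W t ** Y t) absolutely_integrable_on {0..1}" if "continuous_on {0..1} Y" for Y :: "real \<Rightarrow> complex^'n^'n"
      by (rule absolutely_integrable_bilinear_left[OF bounded_bilinear_matrix_matrix_mult that aW])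
  qed
  define \<phi> where "\<phi> x = (if x \<in> {0..1} then y x else 0)" for x
  show ?thesis
  proof (rule that[of \<phi> y'])
    show "\<phi> x = 0" if "x \<notin> {0..1}" for x using that by (auto simp: \<phi>_def)
    have "AE x in lebesgue. x \<in> {0<..<1} \<longrightarrow> - (W x ** y x) + V x ** \<phi> x = mat \<mu> ** \<phi> x"
      by (intro AE_I2) (auto simp: \<phi>_def W_def bounded_bilinear.diff_left[OF bounded_bilinear_matrix_matrix_mult])
    moreover have "ac_deriv \<phi> y'" by (rule ac_deriv_cong[OF y(1)]) (simp add: \<phi>_def)
    ultimately show "fundamental_pair V \<mu> \<phi> y'"
      unfolding fundamental_pair_def using y by (intro exI[of _ "\<lambda>t. W t ** y t"]) (simp add: \<phi>_def)
  qed
qed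

text \<open>The derivative is determined on \<open>[0,1]\<close> only, by continuity; the choice outside is arbitrary.\<close>

definition fundamental_derivative ::
  "(real \<Rightarrow> complex^'n^'n) \<Rightarrow> complex \<Rightarrow> real \<Rightarrow> complex^'n^'n" where
  "fundamental_derivative V \<mu> = (SOME \<phi>'. fundamental_pair V \<mu> (fundamental_solution V \<mu>) \<phi>')"

lemma fundamental_solution_pair:
  fixes V :: "real \<Rightarrow> complex^'n^'n"
  assumes V: "hermitian_potential V"
  shows "fundamental_pair V \<mu> (fundamental_solution V \<mu>) (fundamental_derivative V \<mu>)"
    and "x \<notin> {0..1} \<Longrightarrow> fundamental_solution V \<mu> x = 0"
proof -
  have eq: "fundamental_solution V \<mu> = (THE \<phi>. (\<forall>x. x \<notin> {0..1} \<longrightarrow> \<phi> x = 0) \<and> (\<exists>\<phi>'. fundamental_pair V \<mu> \<phi> \<phi>'))"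
    unfolding fundamental_solution_def fundamental_pair_def ..
  obtain \<phi> \<phi>' where \<phi>: "fundamental_pair V \<mu> \<phi> \<phi>'" "\<And>x. x \<notin> {0..1} \<Longrightarrow> \<phi> x = 0"
    using fundamental_pair_exists[OF V] by blast
  have "fundamental_solution V \<mu> = \<phi>"
    unfolding eq
  proof (rule the_equality)
    show "(\<forall>x. x \<notin> {0..1} \<longrightarrow> \<phi> x = 0) \<and> (\<exists>\<phi>'. fundamental_pair V \<mu> \<phi> \<phi>')" using \<phi> by blast
    fix \<psi> assume "(\<forall>x. x \<notin> {0..1} \<longrightarrow> \<psi> x = 0) \<and> (\<exists>\<phi>'. fundamental_pair V \<mu> \<psi> \<phi>')"
    then obtain \<psi>' where \<psi>: "\<And>x. x \<notin> {0..1} \<Longrightarrow> \<psi> x = 0" "fundamental_pair V \<mu> \<psi> \<psi>'" by blast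
    show "\<psi> = \<phi>"
    proof
      fix x
      show "\<psi> x = \<phi> x"
      proof (cases "x \<in> {0..1}")
        case True
        have "\<psi> x *v h = \<phi> x *v h" for h
        proof -
          obtain y'' z'' where
            "schrodinger_solution V \<mu> (\<lambda>x. 0) (\<lambda>x. \<phi> x *v h) (\<lambda>x. \<phi>' x *v h) y''"
            "schrodinger_solution V \<mu> (\<lambda>x. 0) (\<lambda>x. \<psi> x *v h) (\<lambda>x. \<psi>' x *v h) z''"
            using fundamental_pair_column[OF \<phi>(1)] fundamental_pair_column[OF \<psi>(2)] by metis
          from schrodinger_solution_unique(1)[OF V this(2,1) _ _ True] show ?thesis
            using \<phi>(1) \<psi>(2) unfolding fundamental_pair_def by auto
        qed
        then show ?thesis by (simp add: matrix_eq)
      qed (simp add: \<phi>(2) \<psi>(1))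
    qed
  qed
  note eq' = this
  show "fundamental_pair V \<mu> (fundamental_solution V \<mu>) (fundamental_derivative V \<mu>)"
    unfolding fundamental_derivative_def by (rule someI[of _ \<phi>']) (simp add: eq' \<phi>(1))
  show "fundamental_solution V \<mu> x = 0" if "x \<notin> {0..1}"
    using \<phi>(2)[OF that] by (simp add: eq')
qed

lemma fundamental_solution_initial:
  assumes "hermitian_potential V"
  shows "fundamental_solution V \<mu> 0 = 0" "fundamental_derivative V \<mu> 0 = mat 1"
  using fundamental_solution_pair(1)[OF assms] unfolding fundamental_pair_def by auto

lemma fundamental_solution_column:
  assumes "hermitian_potential V"
  obtains y'' where "schrodinger_solution V \<mu> (\<lambda>x. 0)
    (\<lambda>x. fundamental_solution V \<mu> x *v h) (\<lambda>x. fundamental_derivative V \<mu> x *v h) y''"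
  using fundamental_pair_column[OF fundamental_solution_pair(1)[OF assms]] by blast

lemma solution_eq_fundamental_column:
  fixes V :: "real \<Rightarrow> complex^'n^'n"
  assumes V: "hermitian_potential V" and y: "schrodinger_solution V \<mu> (\<lambda>x. 0) y y' y''"
    and "y 0 = 0" "x \<in> {0..1}"
  shows "y x = fundamental_solution V \<mu> x *v (y' 0)"
proof -
  obtain z'' where "schrodinger_solution V \<mu> (\<lambda>x. 0)
    (\<lambda>x. fundamental_solution V \<mu> x *v (y' 0)) (\<lambda>x. fundamental_derivative V \<mu> x *v (y' 0)) z''"
    using fundamental_solution_column[OF V] by blast
  from schrodinger_solution_unique(1)[OF V y this _ _ assms(4)] show ?thesis
    using assms(3) by (simp add: fundamental_solution_initial[OF V])
qed

lemma continuous_on_fundamental_column: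
  assumes "hermitian_potential V"
  shows "continuous_on {0..1} (\<lambda>x. fundamental_solution V \<mu> x *v h)"
  using fundamental_solution_column[OF assms, of \<mu> h] ac_deriv_continuous
  unfolding schrodinger_solution_def by metis

lemma has_field_derivative_quadratic_remainder:
  fixes f :: "complex \<Rightarrow> complex"
  assumes "\<And>z. cmod (z - a) \<le> 1 \<Longrightarrow> cmod (f z - f a - (z - a) * D) \<le> C * (cmod (z - a))\<^sup>2"
  shows "(f has_field_derivative D) (at a)"
  unfolding has_field_derivative_iff
proof (rule LIM_zero_cancel, rule Lim_null_comparison)
  have "\<forall>\<^sub>F z in at a. z \<noteq> a \<and> dist z a < 1"
    by (auto simp: eventually_at intro: exI[of _ 1])
  then show "\<forall>\<^sub>F z in at a. norm ((f z - f a) / (z - a) - D) \<le> C * cmod (z - a)"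
  proof eventually_elim
    case (elim z)
    have "norm ((f z - f a) / (z - a) - D) = cmod (f z - f a - (z - a) * D) / cmod (z - a)"
      using elim by (simp add: norm_divide[symmetric] diff_divide_distrib)
    also have "\<dots> \<le> C * (cmod (z - a))\<^sup>2 / cmod (z - a)"
      using elim by (intro divide_right_mono assms) (auto simp: dist_norm)
    also have "\<dots> = C * cmod (z - a)" using elim by (simp add: power2_eq_square)
    finally show ?case .
  qed
  show "((\<lambda>z. C * cmod (z - a)) \<longlongrightarrow> 0) (at a)" by (rule tendsto_eq_intros refl | simp)+
qed

text \<open>Write \<open>y\<^sub>\<mu> = \<phi>(\<cdot>,\<mu>) h\<close>. The difference \<open>y\<^sub>\<mu> - y\<^sub>\<nu>\<close> solves the equation for \<open>\<nu>\<close> with source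
  \<open>(\<mu> - \<nu>) y\<^sub>\<mu>\<close> and zero initial data, so it is \<open>O(\<bar>\<mu> - \<nu>\<bar>)\<close>. If \<open>w\<close> solves the linearized equation, whose
  source is \<open>y\<^sub>\<nu>\<close>, then \<open>y\<^sub>\<mu> - y\<^sub>\<nu> - (\<mu> - \<nu>) w\<close> has source \<open>(\<mu> - \<nu>) (y\<^sub>\<mu> - y\<^sub>\<nu>)\<close> and is \<open>O(\<bar>\<mu> - \<nu>\<bar>\<^sup>2)\<close>. So
  \<open>w\<close> is the complex derivative.\<close>

lemma fundamental_solution_parameter_dependence:
  fixes V :: "real \<Rightarrow> complex^'n^'n"
  assumes V: "hermitian_potential V"
  shows "\<exists>C\<ge>0. \<forall>\<mu>. cmod (\<mu> - \<nu>) \<le> 1 \<longrightarrow> (\<forall>x\<in>{0..1}.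
    norm (fundamental_solution V \<mu> x *v h - fundamental_solution V \<nu> x *v h) \<le> C * cmod (\<mu> - \<nu>))"
    and "(\<lambda>\<mu>. (fundamental_solution V \<mu> 1 *v h) $ i) field_differentiable (at \<nu>)"
proof -
  let ?y = "\<lambda>\<mu> x. fundamental_solution V \<mu> x *v h"
  let ?y' = "\<lambda>\<mu> x. fundamental_derivative V \<mu> x *v h"
  define y'' where "y'' \<mu> = (SOME z. schrodinger_solution V \<mu> (\<lambda>x. 0) (?y \<mu>) (?y' \<mu>) z)" for \<mu>
  have y: "schrodinger_solution V \<mu> (\<lambda>x. 0) (?y \<mu>) (?y' \<mu>) (y'' \<mu>)" for \<mu>
  proof -
    obtain z where "schrodinger_solution V \<mu> (\<lambda>x. 0) (?y \<mu>) (?y' \<mu>) z"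
      using fundamental_solution_column[OF V, of \<mu> h] by blast
    then show ?thesis
      unfolding y''_def by (rule someI[where P = "schrodinger_solution V \<mu> (\<lambda>x. 0) (?y \<mu>) (?y' \<mu>)"])
  qed
  note init = fundamental_solution_initial[OF V]
  obtain K :: real where K: "K > 0"
    "\<And>\<mu> f y y' y'' r x. cmod \<mu> \<le> cmod \<nu> + 1 \<Longrightarrow> schrodinger_solution V \<mu> f y y' y'' \<Longrightarrow> r \<ge> 0 \<Longrightarrow>
      (\<And>x. x \<in> {0..1} \<Longrightarrow> norm (f x) \<le> r) \<Longrightarrow> x \<in> {0..1} \<Longrightarrow>
      norm (y x) + norm (y' x) \<le> K * (norm (y 0) + norm (y' 0) + r)"
    using schrodinger_solution_bound[OF V] by blast
  have near: "cmod \<mu> \<le> cmod \<nu> + 1" if "cmod (\<mu> - \<nu>) \<le> 1" for \<mu>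
    using norm_triangle_ineq2[of \<mu> \<nu>] that by linarith
  have bound: "norm (?y \<mu> x) \<le> K * norm h" if "cmod (\<mu> - \<nu>) \<le> 1" "x \<in> {0..1}" for \<mu> x
  proof -
    have "norm (?y \<mu> x) + norm (?y' \<mu> x) \<le> K * norm h"
      using K(2)[OF near[OF that(1)] y, of 0 x] that(2) by (simp add: init)
    then show ?thesis using norm_ge_zero[of "?y' \<mu> x"] by linarith
  qed
  define C where "C = K * (K * norm h)"
  have C0: "C \<ge> 0" using K(1) by (simp add: C_def)
  have dsol: "schrodinger_solution V \<nu> (\<lambda>x. (0 + (\<mu> - \<nu>) *s ?y \<mu> x) - 0) (\<lambda>x. ?y \<mu> x - ?y \<nu> x)
      (\<lambda>x. ?y' \<mu> x - ?y' \<nu> x) (\<lambda>x. y'' \<mu> x - y'' \<nu> x)" for \<mu>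
    by (rule schrodinger_solution_diff[OF schrodinger_solution_shift_parameter[OF y] y])
  have lip: "norm (?y \<mu> x - ?y \<nu> x) \<le> C * cmod (\<mu> - \<nu>)" if m: "cmod (\<mu> - \<nu>) \<le> 1" and x: "x \<in> {0..1}" for \<mu> x
  proof -
    have "norm (?y \<mu> x - ?y \<nu> x) + norm (?y' \<mu> x - ?y' \<nu> x)
       \<le> K * (norm (?y \<mu> 0 - ?y \<nu> 0) + norm (?y' \<mu> 0 - ?y' \<nu> 0) + cmod (\<mu> - \<nu>) * (K * norm h))"
    proof (rule K(2)[OF _ dsol _ _ x])
      fix x :: real assume "x \<in> {0..1}"
      then show "norm (0 + (\<mu> - \<nu>) *s ?y \<mu> x - 0) \<le> cmod (\<mu> - \<nu>) * (K * norm h)"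
        unfolding add_0_left diff_0_right norm_complex_vector_smult by (intro mult_left_mono bound[OF m]) auto
    qed (use K(1) in auto)
    also have "\<dots> = C * cmod (\<mu> - \<nu>)" by (simp add: init C_def)
    finally show ?thesis using norm_ge_zero[of "?y' \<mu> x - ?y' \<nu> x"] by linarith
  qed
  obtain w w' w'' where w: "schrodinger_solution V \<nu> (?y \<nu>) w w' w''" "w 0 = 0" "w' 0 = 0"
    by (rule schrodinger_solution_exists[OF V continuous_on_fundamental_column[OF V]])
  have rem: "norm (?y \<mu> 1 - ?y \<nu> 1 - (\<mu> - \<nu>) *s w 1) \<le> K * C * (cmod (\<mu> - \<nu>))\<^sup>2"
    if m: "cmod (\<mu> - \<nu>) \<le> 1" for \<mu>
  proof -
    \<comment> \<open>The remainder of the linearization, as a solution with quadratically small source.\<close>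
    note rsol = schrodinger_solution_diff[OF dsol schrodinger_solution_smult[OF w(1)], of \<mu> "\<mu> - \<nu>"]
    have "norm (?y \<mu> 1 - ?y \<nu> 1 - (\<mu> - \<nu>) *s w 1) + norm (?y' \<mu> 1 - ?y' \<nu> 1 - (\<mu> - \<nu>) *s w' 1)
      \<le> K * (norm (?y \<mu> 0 - ?y \<nu> 0 - (\<mu> - \<nu>) *s w 0) + norm (?y' \<mu> 0 - ?y' \<nu> 0 - (\<mu> - \<nu>) *s w' 0)
         + cmod (\<mu> - \<nu>) * (C * cmod (\<mu> - \<nu>)))"
    proof (rule K(2)[OF _ rsol])
      fix x :: real assume x: "x \<in> {0..1}"
      have eq: "(0 + (\<mu> - \<nu>) *s ?y \<mu> x) - 0 - (\<mu> - \<nu>) *s ?y \<nu> x = (\<mu> - \<nu>) *s (?y \<mu> x - ?y \<nu> x)"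
        by (simp only: vector_ssub_ldistrib add_0_left diff_0_right)
      show "norm ((0 + (\<mu> - \<nu>) *s ?y \<mu> x) - 0 - (\<mu> - \<nu>) *s ?y \<nu> x) \<le> cmod (\<mu> - \<nu>) * (C * cmod (\<mu> - \<nu>))"
        unfolding eq norm_complex_vector_smult by (intro mult_left_mono lip[OF m x]) simp
    qed (use C0 in auto)
    also have "\<dots> = K * C * (cmod (\<mu> - \<nu>))\<^sup>2" by (simp add: init w power2_eq_square)
    finally show ?thesis using norm_ge_zero[of "?y' \<mu> 1 - ?y' \<nu> 1 - (\<mu> - \<nu>) *s w' 1"] by linarith
  qed
  have "((\<lambda>\<mu>. ?y \<mu> 1 $ i) has_field_derivative (w 1 $ i)) (at \<nu>)"
  proof (rule has_field_derivative_quadratic_remainder)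
    fix \<mu> assume "cmod (\<mu> - \<nu>) \<le> 1"
    from order_trans[OF Finite_Cartesian_Product.norm_nth_le[where i = i] rem[OF this]]
    show "cmod (?y \<mu> 1 $ i - ?y \<nu> 1 $ i - (\<mu> - \<nu>) * w 1 $ i) \<le> K * C * (cmod (\<mu> - \<nu>))\<^sup>2"
      by (simp only: vector_minus_component vector_smult_component)
  qed
  then show "(\<lambda>\<mu>. (fundamental_solution V \<mu> 1 *v h) $ i) field_differentiable (at \<nu>)"
    unfolding field_differentiable_def by blast
  show "\<exists>C\<ge>0. \<forall>\<mu>. cmod (\<mu> - \<nu>) \<le> 1 \<longrightarrow> (\<forall>x\<in>{0..1}.
    norm (?y \<mu> x - ?y \<nu> x) \<le> C * cmod (\<mu> - \<nu>))"
    using C0 lip by blast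
qed

lemma holomorphic_fundamental_solution:
  assumes "hermitian_potential V"
  shows "(\<lambda>\<mu>. (fundamental_solution V \<mu> 1 *v h) $ i) holomorphic_on S"
  unfolding holomorphic_on_def
  using fundamental_solution_parameter_dependence(2)[OF assms] by (blast intro: field_differentiable_at_within)

section \<open>Asymptotics for large spectral parameters\<close>

lemma matrix_vector_mult_axis: "(A *v axis j 1) $ i = (A :: complex^'n^'m) $ i $ j"
  by (simp add: matrix_vector_mult_def axis_def if_distrib if_distribR cong: if_cong)

lemma norm_axis_complex: "norm (axis j 1 :: complex^'n) = 1"
proof -
  have "(norm ((axis j 1 :: complex^'n) $ i))\<^sup>2 = (if i = j then 1 else 0)" for i by (simp add: axis_def)
  then show ?thesis by (simp add: norm_vec_def L2_set_def)
qed

lemma ac_deriv_of_C1: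
  fixes g :: "real \<Rightarrow> 'a::euclidean_space"
  assumes "\<And>t. (g has_vector_derivative g' t) (at t)" "continuous_on {0..1} g'"
  shows "ac_deriv g g'"
  unfolding ac_deriv_def
proof (intro conjI ballI)
  show "g' absolutely_integrable_on {0..1}" by (rule absolutely_integrable_continuous_real[OF assms(2)])
  fix x :: real assume "x \<in> {0..1}"
  then have "(g' has_integral (g x - g 0)) {0..x}"
    by (intro fundamental_theorem_of_calculus) (auto intro: has_vector_derivative_at_within assms(1))
  then show "g x = g 0 + integral {0..x} g'" by (simp add: integral_unique)
qed

text \<open>With \<open>s(t) = sin (k (x - t)) / k\<close> and \<open>c(t) = cos (k (x - t))\<close>, the function \<open>s y' + c y\<close> has derivative
  \<open>s (y'' + k\<^sup>2 y) = s V y\<close>; integrate from \<open>0\<close> to \<open>x\<close>.\<close>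

lemma variation_of_constants:
  fixes V :: "real \<Rightarrow> complex^'n^'n"
  assumes V: "hermitian_potential V" and k: "k \<noteq> 0" and x: "x \<in> {0..1}"
    and y: "schrodinger_solution V (k\<^sup>2) (\<lambda>x. 0) y y' y''" and y0: "y 0 = 0"
  shows "y x = (sin (k * of_real x) / k) *s y' 0 +
    integral {0..x} (\<lambda>t. (sin (k * of_real (x - t)) / k) *s (V t *v y t))"
    and "(\<lambda>t. (sin (k * of_real (x - t)) / k) *s (V t *v y t)) absolutely_integrable_on {0..1}"
proof -
  define s where "s t = sin (k * of_real (x - t)) / k" for t
  define c where "c t = cos (k * of_real (x - t))" for t
  have s: "ac_deriv s (\<lambda>t. - c t)"
  proof (rule ac_deriv_of_C1)
    show "(s has_vector_derivative - c t) (at t)" for t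
      unfolding s_def[abs_def] c_def using k
      by (intro has_vector_derivative_real_field derivative_eq_intros refl | simp)+
    show "continuous_on {0..1} (\<lambda>t. - c t)" unfolding c_def by (intro continuous_intros)
  qed
  have c: "ac_deriv c (\<lambda>t. k\<^sup>2 * s t)"
  proof (rule ac_deriv_of_C1)
    show "(c has_vector_derivative k\<^sup>2 * s t) (at t)" for t
      unfolding c_def[abs_def] s_def using k
      by (intro has_vector_derivative_real_field derivative_eq_intros refl | simp add: power2_eq_square)+
    show "continuous_on {0..1} (\<lambda>t. k\<^sup>2 * s t)" unfolding s_def using k by (intro continuous_intros) auto
  qed
  note yd = y[unfolded schrodinger_solution_def]
  have "ac_deriv (\<lambda>t. s t *s y' t + c t *s y t)
     (\<lambda>t. ((- c t) *s y' t + s t *s y'' t) + ((k\<^sup>2 * s t) *s y t + c t *s y' t))"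
    using yd by (intro ac_deriv_add ac_deriv_bilinear[OF bounded_bilinear_vector_smult] s c) auto
  then have ac: "ac_deriv (\<lambda>t. s t *s y' t + c t *s y t) (\<lambda>t. s t *s (V t *v y t))"
  proof (rule ac_deriv_cong_AE)
    show "AE t in lebesgue. t \<in> {0<..<1} \<longrightarrow>
       ((- c t) *s y' t + s t *s y'' t) + ((k\<^sup>2 * s t) *s y t + c t *s y' t) = s t *s (V t *v y t)"
      using yd[THEN conjunct2, THEN conjunct2]
    proof eventually_elim
      case (elim t)
      show ?case
      proof
        assume t: "t \<in> {0<..<1}"
        show "((- c t) *s y' t + s t *s y'' t) + ((k\<^sup>2 * s t) *s y t + c t *s y' t) = s t *s (V t *v y t)"
          unfolding elim[rule_format, OF t] by (simp add: vec_eq_iff algebra_simps)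
      qed
    qed
  qed
  from ac_derivD(2)[OF this x]
  show "y x = (sin (k * of_real x) / k) *s y' 0 +
    integral {0..x} (\<lambda>t. (sin (k * of_real (x - t)) / k) *s (V t *v y t))"
    by (simp add: s_def c_def y0)
  show "(\<lambda>t. (sin (k * of_real (x - t)) / k) *s (V t *v y t)) absolutely_integrable_on {0..1}"
    using ac_derivD(1)[OF ac] by (simp add: s_def)
qed

lemma cmod_sin_le: "cmod (sin z) \<le> exp \<bar>Im z\<bar>"
proof -
  have "cmod (sin z) = cmod (exp (\<i> * z) - exp (- (\<i> * z))) / 2"
    by (simp add: sin_exp_eq norm_divide norm_mult)
  also have "\<dots> \<le> (cmod (exp (\<i> * z)) + cmod (exp (- (\<i> * z)))) / 2"
    by (intro divide_right_mono norm_triangle_ineq4) simp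
  also have "\<dots> = (exp (- Im z) + exp (Im z)) / 2" by simp
  also have "\<dots> \<le> (exp \<bar>Im z\<bar> + exp \<bar>Im z\<bar>) / 2" by (intro divide_right_mono add_mono) auto
  finally show ?thesis by simp
qed

text \<open>Let \<open>M\<close> be the maximum of \<open>\<bar>y(x)\<bar> exp (- \<bar>Im k\<bar> x)\<close>, where \<open>y = \<phi>(\<cdot>,k\<^sup>2) h\<close>. Variation of constants
  bounds \<open>y - (sin (k x) / k) h\<close> by \<open>exp (\<bar>Im k\<bar> x) M L / \<bar>k\<bar>\<close> with a constant \<open>L\<close>. For \<open>\<bar>k\<bar> \<ge> 2 L\<close>
  this first gives \<open>M \<le> 2 \<bar>h\<bar> / \<bar>k\<bar>\<close> and then, with this value of \<open>M\<close>, the error bound.\<close>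

lemma fundamental_solution_asymptotics:
  fixes V :: "real \<Rightarrow> complex^'n^'n"
  assumes V: "hermitian_potential V"
  obtains C where "C > 0" "\<And>k h. cmod k \<ge> C \<Longrightarrow>
    norm (fundamental_solution V (k\<^sup>2) 1 *v h - (sin k / k) *s h) \<le> C * exp \<bar>Im k\<bar> / (cmod k)\<^sup>2 * norm h"
proof -
  obtain B where B: "B > 0" "\<And>(A::complex^'n^'n) v. norm (A *v v) \<le> norm A * norm v * B"
    using bounded_bilinear.pos_bounded[OF bounded_bilinear_matrix_vector_mult] by blast
  have nV: "(\<lambda>t. norm (V t)) absolutely_integrable_on {0..1}"
    using absolutely_integrable_norm[OF potential_absolutely_integrable[OF V]] by (simp add: o_def)
  define L where "L = B * integral {0..1} (\<lambda>t. norm (V t))"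
  have L0: "L \<ge> 0" unfolding L_def using B(1) integrable_subinterval01[OF nV, of 0 1]
    by (intro mult_nonneg_nonneg Henstock_Kurzweil_Integration.integral_nonneg) auto
  show ?thesis
  proof (rule that[of "2 * L + 1"])
    show "2 * L + 1 > 0" using L0 by simp
    fix k h assume kC: "cmod k \<ge> 2 * L + 1"
    then have k0: "k \<noteq> 0" and kpos: "cmod k > 0" using L0 by auto
    define b where "b = \<bar>Im k\<bar>"
    define y where "y x = fundamental_solution V (k\<^sup>2) x *v h" for x
    obtain y' y'' where y: "schrodinger_solution V (k\<^sup>2) (\<lambda>x. 0) y y' y''" "y 0 = 0" "y' 0 = h"
      unfolding y_def[abs_def] using fundamental_solution_column[OF V, of "k\<^sup>2" h] fundamental_solution_initial[OF V]
      by (metis matrix_vector_mul_lid matrix_vector_mult_0)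
    have cy: "continuous_on {0..1} y" unfolding y_def[abs_def] by (rule continuous_on_fundamental_column[OF V])
    then have "continuous_on {0..1} (\<lambda>x. norm (y x) * exp (- b * x))" by (intro continuous_intros)
    from continuous_attains_sup[OF _ _ this] obtain x0 where
      x0: "x0 \<in> {0..1}" "\<And>x. x \<in> {0..1} \<Longrightarrow> norm (y x) * exp (- b * x) \<le> norm (y x0) * exp (- b * x0)" by auto
    define M where "M = norm (y x0) * exp (- b * x0)"
    have M0: "M \<ge> 0" by (simp add: M_def)
    have yM: "norm (y t) \<le> M * exp (b * t)" if "t \<in> {0..1}" for t
    proof -
      have "norm (y t) * exp (- b * t) * exp (b * t) \<le> M * exp (b * t)"
        using x0(2)[OF that] by (intro mult_right_mono) (auto simp: M_def)
      then show ?thesis by (simp add: mult.assoc flip: exp_add)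
    qed
    have sb: "cmod (sin (k * of_real u) / k) \<le> exp (b * u) / cmod k" if "u \<ge> 0" for u
      using cmod_sin_le[of "k * of_real u"] that
      by (simp add: norm_divide divide_right_mono b_def abs_mult)
    have est: "norm (y x - (sin (k * of_real x) / k) *s h) \<le> exp (b * x) * (M * L / cmod k)" if x: "x \<in> {0..1}" for x
    proof -
      let ?g = "\<lambda>t. (exp (b * x) * M * B / cmod k) * norm (V t)"
      have "norm (integral {0..x} (\<lambda>t. (sin (k * of_real (x - t)) / k) *s (V t *v y t))) \<le> integral {0..x} ?g"
      proof (rule Henstock_Kurzweil_Integration.integral_norm_bound_integral)
        show "(\<lambda>t. (sin (k * of_real (x - t)) / k) *s (V t *v y t)) integrable_on {0..x}"
          by (rule integrable_subinterval01[OF variation_of_constants(2)[OF V k0 x y(1,2)]]) (use x in auto)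
        show "?g integrable_on {0..x}"
          by (intro integrable_on_mult_right integrable_subinterval01[OF nV]) (use x in auto)
        fix t assume t: "t \<in> {0..x}"
        have "norm ((sin (k * of_real (x - t)) / k) *s (V t *v y t))
           \<le> (exp (b * (x - t)) / cmod k) * (norm (V t) * (M * exp (b * t)) * B)"
          unfolding norm_complex_vector_smult using t x B(1) M0
          by (intro mult_mono sb order_trans[OF B(2)] mult_right_mono mult_left_mono yM) auto
        also have "\<dots> = (exp (b * (x - t)) * exp (b * t)) * M * B / cmod k * norm (V t)"
          by (simp add: field_simps)
        also have "exp (b * (x - t)) * exp (b * t) = exp (b * x)"
          by (simp add: algebra_simps flip: exp_add)
        finally show "norm ((sin (k * of_real (x - t)) / k) *s (V t *v y t)) \<le> ?g t" .
      qed
      also have "\<dots> = (exp (b * x) * M * B / cmod k) * integral {0..x} (\<lambda>t. norm (V t))" by (rule integral_mult_right)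
      also have "\<dots> \<le> (exp (b * x) * M * B / cmod k) * integral {0..1} (\<lambda>t. norm (V t))"
        using x M0 B(1) integrable_subinterval01[OF nV] by (intro mult_left_mono integral_subset_le) auto
      also have "\<dots> = exp (b * x) * (M * L / cmod k)" by (simp add: L_def)
      finally show ?thesis using variation_of_constants(1)[OF V k0 x y(1,2)] by (simp add: y(3))
    qed
    have "norm (y x0) \<le> norm (y x0 - (sin (k * of_real x0) / k) *s h) + norm ((sin (k * of_real x0) / k) *s h)"
      by (metis add.commute norm_triangle_sub)
    also have "\<dots> \<le> exp (b * x0) * (M * L / cmod k) + exp (b * x0) / cmod k * norm h"
      unfolding norm_complex_vector_smult using x0(1) by (intro add_mono est mult_right_mono sb) auto
    finally have "norm (y x0) * exp (- b * x0) \<le> (exp (b * x0) * (M * L / cmod k) + exp (b * x0) / cmod k * norm h) * exp (- b * x0)"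
      by (intro mult_right_mono) auto
    also have "\<dots> = (exp (b * x0) * exp (- b * x0)) * (M * L / cmod k + norm h / cmod k)"
      by (simp add: algebra_simps)
    also have "exp (b * x0) * exp (- b * x0) = 1" by (simp flip: exp_add)
    finally have "M \<le> M * L / cmod k + norm h / cmod k" by (simp add: M_def)
    moreover have "M * L / cmod k \<le> M / 2"
    proof -
      \<comment> \<open>This is where \<open>\<bar>k\<bar> \<ge> 2 L\<close> enters; the threshold \<open>2 L + 1\<close> also keeps \<open>k\<close> away from \<open>0\<close>.\<close>
      have "M * L \<le> M * (cmod k / 2)" using kC M0 by (intro mult_left_mono) auto
      then show ?thesis using kpos by (simp add: pos_divide_le_eq)
    qed
    ultimately have "M / 2 \<le> norm h / cmod k" by argo
    then have M: "M \<le> 2 * norm h / cmod k" by (simp add: mult.commute)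
    have "norm (y 1 - (sin k / k) *s h) \<le> exp b * (M * L / cmod k)" using est[of 1] by simp
    also have "\<dots> \<le> exp b * ((2 * norm h / cmod k) * L / cmod k)"
      using M L0 kpos by (intro mult_left_mono divide_right_mono mult_right_mono) auto
    also have "\<dots> = (2 * L) * exp b / (cmod k)\<^sup>2 * norm h" by (simp add: power2_eq_square)
    also have "\<dots> \<le> (2 * L + 1) * exp b / (cmod k)\<^sup>2 * norm h"
      by (intro mult_right_mono divide_right_mono) auto
    finally show "norm (fundamental_solution V (k\<^sup>2) 1 *v h - (sin k / k) *s h)
       \<le> (2 * L + 1) * exp \<bar>Im k\<bar> / (cmod k)\<^sup>2 * norm h" by (simp add: y_def b_def)
  qed
qed

text \<open>For \<open>\<bar>Im k\<bar> \<ge> 1\<close> the hyperbolic part of \<open>\<bar>sin k\<bar>\<^sup>2\<close> dominates. For \<open>\<bar>Im k\<bar> < 1\<close> the number \<open>\<bar>Re k\<bar>\<close> is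
  within \<open>2/3 < \<pi>/4\<close> of \<open>\<pi> (n + 1/2)\<close>, so \<open>cos (2 Re k) \<le> 0\<close>.\<close>

lemma cmod_sin_ge:
  assumes "cmod k = pi * (real n + 1/2)"
  shows "cmod (sin k) \<ge> exp \<bar>Im k\<bar> / 3"
proof -
  define a where "a = \<bar>Re k\<bar>"
  define b where "b = \<bar>Im k\<bar>"
  define R where "R = pi * (real n + 1/2)"
  have R: "R \<ge> 3/2" "R\<^sup>2 = a\<^sup>2 + b\<^sup>2"
  proof -
    have "3 * (1/2) \<le> pi * (real n + 1/2)" using pi_gt3 by (intro mult_mono) auto
    then show "R \<ge> 3/2" by (simp add: R_def)
    show "R\<^sup>2 = a\<^sup>2 + b\<^sup>2" using cmod_power2[of k] assms by (simp add: R_def a_def b_def)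
  qed
  have nn: "a \<ge> 0" "b \<ge> 0" by (auto simp: a_def b_def)
  have cos_le: "(exp b)\<^sup>2 / 2 \<ge> 2 * cos (2 * a)"
  proof (cases "b \<ge> 1")
    case True
    have "(2::real) \<le> exp 1" using exp_ge_add_one_self[of 1] by simp
    also have "\<dots> \<le> exp b" using True by simp
    finally have "2\<^sup>2 \<le> (exp b)\<^sup>2" by (intro power_mono) auto
    moreover have "cos (2 * a) \<le> 1" by simp
    ultimately show ?thesis by (simp only: power2_eq_square)
  next
    case False
    have "(R - a) * (R + a) = b\<^sup>2" using R(2) by (simp add: power2_eq_square algebra_simps)
    moreover have "b\<^sup>2 \<le> 1" using False nn by (simp add: power_le_one)
    moreover have aR: "a \<le> R"
    proof (rule power2_le_imp_le)
      show "a\<^sup>2 \<le> R\<^sup>2" unfolding R(2) by simp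
      show "0 \<le> R" using R(1) by simp
    qed
    moreover have "(R - a) * (3/2) \<le> (R - a) * (R + a)" using aR R(1) nn by (intro mult_left_mono) auto
    ultimately have "2 * (R - a) \<le> pi / 2" using pi_gt3 by linarith
    then have "cos (2 * (R - a)) \<ge> 0" using aR by (intro cos_ge_zero) auto
    moreover have "cos (2 * a) = - cos (2 * (R - a))"
    proof -
      have "2 * a = real (2 * n + 1) * pi - 2 * (R - a)" by (simp add: R_def algebra_simps)
      then have "cos (2 * a) = cos (real (2 * n + 1) * pi - 2 * (R - a))" by (rule arg_cong)
      also have "\<dots> = - cos (2 * (R - a))" unfolding cos_diff cos_npi sin_npi by simp
      finally show ?thesis .
    qed
    ultimately show ?thesis using zero_le_power2[of "exp b"] by linarith
  qed
  have "(cmod (sin k))\<^sup>2 = (exp (2 * Im k) + inverse (exp (2 * Im k)) - 2 * cos (2 * Re k)) / 4"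
    by (rule norm_sin_squared)
  also have "exp (2 * Im k) + inverse (exp (2 * Im k)) \<ge> (exp b)\<^sup>2"
    by (cases "Im k \<ge> 0") (auto simp: b_def power2_eq_square exp_minus[symmetric] simp flip: exp_add)
  then have "(exp (2 * Im k) + inverse (exp (2 * Im k)) - 2 * cos (2 * Re k)) / 4 \<ge> ((exp b)\<^sup>2 - (exp b)\<^sup>2 / 2) / 4"
    using cos_le by (cases "Re k \<ge> 0") (auto simp: a_def)
  finally have "(cmod (sin k))\<^sup>2 \<ge> (exp b)\<^sup>2 / 8" by simp
  moreover have "(exp b / 3)\<^sup>2 \<le> (exp b)\<^sup>2 / 8" by (simp add: power_divide)
  ultimately have "(exp b / 3)\<^sup>2 \<le> (cmod (sin k))\<^sup>2" by linarith
  then have "exp b / 3 \<le> cmod (sin k)" by (rule power2_le_imp_le) simp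
  then show ?thesis unfolding b_def .
qed

text \<open>On these circles \<open>\<bar>sin k / k\<bar>\<close> lies between \<open>G / 3\<close> and \<open>G\<close>, where \<open>G = exp \<bar>Im k\<bar> / \<bar>k\<bar>\<close>, and the
  remaining part of \<open>\<phi>(1,\<mu>)\<close> is at most \<open>G / 72\<close> once \<open>n\<close> is large. Then \<open>\<bar>\<phi>(1,\<mu>) h\<bar> \<le> 2 G \<bar>h\<bar>\<close> and
  \<open>\<bar>det \<phi>(1,\<mu>)\<bar> \<ge> G\<^sup>2 / 18\<close>.\<close>

lemma fundamental_solution_circle_bound:
  fixes V :: "real \<Rightarrow> complex^2^2"
  assumes V: "hermitian_potential V"
  obtains n0 :: nat where "\<And>n \<mu> h. n \<ge> n0 \<Longrightarrow> cmod \<mu> = (pi * (real n + 1/2))\<^sup>2 \<Longrightarrow>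
    det (fundamental_solution V \<mu> 1) \<noteq> 0 \<and>
    (norm (fundamental_solution V \<mu> 1 *v h))\<^sup>2 \<le> 72 * (norm h)\<^sup>2 * cmod (det (fundamental_solution V \<mu> 1))"
proof -
  obtain C where C: "C > 0" "\<And>k h. cmod k \<ge> C \<Longrightarrow>
    norm (fundamental_solution V (k\<^sup>2) 1 *v h - (sin k / k) *s h) \<le> C * exp \<bar>Im k\<bar> / (cmod k)\<^sup>2 * norm h"
    using fundamental_solution_asymptotics[OF V] by blast
  obtain n0 :: nat where n0: "real n0 \<ge> 72 * C" using real_arch_simple by blast
  show ?thesis
  proof (rule that[of n0])
    fix n \<mu> and h :: "complex^2"
    assume n: "n \<ge> n0" and \<mu>: "cmod \<mu> = (pi * (real n + 1/2))\<^sup>2"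
    define k where "k = csqrt \<mu>"
    have k2: "k\<^sup>2 = \<mu>" by (simp add: k_def)
    have ck: "cmod k = pi * (real n + 1/2)"
    proof -
      have "(cmod k)\<^sup>2 = (pi * (real n + 1/2))\<^sup>2" using \<mu> k2 by (metis norm_power)
      then show ?thesis by (rule power2_eq_imp_eq) auto
    qed
    have "1 * real n \<le> pi * (real n + 1/2)" using pi_gt3 by (intro mult_mono) auto
    then have kC: "cmod k \<ge> 72 * C" using n n0 ck by linarith
    then have kpos: "cmod k > 0" and kC': "cmod k \<ge> C" using C(1) by auto
    define D where "D = fundamental_solution V \<mu> 1"
    define G where "G = exp \<bar>Im k\<bar> / cmod k"
    define s where "s = sin k / k"
    have G0: "G > 0" using kpos by (simp add: G_def)
    have s_le: "cmod s \<le> G" using cmod_sin_le[of k] kpos by (simp add: s_def G_def norm_divide divide_right_mono)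
    have s_ge: "cmod s \<ge> G / 3"
      using cmod_sin_ge[OF ck] kpos by (simp add: s_def G_def norm_divide divide_simps)
    have dev: "norm (D *v v - s *s v) \<le> G / 72 * norm v" for v
    proof -
      have "norm (D *v v - s *s v) \<le> C * exp \<bar>Im k\<bar> / (cmod k)\<^sup>2 * norm v"
        using C(2)[OF kC', of v] by (simp add: D_def s_def k2)
      also have "C * exp \<bar>Im k\<bar> / (cmod k)\<^sup>2 = G * (C / cmod k)" by (simp add: G_def power2_eq_square)
      also have "G * (C / cmod k) \<le> G * (1/72)"
        using kC kpos G0 by (intro mult_left_mono) (auto simp: pos_divide_le_eq)
      finally show ?thesis by (simp add: mult_right_mono)
    qed
    have ent: "cmod (D $ i $ j - (if i = j then s else 0)) \<le> G / 72" for i j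
    proof -
      have "(axis j 1 :: complex^2) $ i = (if i = j then 1 else 0)" by (simp add: axis_def)
      then have "(D *v axis j 1 - s *s axis j 1) $ i = D $ i $ j - (if i = j then s else 0)"
        by (simp add: matrix_vector_mult_axis)
      then show ?thesis using dev[of "axis j 1"] Finite_Cartesian_Product.norm_nth_le[of "D *v axis j 1 - s *s axis j 1" i]
        by (simp add: norm_axis_complex)
    qed
    define e11 e12 e21 e22 where e: "e11 = D $ 1 $ 1 - s" "e12 = D $ 1 $ 2" "e21 = D $ 2 $ 1" "e22 = D $ 2 $ 2 - s"
    have en: "cmod e11 \<le> G / 72" "cmod e12 \<le> G / 72" "cmod e21 \<le> G / 72" "cmod e22 \<le> G / 72"
      using ent[of 1 1] ent[of 1 2] ent[of 2 1] ent[of 2 2] by (auto simp: e)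
    have "det D = s * s - (- (s * (e11 + e22)) - e11 * e22 + e12 * e21)" by (simp add: det_2 e algebra_simps)
    then have "cmod (det D) \<ge> cmod (s * s) - cmod (- (s * (e11 + e22)) - e11 * e22 + e12 * e21)"
      using norm_triangle_ineq2[of "s * s" "- (s * (e11 + e22)) - e11 * e22 + e12 * e21"] by simp
    moreover have "cmod (- (s * (e11 + e22)) - e11 * e22 + e12 * e21) \<le> G * (G/72 + G/72) + (G/72) * (G/72) + (G/72) * (G/72)"
    proof -
      have "cmod (- (s * (e11 + e22)) - e11 * e22 + e12 * e21) \<le> cmod (s * (e11 + e22)) + cmod (e11 * e22) + cmod (e12 * e21)"
        using norm_triangle_ineq[of "- (s * (e11 + e22)) - e11 * e22" "e12 * e21"]
          norm_triangle_ineq4[of "- (s * (e11 + e22))" "e11 * e22"] norm_minus_cancel[of "s * (e11 + e22)"]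
        by linarith
      also have "\<dots> \<le> G * (G/72 + G/72) + (G/72) * (G/72) + (G/72) * (G/72)"
        unfolding norm_mult using s_le en G0 by (intro add_mono mult_mono order_trans[OF norm_triangle_ineq]) auto
      finally show ?thesis .
    qed
    moreover have "cmod (s * s) \<ge> (G/3) * (G/3)" unfolding norm_mult using s_ge G0 by (intro mult_mono) auto
    ultimately have "cmod (det D) \<ge> (G/3) * (G/3) - (G * (G/72 + G/72) + (G/72) * (G/72) + (G/72) * (G/72))" by linarith
    moreover have "(G/3) * (G/3) - (G * (G/72 + G/72) + (G/72) * (G/72) + (G/72) * (G/72)) \<ge> G\<^sup>2 / 18"
      by (simp add: power2_eq_square)
    ultimately have det: "cmod (det D) \<ge> G\<^sup>2 / 18" by linarith
    have "norm (D *v h) \<le> norm (D *v h - s *s h) + norm (s *s h)" by (metis add.commute norm_triangle_sub)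
    also have "\<dots> \<le> G / 72 * norm h + G * norm h"
      unfolding norm_complex_vector_smult using s_le by (intro add_mono dev mult_right_mono) auto
    also have "\<dots> \<le> 2 * G * norm h" using G0 by (simp add: algebra_simps)
    finally have "(norm (D *v h))\<^sup>2 \<le> (2 * G * norm h)\<^sup>2" by (intro power_mono) auto
    also have "\<dots> = 72 * (norm h)\<^sup>2 * (G\<^sup>2 / 18)" by (simp add: power_mult_distrib)
    also have "\<dots> \<le> 72 * (norm h)\<^sup>2 * cmod (det D)" using det by (intro mult_left_mono) auto
    finally have "(norm (D *v h))\<^sup>2 \<le> 72 * (norm h)\<^sup>2 * cmod (det D)" .
    moreover have "G\<^sup>2 / 18 > 0" using G0 by simp
    then have "det D \<noteq> 0" using det by auto
    ultimately show "det (fundamental_solution V \<mu> 1) \<noteq> 0 \<and>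
      (norm (fundamental_solution V \<mu> 1 *v h))\<^sup>2 \<le> 72 * (norm h)\<^sup>2 * cmod (det (fundamental_solution V \<mu> 1))"
      by (simp add: D_def)
  qed
qed

section \<open>Entire functions with matching zeros\<close>

text \<open>The zeros of \<open>g\<close> are removable singularities of \<open>f / g\<close>. The resulting entire function is bounded on
  large circles, hence everywhere by the maximum principle, and Liouville's theorem applies. Asking
  for \<open>\<bar>f\<bar> \<le> C \<bar>g\<bar>\<close> near the zeros of \<open>g\<close> replaces a comparison of multiplicities.\<close>

lemma entire_quotient_constant:
  fixes f g :: "complex \<Rightarrow> complex" and R :: "nat \<Rightarrow> real"
  assumes f: "f holomorphic_on UNIV" and g: "g holomorphic_on UNIV"
    and zeros: "\<And>z0. g z0 = 0 \<Longrightarrow> \<exists>C. \<exists>r>0. \<forall>z\<in>ball z0 r. cmod (f z) \<le> C * cmod (g z)"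
    and R: "filterlim R at_top sequentially"
    and circles: "\<forall>\<^sub>F n in sequentially. \<forall>z. cmod z = R n \<longrightarrow> g z \<noteq> 0 \<and> cmod (f z) \<le> B * cmod (g z)"
  obtains c where "\<And>z. f z = c * g z"
proof -
  obtain \<beta> where \<beta>: "g \<beta> \<noteq> 0"
  proof -
    obtain n where n: "R n \<ge> 0" "\<forall>z. cmod z = R n \<longrightarrow> g z \<noteq> 0 \<and> cmod (f z) \<le> B * cmod (g z)"
      using eventually_happens[OF eventually_conj[OF filterlim_at_top[THEN iffD1, OF R, rule_format, of 0] circles]] by auto
    then show ?thesis using that[of "of_real (R n)"] by simp
  qed
  define q where "q z = f z / g z" for z
  define r where "r z = Lim (at z) q" for z
  have cont: "isCont f z" "isCont g z" for z
    using f g by (auto intro!: continuous_on_interior[of UNIV] holomorphic_on_imp_continuous_on)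
  have r_eq: "r z = q z" if "g z \<noteq> 0" for z
  proof -
    have "isCont q z" unfolding q_def[abs_def] using that by (intro continuous_intros cont)
    then show ?thesis unfolding r_def isCont_def by (intro tendsto_Lim) auto
  qed
  have "r field_differentiable (at z0)" for z0
  proof -
    have "\<exists>e>0. \<forall>z\<in>ball z0 e - {z0}. g z \<noteq> 0"
    proof (cases "g z0 = 0")
      case True
      from isolated_zeros[OF g _ _ _ True _ \<beta>] show ?thesis by (metis UNIV_I connected_UNIV open_UNIV)
    next
      case False
      from continuous_at_avoid[OF cont(2) False] show ?thesis by (auto simp: dist_commute)
    qed
    then obtain e where e: "e > 0" "\<And>z. z \<in> ball z0 e - {z0} \<Longrightarrow> g z \<noteq> 0" by blast
    have holq: "q holomorphic_on (ball z0 e - {z0})" unfolding q_def[abs_def]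
      using e(2) by (intro holomorphic_on_divide holomorphic_on_subset[OF f] holomorphic_on_subset[OF g]) auto
    have "\<exists>h. h holomorphic_on ball z0 e \<and> (\<forall>z\<in>ball z0 e - {z0}. h z = q z)"
    proof (cases "g z0 = 0")
      case True
      then obtain C \<rho> where C: "\<rho> > 0" "\<And>z. z \<in> ball z0 \<rho> \<Longrightarrow> cmod (f z) \<le> C * cmod (g z)" using zeros by blast
      have "\<forall>\<^sub>F z in at z0. cmod (q z) \<le> C"
        unfolding eventually_at
      proof (intro exI[of _ "min e \<rho>"] conjI ballI impI)
        fix z assume z: "z \<noteq> z0 \<and> dist z z0 < min e \<rho>"
        then have "g z \<noteq> 0" using e(2)[of z] by (auto simp: dist_commute)
        moreover have "cmod (f z) \<le> C * cmod (g z)" using C(2)[of z] z by (auto simp: dist_commute)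
        ultimately show "cmod (q z) \<le> C" by (simp add: q_def norm_divide pos_divide_le_eq)
      qed (use e C in auto)
      then show ?thesis using holomorphic_on_extend_bounded[OF holq] e(1) by auto
    next
      case False
      then have "\<forall>z\<in>ball z0 e. g z \<noteq> 0" using e(2) by (metis Diff_iff singletonD)
      then have "q holomorphic_on ball z0 e" unfolding q_def[abs_def]
        by (intro holomorphic_on_divide holomorphic_on_subset[OF f] holomorphic_on_subset[OF g]) auto
      then show ?thesis by blast
    qed
    then obtain h where h: "h holomorphic_on ball z0 e" "\<And>z. z \<in> ball z0 e - {z0} \<Longrightarrow> h z = q z" by blast
    have "r z = h z" if z: "z \<in> ball z0 e" for z
    proof (cases "z = z0")
      case True
      have "isCont h z0" using h(1) e(1)
        by (metis centre_in_ball continuous_on_eq_continuous_at holomorphic_on_imp_continuous_on open_ball)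
      then have "(h \<longlongrightarrow> h z0) (at z0)" by (simp add: isCont_def)
      then have "(q \<longlongrightarrow> h z0) (at z0)"
        by (rule Lim_transform_within_open[OF _ open_ball[of z0 e]]) (use e h(2) in auto)
      then show ?thesis unfolding r_def True by (intro tendsto_Lim) auto
    next
      case False
      then show ?thesis using h(2)[of z] e(2)[of z] r_eq[of z] z by auto
    qed
    then have "r holomorphic_on ball z0 e" by (rule holomorphic_transform[OF h(1), OF sym])
    then show ?thesis using e(1) by (intro holomorphic_on_imp_differentiable_at) auto
  qed
  then have holr: "r holomorphic_on UNIV" unfolding holomorphic_on_def by (auto intro: field_differentiable_at_within)
  have "cmod (r z) \<le> B" for z
  proof -
    have "\<forall>\<^sub>F n in sequentially. R n \<ge> cmod z + 1"
      using R unfolding filterlim_at_top by blast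
    then obtain n where n: "R n \<ge> cmod z + 1" "\<forall>z. cmod z = R n \<longrightarrow> g z \<noteq> 0 \<and> cmod (f z) \<le> B * cmod (g z)"
      using eventually_happens[OF eventually_conj[OF _ circles]] by (metis (no_types, lifting) sequentially_bot)
    have Rn: "R n > 0" using n(1) norm_ge_zero[of z] by linarith
    show ?thesis
    proof (rule maximum_modulus_frontier[of r "ball 0 (R n)"])
      show "r holomorphic_on interior (ball 0 (R n))" by (rule holomorphic_on_subset[OF holr]) simp
      show "continuous_on (closure (ball 0 (R n))) r"
        by (rule continuous_on_subset[OF holomorphic_on_imp_continuous_on[OF holr]]) simp
      show "z \<in> ball 0 (R n)" using n(1) by simp
      fix w :: complex assume "w \<in> frontier (ball 0 (R n))"
      then have w: "cmod w = R n" using Rn by simp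
      then have "g w \<noteq> 0" "cmod (f w) \<le> B * cmod (g w)" using n(2) by auto
      then show "cmod (r w) \<le> B" by (simp add: r_eq q_def norm_divide pos_divide_le_eq)
    qed simp
  qed
  then have "bounded (range r)" by (auto simp: bounded_iff)
  then have "r constant_on UNIV" by (rule Liouville_theorem[OF holr])
  then obtain c where c: "\<And>z. r z = c" by (auto simp: constant_on_def)
  show ?thesis
  proof (rule that[of c])
    fix z show "f z = c * g z"
    proof (cases "g z = 0")
      case True
      then obtain C \<rho> where "\<rho> > 0" "\<And>w. w \<in> ball z \<rho> \<Longrightarrow> cmod (f w) \<le> C * cmod (g w)" using zeros by blast
      from this(2)[of z] this(1) show ?thesis using True by simp
    next
      case False
      then show ?thesis using r_eq[OF False] c[of z] by (simp add: q_def field_simps)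
    qed
  qed
qed

lemma holomorphic_zero_bound:
  assumes "f holomorphic_on UNIV" "f z0 = 0"
  obtains C r where "C > 0" "r > 0" "\<And>z. z \<in> ball z0 r \<Longrightarrow> cmod (f z) \<le> C * cmod (z - z0)"
proof -
  obtain D where "(f has_field_derivative D) (at z0)"
    using holomorphic_on_imp_differentiable_at[OF assms(1)] unfolding field_differentiable_def by auto
  then have "((\<lambda>z. f z / (z - z0)) \<longlongrightarrow> D) (at z0)" using assms(2) by (simp add: has_field_derivative_iff)
  then have "((\<lambda>z. cmod (f z / (z - z0))) \<longlongrightarrow> cmod D) (at z0)" by (rule tendsto_norm)
  then have "\<forall>\<^sub>F z in at z0. cmod (f z / (z - z0)) < cmod D + 1" by (rule order_tendstoD) simp
  then obtain r where r: "r > 0" "\<And>z. z \<noteq> z0 \<Longrightarrow> dist z z0 < r \<Longrightarrow> cmod (f z / (z - z0)) < cmod D + 1"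
    unfolding eventually_at by auto
  show ?thesis
  proof (rule that[of "cmod D + 1" r])
    fix z assume z: "z \<in> ball z0 r"
    show "cmod (f z) \<le> (cmod D + 1) * cmod (z - z0)"
    proof (cases "z = z0")
      case False
      then have "cmod (f z) / cmod (z - z0) < cmod D + 1" using r(2)[of z] z by (simp add: dist_commute norm_divide)
      then show ?thesis using False by (simp add: pos_divide_less_eq)
    qed (simp add: assms(2))
  qed (use r in \<open>auto intro: add_nonneg_pos\<close>)
qed

lemma holomorphic_det_2:
  fixes D :: "complex \<Rightarrow> complex^2^2"
  assumes "\<And>h i. (\<lambda>\<mu>. (D \<mu> *v h) $ i) holomorphic_on UNIV"
  shows "(\<lambda>\<mu>. det (D \<mu>)) holomorphic_on UNIV"
proof -
  have "(\<lambda>\<mu>. D \<mu> $ i $ j) holomorphic_on UNIV" for i j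
    using assms[of "axis j 1" i] by (simp add: matrix_vector_mult_axis)
  then show ?thesis unfolding det_2 by (intro holomorphic_intros)
qed

text \<open>Both sides are compared by orders of zeros. The column \<open>D(\<mu>) h\<close> vanishes at \<open>b\<close> and at all zeros of
  \<open>det D\<close> other than \<open>a\<close>, so the left-hand side vanishes to order at least one at \<open>a\<close> and two at the other
  zeros, whereas \<open>(\<mu> - b) det D\<close> vanishes to order at most one at \<open>a\<close> and two at the other zeros. The
  growth on the circles is the same because \<open>\<bar>\<mu> - a\<bar> \<le> 3 \<bar>\<mu> - b\<bar>\<close> there.\<close>

lemma quadratic_column_identity:
  fixes D :: "complex \<Rightarrow> complex^2^2"
  assumes hol: "\<And>h i. (\<lambda>\<mu>. (D \<mu> *v h) $ i) holomorphic_on UNIV"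
    and circle: "\<And>n \<mu> h. n \<ge> n0 \<Longrightarrow> cmod \<mu> = (pi * (real n + 1/2))\<^sup>2 \<Longrightarrow>
       det (D \<mu>) \<noteq> 0 \<and> (norm (D \<mu> *v h))\<^sup>2 \<le> K * (norm h)\<^sup>2 * cmod (det (D \<mu>))"
    and ab: "a \<noteq> b" and h: "D b *v h = 0"
    and simple: "\<And>\<mu>. \<mu> = a \<or> \<mu> = b \<Longrightarrow> \<exists>c>0. \<exists>r>0. \<forall>z\<in>ball \<mu> r. c * cmod (z - \<mu>) \<le> cmod (det (D z))"
    and double: "\<And>\<mu>. \<mu> \<noteq> a \<Longrightarrow> \<mu> \<noteq> b \<Longrightarrow> det (D \<mu>) = 0 \<Longrightarrow>
      D \<mu> = 0 \<and> (\<exists>c>0. \<exists>r>0. \<forall>z\<in>ball \<mu> r. c * (cmod (z - \<mu>))\<^sup>2 \<le> cmod (det (D z)))"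
  obtains c where "\<And>\<mu>. (D \<mu> *v h) $ i * (D \<mu> *v h) $ j * (\<mu> - a) = c * ((\<mu> - b) * det (D \<mu>))"
proof -
  define f where "f \<mu> = (D \<mu> *v h) $ i * (D \<mu> *v h) $ j * (\<mu> - a)" for \<mu>
  define g where "g \<mu> = (\<mu> - b) * det (D \<mu>)" for \<mu>
  define R where "R n = (pi * (real n + 1/2))\<^sup>2" for n
  have holf: "f holomorphic_on UNIV" unfolding f_def[abs_def] by (intro holomorphic_intros hol)
  have holg: "g holomorphic_on UNIV" unfolding g_def[abs_def] by (intro holomorphic_intros holomorphic_det_2 hol)
  have R: "filterlim R at_top sequentially"
  proof (rule filterlim_at_top_mono[OF filterlim_real_sequentially], rule always_eventually, rule allI)
    fix n :: nat
    have "1 * (real n + 1/2) \<le> pi * (real n + 1/2)" using pi_gt3 by (intro mult_right_mono) auto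
    then have "(real n + 1/2)\<^sup>2 \<le> R n" unfolding R_def by (intro power_mono) auto
    moreover have "real n \<le> (real n + 1/2)\<^sup>2"
      using zero_le_power2[of "real n"] by (simp add: power2_sum)
    ultimately show "real n \<le> R n" by linarith
  qed
  have circ: "\<forall>\<^sub>F n in sequentially. \<forall>z. cmod z = R n \<longrightarrow> g z \<noteq> 0 \<and> cmod (f z) \<le> (3 * (\<bar>K\<bar> * (norm h)\<^sup>2)) * cmod (g z)"
  proof -
    have "\<forall>\<^sub>F n in sequentially. R n \<ge> cmod a + 2 * cmod b + 1" using R unfolding filterlim_at_top by blast
    then show ?thesis using eventually_ge_at_top[of n0]
    proof eventually_elim
      case (elim n)
      show ?case
      proof (intro allI impI)
        fix z assume z: "cmod z = R n"
        from circle[OF elim(2) z[unfolded R_def], of h]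
        have det: "det (D z) \<noteq> 0" and bd: "(norm (D z *v h))\<^sup>2 \<le> K * (norm h)\<^sup>2 * cmod (det (D z))" by auto
        have "cmod (z - a) \<le> cmod z + cmod a" by (rule norm_triangle_ineq4)
        moreover have "cmod z - cmod b \<le> cmod (z - b)" by (rule norm_triangle_ineq2)
        ultimately have zab: "cmod (z - a) \<le> 3 * cmod (z - b)" "cmod (z - b) > 0"
          using elim(1) z norm_ge_zero[of a] norm_ge_zero[of b] by linarith+
        have "cmod ((D z *v h) $ i * (D z *v h) $ j) \<le> norm (D z *v h) * norm (D z *v h)"
          unfolding norm_mult by (intro mult_mono Finite_Cartesian_Product.norm_nth_le) auto
        also have "\<dots> \<le> K * (norm h)\<^sup>2 * cmod (det (D z))" using bd by (simp add: power2_eq_square)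
        also have "\<dots> \<le> \<bar>K\<bar> * (norm h)\<^sup>2 * cmod (det (D z))" by (intro mult_right_mono) auto
        finally have "cmod (f z) \<le> \<bar>K\<bar> * (norm h)\<^sup>2 * cmod (det (D z)) * (3 * cmod (z - b))"
          unfolding f_def norm_mult[of "_ * _" "z - a"] using zab by (intro mult_mono) auto
        then show "g z \<noteq> 0 \<and> cmod (f z) \<le> (3 * (\<bar>K\<bar> * (norm h)\<^sup>2)) * cmod (g z)"
          using det zab by (auto simp: g_def norm_mult mult_ac)
      qed
    qed
  qed
  have zeros: "\<exists>C. \<exists>r>0. \<forall>z\<in>ball z0 r. cmod (f z) \<le> C * cmod (g z)" if g0: "g z0 = 0" for z0
  proof -
    define F where "F z = (D z *v h) $ i * (D z *v h) $ j" for z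
    \<comment> \<open>It suffices to compare both functions with a common power \<open>X\<close> of the distance to \<open>z0\<close>.\<close>
    have key: ?thesis
      if up: "C > 0" "r1 > 0" "\<And>z. z \<in> ball z0 r1 \<Longrightarrow> cmod (f z) \<le> C * X z"
        and lo: "c > 0" "r2 > 0" "\<And>z. z \<in> ball z0 r2 \<Longrightarrow> c * X z \<le> cmod (g z)" for C r1 c r2 :: real and X
    proof (intro exI conjI ballI)
      show "min r1 r2 > 0" using that by simp
      fix z assume z: "z \<in> ball z0 (min r1 r2)"
      have "cmod (f z) \<le> C * X z" using up(3) z by auto
      also have "\<dots> = (C / c) * (c * X z)" using lo(1) by simp
      also have "\<dots> \<le> (C / c) * cmod (g z)" using lo(3)[of z] z up(1) lo(1) by (intro mult_left_mono) auto
      finally show "cmod (f z) \<le> (C / c) * cmod (g z)" .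
    qed
    have col: "\<exists>C>0. \<exists>r>0. \<forall>z\<in>ball z0 r. cmod (F z) \<le> C * (cmod (z - z0))\<^sup>2" if "D z0 *v h = 0"
    proof -
      have z: "(D z0 *v h) $ i = 0" "(D z0 *v h) $ j = 0" using that by simp_all
      obtain C1 r1 where 1: "C1 > 0" "r1 > 0" "\<And>z. z \<in> ball z0 r1 \<Longrightarrow> cmod ((D z *v h) $ i) \<le> C1 * cmod (z - z0)"
        using holomorphic_zero_bound[OF hol z(1)] by blast
      obtain C2 r2 where 2: "C2 > 0" "r2 > 0" "\<And>z. z \<in> ball z0 r2 \<Longrightarrow> cmod ((D z *v h) $ j) \<le> C2 * cmod (z - z0)"
        using holomorphic_zero_bound[OF hol z(2)] by blast
      show ?thesis
      proof (rule exI[of _ "C1 * C2"], rule conjI, simp add: 1 2, rule exI[of _ "min r1 r2"], intro conjI ballI)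
        fix z assume z: "z \<in> ball z0 (min r1 r2)"
        have "cmod (F z) \<le> (C1 * cmod (z - z0)) * (C2 * cmod (z - z0))"
          unfolding F_def norm_mult using 1 2 z by (intro mult_mono) auto
        then show "cmod (F z) \<le> C1 * C2 * (cmod (z - z0))\<^sup>2" by (simp add: power2_eq_square mult_ac)
      qed (use 1 2 in auto)
    qed
    have bnd: "\<exists>C>0. \<exists>r>0. \<forall>z\<in>ball z0 r. cmod (p z) \<le> C" if "p holomorphic_on UNIV" for p
    proof -
      have "(\<lambda>z. p z - p z0) holomorphic_on UNIV" by (intro holomorphic_intros that)
      from holomorphic_zero_bound[OF this, of z0] obtain C r where
        C: "C > 0" "r > 0" "\<And>z. z \<in> ball z0 r \<Longrightarrow> cmod (p z - p z0) \<le> C * cmod (z - z0)" by auto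
      show ?thesis
      proof (rule exI[of _ "cmod (p z0) + C * r"], rule conjI, rule add_nonneg_pos[OF norm_ge_zero],
          simp add: C, rule exI[of _ r], intro conjI ballI)
        fix z assume z: "z \<in> ball z0 r"
        have "cmod (p z) \<le> cmod (p z0) + cmod (p z - p z0)" by (metis norm_triangle_sub)
        also have "\<dots> \<le> cmod (p z0) + C * r"
          using C(3)[OF z] z C(1) by (intro add_left_mono order_trans[OF C(3)[OF z]] mult_left_mono) (auto simp: dist_norm norm_minus_commute)
        finally show "cmod (p z) \<le> cmod (p z0) + C * r" .
      qed (use C in auto)
    qed
    have holF: "F holomorphic_on UNIV" unfolding F_def[abs_def] by (intro holomorphic_intros hol)
    consider "z0 = a" | "z0 = b" | "z0 \<noteq> a" "z0 \<noteq> b" "det (D z0) = 0" using g0 by (auto simp: g_def)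
    then show ?thesis
    proof cases
      case 1
      obtain c r where c: "c > 0" "r > 0" "\<forall>z\<in>ball a r. c * cmod (z - a) \<le> cmod (det (D z))" using simple by blast
      obtain C r1 where C: "C > 0" "r1 > 0" "\<forall>z\<in>ball z0 r1. cmod (F z) \<le> C" using bnd[OF holF] by blast
      define d where "d = cmod (a - b) / 2"
      have d: "d > 0" using ab by (simp add: d_def)
      show ?thesis
      proof (rule key[where X = "\<lambda>z. cmod (z - a)"])
        show "cmod (f z) \<le> C * cmod (z - a)" if "z \<in> ball z0 r1" for z
          using C(3) that unfolding f_def F_def norm_mult[of "_ * _" "z - a"] by (intro mult_right_mono) auto
        show "(d * c) * cmod (z - a) \<le> cmod (g z)" if z: "z \<in> ball z0 (min r d)" for z
        proof -
          have "cmod (a - b) \<le> cmod (a - z) + cmod (z - b)"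
            using norm_triangle_ineq[of "a - z" "z - b"] by simp
          then have "d \<le> cmod (z - b)" using z 1 by (auto simp: d_def dist_norm)
          moreover have "c * cmod (z - a) \<le> cmod (det (D z))" using c(3) z 1 by auto
          ultimately have "d * (c * cmod (z - a)) \<le> cmod (z - b) * cmod (det (D z))"
            using d c by (intro mult_mono) auto
          then show ?thesis by (simp add: g_def norm_mult mult.assoc)
        qed
      qed (use c C d in auto)
    next
      case 2
      obtain c r where c: "c > 0" "r > 0" "\<forall>z\<in>ball b r. c * cmod (z - b) \<le> cmod (det (D z))" using simple by blast
      obtain C r1 where C: "C > 0" "r1 > 0" "\<forall>z\<in>ball z0 r1. cmod (F z) \<le> C * (cmod (z - z0))\<^sup>2" using col 2 h by blast
      have "(\<lambda>z. z - a) holomorphic_on UNIV" by (intro holomorphic_intros)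
      from bnd[OF this] obtain C' r' where C': "C' > 0" "r' > 0" "\<forall>z\<in>ball z0 r'. cmod (z - a) \<le> C'" by blast
      show ?thesis
      proof (rule key[where X = "\<lambda>z. (cmod (z - b))\<^sup>2"])
        show "cmod (f z) \<le> (C * C') * (cmod (z - b))\<^sup>2" if "z \<in> ball z0 (min r1 r')" for z
        proof -
          have "cmod (F z) * cmod (z - a) \<le> (C * (cmod (z - b))\<^sup>2) * C'"
            using C C' that 2 by (intro mult_mono) auto
          then show ?thesis by (simp add: f_def F_def norm_mult mult_ac)
        qed
        show "c * (cmod (z - b))\<^sup>2 \<le> cmod (g z)" if z: "z \<in> ball z0 r" for z
        proof -
          have "cmod (z - b) * (c * cmod (z - b)) \<le> cmod (z - b) * cmod (det (D z))"
            using c(3) z 2 by (intro mult_left_mono) auto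
          then show ?thesis by (simp add: g_def norm_mult power2_eq_square mult_ac)
        qed
      qed (use c C C' in auto)
    next
      case 3
      from double[OF 3] have D0: "D z0 = 0" by blast
      from double[OF 3] obtain c r where c: "c > 0" "r > 0" "\<forall>z\<in>ball z0 r. c * (cmod (z - z0))\<^sup>2 \<le> cmod (det (D z))" by blast
      obtain C r1 where C: "C > 0" "r1 > 0" "\<forall>z\<in>ball z0 r1. cmod (F z) \<le> C * (cmod (z - z0))\<^sup>2" using col D0 by auto
      have "(\<lambda>z. z - a) holomorphic_on UNIV" by (intro holomorphic_intros)
      from bnd[OF this] obtain C' r' where C': "C' > 0" "r' > 0" "\<forall>z\<in>ball z0 r'. cmod (z - a) \<le> C'" by blast
      define d where "d = cmod (z0 - b) / 2"
      have d: "d > 0" using 3 by (simp add: d_def)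
      show ?thesis
      proof (rule key[where X = "\<lambda>z. (cmod (z - z0))\<^sup>2"])
        show "cmod (f z) \<le> (C * C') * (cmod (z - z0))\<^sup>2" if "z \<in> ball z0 (min r1 r')" for z
        proof -
          have "cmod (F z) * cmod (z - a) \<le> (C * (cmod (z - z0))\<^sup>2) * C'"
            using C C' that by (intro mult_mono) auto
          then show ?thesis by (simp add: f_def F_def norm_mult mult_ac)
        qed
        show "(d * c) * (cmod (z - z0))\<^sup>2 \<le> cmod (g z)" if z: "z \<in> ball z0 (min r d)" for z
        proof -
          have "cmod (z0 - b) \<le> cmod (z0 - z) + cmod (z - b)"
            using norm_triangle_ineq[of "z0 - z" "z - b"] by simp
          then have "d \<le> cmod (z - b)" using z by (auto simp: d_def dist_norm)
          moreover have "c * (cmod (z - z0))\<^sup>2 \<le> cmod (det (D z))" using c(3) z by auto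
          ultimately have "d * (c * (cmod (z - z0))\<^sup>2) \<le> cmod (z - b) * cmod (det (D z))"
            using d c by (intro mult_mono) auto
          then show ?thesis by (simp add: g_def norm_mult mult.assoc)
        qed
      qed (use c C C' d in auto)
    qed
  qed
  obtain c where "\<And>z. f z = c * g z"
    using entire_quotient_constant[OF holf holg zeros R circ] by blast
  then show ?thesis by (rule that[unfolded f_def[symmetric] g_def[symmetric]])
qed

section \<open>Overlap integrals and the order of the zeros of the determinant\<close>

lemma zero_solution_initial_slope:
  fixes y :: "real \<Rightarrow> 'a::euclidean_space"
  assumes y: "ac_deriv y y'" "continuous_on {0..1} y'" and zero: "\<And>x. x \<in> {0..1} \<Longrightarrow> y x = 0"
  shows "y' 0 = 0"
proof -
  have "((\<lambda>u. integral {0..u} y') has_vector_derivative y' 0) (at 0 within {0..1})"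
    by (rule integral_has_vector_derivative[OF y(2)]) simp
  moreover have "integral {0..u} y' = 0" if "u \<in> {0..1}" for u
    using ac_derivD(2)[OF y(1) that] zero[OF that] zero[of 0] by simp
  then have "((\<lambda>u. integral {0..u} y') has_vector_derivative 0) (at 0 within {0..1})"
    by (intro has_vector_derivative_transform[OF _ _ has_vector_derivative_const[of 0]]) auto
  ultimately show ?thesis
    using vector_derivative_unique_within_closed_interval[of 0 1 0] by simp
qed

lemma fundamental_column_injective:
  fixes V :: "real \<Rightarrow> complex^'n^'n"
  assumes V: "hermitian_potential V" and zero: "\<And>x. x \<in> {0..1} \<Longrightarrow> fundamental_solution V \<mu> x *v h = 0"
  shows "h = 0"
proof -
  obtain y'' where y: "schrodinger_solution V \<mu> (\<lambda>x. 0) (\<lambda>x. fundamental_solution V \<mu> x *v h)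
      (\<lambda>x. fundamental_derivative V \<mu> x *v h) y''"
    using fundamental_solution_column[OF V] by blast
  have "fundamental_derivative V \<mu> 0 *v h = 0"
  proof (rule zero_solution_initial_slope)
    note ac = y[unfolded schrodinger_solution_def, THEN conjunct1]
      y[unfolded schrodinger_solution_def, THEN conjunct2, THEN conjunct1]
    show "ac_deriv (\<lambda>x. fundamental_solution V \<mu> x *v h) (\<lambda>x. fundamental_derivative V \<mu> x *v h)"
      by (rule ac(1))
    show "continuous_on {0..1} (\<lambda>x. fundamental_derivative V \<mu> x *v h)"
      by (rule ac_deriv_continuous[OF ac(2)])
  qed (rule zero)
  then show ?thesis by (simp add: fundamental_solution_initial[OF V])
qed

text \<open>For \<open>\<mu> = \<nu>\<close> this is the sesquilinear form of \<open>gram_matrix\<close>. Allowing different parameters makes it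
  possible to reach the case \<open>\<mu> = \<nu>\<close>, in which Lagrange's identity does not determine the integral, as a
  limit.\<close>

definition overlap ::
  "(real \<Rightarrow> complex^'n^'n) \<Rightarrow> complex \<Rightarrow> complex \<Rightarrow> complex^'n \<Rightarrow> complex^'n \<Rightarrow> complex" where
  "overlap V \<mu> \<nu> h k = integral {0..1}
     (\<lambda>t. cinner (fundamental_solution V \<mu> t *v h) (fundamental_solution V \<nu> t *v k))"

lemma overlap_continuous_integrand:
  fixes V :: "real \<Rightarrow> complex^'n^'n"
  assumes "hermitian_potential V"
  shows "continuous_on {0..1} (\<lambda>t. cinner (fundamental_solution V \<mu> t *v h) (fundamental_solution V \<nu> t *v k))"
  by (intro bounded_bilinear.continuous_on[OF bounded_bilinear_cinner] continuous_on_fundamental_column assms)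

lemma overlap_integrable:
  fixes V :: "real \<Rightarrow> complex^'n^'n"
  assumes "hermitian_potential V"
  shows "(\<lambda>t. cinner (fundamental_solution V \<mu> t *v h) (fundamental_solution V \<nu> t *v k)) integrable_on {0..1}"
  by (intro integrable_continuous_real overlap_continuous_integrand assms)

lemma overlap_linear_combination_left:
  fixes V :: "real \<Rightarrow> complex^'n^'n"
  assumes V: "hermitian_potential V"
  shows "overlap V \<mu> \<nu> (c *s h + d *s k) l = c * overlap V \<mu> \<nu> h l + d * overlap V \<mu> \<nu> k l"
proof -
  interpret c: bounded_bilinear "cinner :: complex^'n \<Rightarrow> complex^'n \<Rightarrow> complex" by (rule bounded_bilinear_cinner)
  show ?thesis unfolding overlap_def
    by (simp add: matrix_vector_right_distrib vector_scalar_commute c.add_left cinner_smult_left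
        integral_add overlap_integrable[OF V] integrable_on_mult_right)
qed

lemma overlap_linear_combination_right:
  fixes V :: "real \<Rightarrow> complex^'n^'n"
  assumes V: "hermitian_potential V"
  shows "overlap V \<mu> \<nu> l (c *s h + d *s k) = cnj c * overlap V \<mu> \<nu> l h + cnj d * overlap V \<mu> \<nu> l k"
proof -
  interpret c: bounded_bilinear "cinner :: complex^'n \<Rightarrow> complex^'n \<Rightarrow> complex" by (rule bounded_bilinear_cinner)
  show ?thesis unfolding overlap_def
    by (simp add: matrix_vector_right_distrib vector_scalar_commute c.add_right cinner_smult_right
        integral_add overlap_integrable[OF V] integrable_on_mult_right)
qed

lemma cinner_self: "cinner v v = of_real ((norm v)\<^sup>2)"
proof -
  have "cinner v v = (\<Sum>i\<in>UNIV. of_real ((norm (v $ i))\<^sup>2))"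
    unfolding cinner_def by (intro sum.cong refl) (rule complex_norm_square[symmetric])
  also have "\<dots> = of_real ((norm v)\<^sup>2)" by (simp add: norm_vec_def L2_set_def sum_nonneg)
  finally show ?thesis .
qed

lemma overlap_self_eq_0:
  fixes V :: "real \<Rightarrow> complex^'n^'n"
  assumes V: "hermitian_potential V" and ov: "overlap V \<mu> \<mu> h h = 0"
  shows "h = 0"
proof -
  let ?y = "\<lambda>t. fundamental_solution V \<mu> t *v h"
  have cont: "continuous_on {0..1} (\<lambda>t. (norm (?y t))\<^sup>2)"
    by (intro continuous_intros continuous_on_fundamental_column V)
  have "((\<lambda>t. cinner (?y t) (?y t)) has_integral 0) {0..1}"
    using integrable_integral[OF overlap_integrable[OF V, of \<mu> h \<mu> h]] ov by (simp add: overlap_def)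
  then have "((\<lambda>t. complex_of_real ((norm (?y t))\<^sup>2)) has_integral 0) {0..1}" by (simp add: cinner_self)
  from has_integral_linear[OF this bounded_linear_Re]
  have int: "((\<lambda>t. (norm (?y t))\<^sup>2) has_integral 0) (cbox 0 1)" by (simp add: o_def cbox_interval)
  show ?thesis
  proof (rule fundamental_column_injective[OF V])
    fix t :: real assume t: "t \<in> {0..1}"
    have "(norm (?y t))\<^sup>2 = 0"
      by (rule has_integral_0_cbox_imp_0[OF _ _ int]) (use cont t in \<open>simp_all add: cbox_interval\<close>)
    then show "?y t = 0" by simp
  qed
qed

lemma overlap_isCont:
  fixes V :: "real \<Rightarrow> complex^'n^'n"
  assumes V: "hermitian_potential V"
  shows "isCont (\<lambda>\<mu>. overlap V \<mu> \<nu> h k) \<nu>'"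
proof -
  interpret c: bounded_bilinear "cinner :: complex^'n \<Rightarrow> complex^'n \<Rightarrow> complex" by (rule bounded_bilinear_cinner)
  obtain B where B: "B > 0" "\<And>a b. cmod (cinner a b :: complex) \<le> norm (a::complex^'n) * norm b * B"
    using c.pos_bounded by blast
  obtain C where C: "C \<ge> 0" "\<And>\<mu> x. cmod (\<mu> - \<nu>') \<le> 1 \<Longrightarrow> x \<in> {0..1} \<Longrightarrow>
    norm (fundamental_solution V \<mu> x *v h - fundamental_solution V \<nu>' x *v h) \<le> C * cmod (\<mu> - \<nu>')"
    using fundamental_solution_parameter_dependence(1)[OF V, of \<nu>' h] by blast
  let ?n = "\<lambda>t. norm (fundamental_solution V \<nu> t *v k)"
  have cn: "continuous_on {0..1} ?n" by (intro continuous_intros continuous_on_fundamental_column V)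
  define I where "I = integral {0..1} ?n"
  have bd: "cmod (overlap V \<mu> \<nu> h k - overlap V \<nu>' \<nu> h k) \<le> (C * B * I) * cmod (\<mu> - \<nu>')"
    if m: "cmod (\<mu> - \<nu>') \<le> 1" for \<mu>
  proof -
    have "overlap V \<mu> \<nu> h k - overlap V \<nu>' \<nu> h k = integral {0..1}
       (\<lambda>t. cinner (fundamental_solution V \<mu> t *v h - fundamental_solution V \<nu>' t *v h) (fundamental_solution V \<nu> t *v k))"
      unfolding overlap_def c.diff_left by (intro integral_diff[symmetric] overlap_integrable V)
    also have "cmod \<dots> \<le> integral {0..1} (\<lambda>t. (C * B * cmod (\<mu> - \<nu>')) * ?n t)"
    proof (rule Henstock_Kurzweil_Integration.integral_norm_bound_integral)
      show "(\<lambda>t. cinner (fundamental_solution V \<mu> t *v h - fundamental_solution V \<nu>' t *v h) (fundamental_solution V \<nu> t *v k)) integrable_on {0..1}"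
        unfolding c.diff_left by (intro integrable_diff overlap_integrable V)
      show "(\<lambda>t. (C * B * cmod (\<mu> - \<nu>')) * ?n t) integrable_on {0..1}"
        by (intro integrable_on_mult_right integrable_continuous_real cn)
      fix t :: real assume t: "t \<in> {0..1}"
      have "cmod (cinner (fundamental_solution V \<mu> t *v h - fundamental_solution V \<nu>' t *v h) (fundamental_solution V \<nu> t *v k))
        \<le> (C * cmod (\<mu> - \<nu>')) * ?n t * B"
        using C(2)[OF m t] B(1) by (intro order_trans[OF B(2)] mult_right_mono) auto
      then show "cmod (cinner (fundamental_solution V \<mu> t *v h - fundamental_solution V \<nu>' t *v h) (fundamental_solution V \<nu> t *v k))
        \<le> (C * B * cmod (\<mu> - \<nu>')) * ?n t" by (simp add: mult_ac)
    qed
    also have "\<dots> = (C * B * I) * cmod (\<mu> - \<nu>')" by (simp add: I_def mult_ac)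
    finally show ?thesis .
  qed
  have "((\<lambda>\<mu>. overlap V \<mu> \<nu> h k - overlap V \<nu>' \<nu> h k) \<longlongrightarrow> 0) (at \<nu>')"
  proof (rule Lim_null_comparison)
    have "\<forall>\<^sub>F \<mu> in at \<nu>'. dist \<mu> \<nu>' < 1" by (auto simp: eventually_at intro: exI[of _ 1])
    then show "\<forall>\<^sub>F \<mu> in at \<nu>'. norm (overlap V \<mu> \<nu> h k - overlap V \<nu>' \<nu> h k) \<le> (C * B * I) * cmod (\<mu> - \<nu>')"
      by eventually_elim (auto intro!: bd simp: dist_norm)
    show "((\<lambda>\<mu>. (C * B * I) * cmod (\<mu> - \<nu>')) \<longlongrightarrow> 0) (at \<nu>')" by (rule tendsto_eq_intros refl | simp)+
  qed
  then show ?thesis unfolding isCont_def by (rule LIM_zero_cancel)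
qed

lemma cinner_conj_transpose: "cinner v (conj_transpose A *v w) = cinner (A *v v) w"
proof -
  have "cinner v (conj_transpose A *v w) = (\<Sum>i\<in>UNIV. \<Sum>j\<in>UNIV. v $ i * (A $ j $ i * cnj (w $ j)))"
    by (simp add: cinner_def matrix_vector_mult_def conj_transpose_def transpose_def map_matrix_def sum_distrib_left)
  also have "\<dots> = (\<Sum>j\<in>UNIV. \<Sum>i\<in>UNIV. v $ i * (A $ j $ i * cnj (w $ j)))" by (rule sum.swap)
  also have "\<dots> = cinner (A *v v) w"
    by (simp add: cinner_def matrix_vector_mult_def sum_distrib_left sum_distrib_right mult_ac)
  finally show ?thesis .
qed

lemma cinner_gram_matrix:
  fixes V :: "real \<Rightarrow> complex^'n^'n"
  assumes V: "hermitian_potential V"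
  shows "cinner h (gram_matrix V \<mu> *v k) = overlap V \<mu> \<mu> h k"
proof -
  let ?\<phi> = "fundamental_solution V \<mu>"
  have cont: "continuous_on {0..1} ?\<phi>"
    using fundamental_solution_pair(1)[OF V] ac_deriv_continuous unfolding fundamental_pair_def by blast
  have "linear (conj_transpose :: complex^'n^'n \<Rightarrow> complex^'n^'n)"
    by (auto intro!: linearI simp: conj_transpose_def transpose_def map_matrix_def vec_eq_iff)
  then have "bounded_linear (conj_transpose :: complex^'n^'n \<Rightarrow> complex^'n^'n)"
    by (simp add: linear_conv_bounded_linear)
  from bounded_bilinear.continuous_on[OF bounded_bilinear_matrix_matrix_mult bounded_linear.continuous_on[OF this cont] cont]
  have int: "(\<lambda>t. conj_transpose (?\<phi> t) ** ?\<phi> t) integrable_on {0..1}"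
    by (rule integrable_continuous_real)
  have "bounded_linear (\<lambda>M :: complex^'n^'n. cinner h (M *v k))"
    using bounded_linear_compose[OF bounded_bilinear.bounded_linear_right[OF bounded_bilinear_cinner]
        bounded_bilinear.bounded_linear_left[OF bounded_bilinear_matrix_vector_mult]] .
  from integral_linear[OF int this]
  have "cinner h (gram_matrix V \<mu> *v k) = integral {0..1} (\<lambda>t. cinner h ((conj_transpose (?\<phi> t) ** ?\<phi> t) *v k))"
    by (simp add: gram_matrix_def o_def)
  also have "\<dots> = overlap V \<mu> \<mu> h k"
    unfolding overlap_def by (simp add: cinner_conj_transpose flip: matrix_vector_mul_assoc)
  finally show ?thesis .
qed

text \<open>The boundary terms at \<open>0\<close> vanish by the initial values, and one of those at \<open>1\<close> vanishes because
  \<open>\<phi>(\<cdot>,a) k\<close> is an eigenfunction.\<close>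

lemma lagrange_overlap:
  fixes V :: "real \<Rightarrow> complex^'n^'n"
  assumes V: "hermitian_potential V" and k: "fundamental_solution V (of_real a) 1 *v k = 0"
  shows "cinner (fundamental_solution V \<mu> 1 *v h) (fundamental_derivative V (of_real a) 1 *v k) =
    (\<mu> - of_real a) * overlap V \<mu> (of_real a) h k"
proof -
  interpret c: bounded_bilinear "cinner :: complex^'n \<Rightarrow> complex^'n \<Rightarrow> complex" by (rule bounded_bilinear_cinner)
  obtain y'' z'' where
    "schrodinger_solution V \<mu> (\<lambda>x. 0) (\<lambda>x. fundamental_solution V \<mu> x *v h) (\<lambda>x. fundamental_derivative V \<mu> x *v h) y''"
    "schrodinger_solution V (of_real a) (\<lambda>x. 0) (\<lambda>x. fundamental_solution V (of_real a) x *v k)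
      (\<lambda>x. fundamental_derivative V (of_real a) x *v k) z''"
    using fundamental_solution_column[OF V] by metis
  from lagrange_identity[OF V this] show ?thesis
    using k by (simp add: overlap_def fundamental_solution_initial[OF V] c.zero_left c.zero_right)
qed

text \<open>A common form of the order estimates below: \<open>X\<close> is the modulus of a determinant, \<open>P\<close> a power of
  \<open>\<bar>z - a\<bar>\<close>, and \<open>t\<close> a function that is continuous and nonzero at \<open>a\<close>.\<close>

lemma lower_bound_from_identity:
  fixes t :: "complex \<Rightarrow> complex"
  assumes t: "isCont t a" "t a \<noteq> 0" and eq: "\<And>z. cmod w * X z = P z * cmod (t z)"
    and X: "\<And>z. X z \<ge> 0" and P: "\<And>z. P z \<ge> 0"
  shows "\<exists>c>0. \<exists>r>0. \<forall>z\<in>ball a r. c * P z \<le> (X z :: real)"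
proof -
  define c where "c = cmod (t a) / (2 * (cmod w + 1))"
  have w: "cmod w + 1 > 0" by (rule add_nonneg_pos) auto
  obtain r where r: "r > 0" "\<And>z. dist z a < r \<Longrightarrow> dist (t z) (t a) < cmod (t a) / 2"
    using t unfolding continuous_at_eps_delta by (metis half_gt_zero zero_less_norm_iff)
  have "c > 0" using t(2) w by (simp add: c_def)
  moreover have "c * P z \<le> X z" if z: "z \<in> ball a r" for z
  proof -
    have "cmod (t z - t a) < cmod (t a) / 2"
      using r(2)[of z] z by (simp add: dist_norm norm_minus_commute)
    moreover have "cmod (t a) \<le> cmod (t z) + cmod (t z - t a)" using norm_triangle_ineq4[of "t z" "t z - t a"] by simp
    ultimately have "cmod (t a) / 2 \<le> cmod (t z)" by linarith
    then have "P z * (cmod (t a) / 2) \<le> P z * cmod (t z)" by (intro mult_left_mono P)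
    also have "\<dots> = cmod w * X z" by (simp add: eq)
    also have "\<dots> \<le> (cmod w + 1) * X z" using X by (intro mult_right_mono) auto
    finally have "P z * (cmod (t a) / 2) / (cmod w + 1) \<le> X z"
      unfolding pos_divide_le_eq[OF w] by (simp only: mult.commute)
    moreover have "c * P z = P z * (cmod (t a) / 2) / (cmod w + 1)" by (simp add: c_def mult_ac)
    ultimately show "c * P z \<le> X z" by (simp only:)
  qed
  ultimately show ?thesis using r(1) by blast
qed

lemma overlap_components:
  fixes V :: "real \<Rightarrow> complex^2^2"
  assumes "hermitian_potential V"
  shows "overlap V \<mu> \<nu> h k = h $ 1 * overlap V \<mu> \<nu> (axis 1 1) k + h $ 2 * overlap V \<mu> \<nu> (axis 2 1) k"
    and "overlap V \<mu> \<nu> h k = cnj (k $ 1) * overlap V \<mu> \<nu> h (axis 1 1) + cnj (k $ 2) * overlap V \<mu> \<nu> h (axis 2 1)"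
proof -
  have e: "v = v $ 1 *s axis 1 1 + v $ 2 *s axis 2 1" for v :: "complex^2"
    by (simp add: vec_eq_iff axis_def forall_2)
  show "overlap V \<mu> \<nu> h k = h $ 1 * overlap V \<mu> \<nu> (axis 1 1) k + h $ 2 * overlap V \<mu> \<nu> (axis 2 1) k"
    by (subst e[of h]) (rule overlap_linear_combination_left[OF assms])
  show "overlap V \<mu> \<nu> h k = cnj (k $ 1) * overlap V \<mu> \<nu> h (axis 1 1) + cnj (k $ 2) * overlap V \<mu> \<nu> h (axis 2 1)"
    by (subst e[of k]) (rule overlap_linear_combination_right[OF assms])
qed

lemma isCont_fundamental_entry:
  assumes "hermitian_potential V"
  shows "isCont (\<lambda>\<mu>. fundamental_solution V \<mu> 1 $ i $ j) a"
  using holomorphic_fundamental_solution[OF assms, of "axis j 1" i UNIV]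
  by (auto simp: matrix_vector_mult_axis dest!: holomorphic_on_imp_continuous_on intro: continuous_on_interior)

text \<open>Let \<open>w = \<phi>'(1,a) k\<close> and let \<open>r\<^sub>j(z)\<close> be the overlap of the \<open>j\<close>-th column with \<open>\<phi>(\<cdot>,a) k\<close>. Lagrange's
  identity says \<open>w\<^sup>* D(z) = (z - a) r(z)\<close> as row vectors, and multiplication by the adjugate of \<open>D\<close> yields
  \<open>w\<^sup>* det D(z) = (z - a) r(z) adj D(z)\<close>. The row \<open>r(a) adj D(a)\<close> is not zero: otherwise \<open>(r(a) k) D(a) = 0\<close>,
  although \<open>r(a) k = \<integral> \<bar>\<phi>(t,a) k\<bar>\<^sup>2 dt > 0\<close> and \<open>D(a) \<noteq> 0\<close>.\<close>

lemma det_simple_zero_bound: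
  fixes V :: "real \<Rightarrow> complex^2^2"
  assumes V: "hermitian_potential V"
    and k: "fundamental_solution V (of_real a) 1 *v k = 0" "k \<noteq> 0" and D: "fundamental_solution V (of_real a) 1 \<noteq> 0"
  shows "\<exists>c>0. \<exists>r>0. \<forall>z\<in>ball (of_real a) r. c * cmod (z - of_real a) \<le> cmod (det (fundamental_solution V z 1))"
proof -
  define d where "d z i j = fundamental_solution V z 1 $ i $ j" for z i j
  define \<alpha> where "\<alpha> = complex_of_real a"
  define w where "w = fundamental_derivative V \<alpha> 1 *v k"
  define r where "r z j = overlap V z \<alpha> (axis j 1) k" for z j
  have det: "det (fundamental_solution V z 1) = d z 1 1 * d z 2 2 - d z 1 2 * d z 2 1" for z
    by (simp add: det_2 d_def)
  have lag: "d z 1 j * cnj (w $ 1) + d z 2 j * cnj (w $ 2) = (z - \<alpha>) * r z j" for z j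
    using lagrange_overlap[OF V k(1), of z "axis j 1"]
    by (simp add: cinner_def sum_2 matrix_vector_mult_axis d_def w_def r_def \<alpha>_def)
  define t1 where "t1 z = r z 1 * d z 2 2 - r z 2 * d z 2 1" for z
  define t2 where "t2 z = r z 2 * d z 1 1 - r z 1 * d z 1 2" for z
  have cont: "isCont t1 \<alpha>" "isCont t2 \<alpha>"
    unfolding t1_def[abs_def] t2_def[abs_def] r_def d_def
    by (intro continuous_intros overlap_isCont[OF V] isCont_fundamental_entry[OF V])+
  have e1: "cnj (w $ 1) * det (fundamental_solution V z 1) = (z - \<alpha>) * t1 z" for z
  proof -
    have "cnj (w $ 1) * det (fundamental_solution V z 1) =
      d z 2 2 * (d z 1 1 * cnj (w $ 1) + d z 2 1 * cnj (w $ 2)) - d z 2 1 * (d z 1 2 * cnj (w $ 1) + d z 2 2 * cnj (w $ 2))"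
      by (simp add: det algebra_simps)
    then show ?thesis unfolding lag by (simp add: t1_def algebra_simps)
  qed
  have e2: "cnj (w $ 2) * det (fundamental_solution V z 1) = (z - \<alpha>) * t2 z" for z
  proof -
    have "cnj (w $ 2) * det (fundamental_solution V z 1) =
      d z 1 1 * (d z 1 2 * cnj (w $ 1) + d z 2 2 * cnj (w $ 2)) - d z 1 2 * (d z 1 1 * cnj (w $ 1) + d z 2 1 * cnj (w $ 2))"
      by (simp add: det algebra_simps)
    then show ?thesis unfolding lag by (simp add: t2_def algebra_simps)
  qed
  have "t1 \<alpha> \<noteq> 0 \<or> t2 \<alpha> \<noteq> 0"
  proof (rule ccontr)
    assume "\<not> ?thesis"
    then have t: "r \<alpha> 1 * d \<alpha> 2 2 = r \<alpha> 2 * d \<alpha> 2 1" "r \<alpha> 2 * d \<alpha> 1 1 = r \<alpha> 1 * d \<alpha> 1 2"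
      by (auto simp: t1_def t2_def)
    have ker: "d \<alpha> i 1 * k $ 1 + d \<alpha> i 2 * k $ 2 = 0" for i
      using k(1) by (simp add: vec_eq_iff matrix_vector_mult_def sum_2 d_def \<alpha>_def)
    \<comment> \<open>Multiplying the entries of \<open>D(\<alpha>)\<close> by \<open>s = r(\<alpha>) k\<close> shows that they all vanish.\<close>
    define s where "s = k $ 1 * r \<alpha> 1 + k $ 2 * r \<alpha> 2"
    have "s = overlap V \<alpha> \<alpha> k k" using overlap_components(1)[OF V, of \<alpha> \<alpha> k k] by (simp add: s_def r_def)
    then have s: "s \<noteq> 0" using overlap_self_eq_0[OF V] k(2) by auto
    have "s * d \<alpha> 2 2 = k $ 1 * (r \<alpha> 1 * d \<alpha> 2 2) + k $ 2 * r \<alpha> 2 * d \<alpha> 2 2" by (simp add: s_def algebra_simps)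
    also have "\<dots> = r \<alpha> 2 * (d \<alpha> 2 1 * k $ 1 + d \<alpha> 2 2 * k $ 2)" unfolding t by (simp add: algebra_simps)
    finally have 22: "d \<alpha> 2 2 = 0" using s by (simp add: ker)
    have "s * d \<alpha> 2 1 = k $ 1 * r \<alpha> 1 * d \<alpha> 2 1 + k $ 2 * (r \<alpha> 2 * d \<alpha> 2 1)" by (simp add: s_def algebra_simps)
    also have "\<dots> = r \<alpha> 1 * (d \<alpha> 2 1 * k $ 1 + d \<alpha> 2 2 * k $ 2)" unfolding t(1)[symmetric] by (simp add: algebra_simps)
    finally have 21: "d \<alpha> 2 1 = 0" using s by (simp add: ker)
    have "s * d \<alpha> 1 1 = k $ 1 * r \<alpha> 1 * d \<alpha> 1 1 + k $ 2 * (r \<alpha> 2 * d \<alpha> 1 1)" by (simp add: s_def algebra_simps)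
    also have "\<dots> = r \<alpha> 1 * (d \<alpha> 1 1 * k $ 1 + d \<alpha> 1 2 * k $ 2)" unfolding t by (simp add: algebra_simps)
    finally have 11: "d \<alpha> 1 1 = 0" using s by (simp add: ker)
    have "s * d \<alpha> 1 2 = k $ 1 * (r \<alpha> 1 * d \<alpha> 1 2) + k $ 2 * r \<alpha> 2 * d \<alpha> 1 2" by (simp add: s_def algebra_simps)
    also have "\<dots> = r \<alpha> 2 * (d \<alpha> 1 1 * k $ 1 + d \<alpha> 1 2 * k $ 2)" unfolding t(2)[symmetric] by (simp add: algebra_simps)
    finally have 12: "d \<alpha> 1 2 = 0" using s by (simp add: ker)
    have "fundamental_solution V \<alpha> 1 = 0" using 11 12 21 22 by (simp add: vec_eq_iff forall_2 d_def)
    then show False using D by (simp add: \<alpha>_def)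
  qed
  then show ?thesis
  proof
    assume "t1 \<alpha> \<noteq> 0"
    then show ?thesis unfolding \<alpha>_def[symmetric]
      by (rule lower_bound_from_identity[OF cont(1) _ arg_cong[where f = cmod, OF e1, unfolded norm_mult]]) simp_all
  next
    assume "t2 \<alpha> \<noteq> 0"
    then show ?thesis unfolding \<alpha>_def[symmetric]
      by (rule lower_bound_from_identity[OF cont(2) _ arg_cong[where f = cmod, OF e2, unfolded norm_mult]]) simp_all
  qed
qed

text \<open>Here every vector lies in the kernel of \<open>D(a)\<close>, so Lagrange's identity holds as the matrix identity
  \<open>\<phi>'(1,a)\<^sup>* D(z) = (z - a) p(z)\<close>, where \<open>p(a)\<close> is the Gram matrix. Take determinants and use that the Gram
  matrix is definite.\<close>

lemma det_double_zero_bound: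
  fixes V :: "real \<Rightarrow> complex^2^2"
  assumes V: "hermitian_potential V" and D: "fundamental_solution V (of_real a) 1 = 0"
  shows "\<exists>c>0. \<exists>r>0. \<forall>z\<in>ball (of_real a) r. c * (cmod (z - of_real a))\<^sup>2 \<le> cmod (det (fundamental_solution V z 1))"
proof -
  define d where "d z i j = fundamental_solution V z 1 $ i $ j" for z i j
  define \<alpha> where "\<alpha> = complex_of_real a"
  define w where "w i j = cnj (fundamental_derivative V \<alpha> 1 $ j $ i)" for i j
  define p where "p z i j = overlap V z \<alpha> (axis j 1) (axis i 1)" for z i j
  define t where "t z = p z 1 1 * p z 2 2 - p z 1 2 * p z 2 1" for z
  have lag: "w i 1 * d z 1 j + w i 2 * d z 2 j = (z - \<alpha>) * p z i j" for z i j
    using lagrange_overlap[OF V, of a "axis i 1" z "axis j 1"] D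
    by (simp add: cinner_def sum_2 matrix_vector_mult_axis d_def w_def p_def \<alpha>_def mult.commute)
  have e: "(w 1 1 * w 2 2 - w 1 2 * w 2 1) * det (fundamental_solution V z 1) = (z - \<alpha>)\<^sup>2 * t z" for z
  proof -
    have "(w 1 1 * w 2 2 - w 1 2 * w 2 1) * det (fundamental_solution V z 1) =
      (w 1 1 * d z 1 1 + w 1 2 * d z 2 1) * (w 2 1 * d z 1 2 + w 2 2 * d z 2 2) -
      (w 1 1 * d z 1 2 + w 1 2 * d z 2 2) * (w 2 1 * d z 1 1 + w 2 2 * d z 2 1)"
      by (simp add: det_2 d_def algebra_simps)
    then show ?thesis unfolding lag by (simp add: t_def power2_eq_square algebra_simps)
  qed
  have cont: "isCont t \<alpha>" unfolding t_def[abs_def] p_def by (intro continuous_intros overlap_isCont[OF V])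
  have "t \<alpha> \<noteq> 0"
  proof
    assume t0: "t \<alpha> = 0"
    \<comment> \<open>If the determinant vanishes at \<open>\<alpha>\<close>, this vector is in the kernel of \<open>p(\<alpha>)\<close>.\<close>
    define v :: "complex^2" where "v = (\<chi> i. if i = 1 then - p \<alpha> 1 2 else p \<alpha> 1 1)"
    have v: "v $ 1 = - p \<alpha> 1 2" "v $ 2 = p \<alpha> 1 1" by (simp_all add: v_def)
    have "overlap V \<alpha> \<alpha> v (axis 1 1) = 0" "overlap V \<alpha> \<alpha> v (axis 2 1) = 0"
      using t0 by (simp_all add: overlap_components(1)[OF V, of \<alpha> \<alpha> v] v t_def flip: p_def)
    then have "overlap V \<alpha> \<alpha> v v = 0" by (simp add: overlap_components(2)[OF V, of \<alpha> \<alpha> v v])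
    then have "v = 0" by (rule overlap_self_eq_0[OF V])
    then have "overlap V \<alpha> \<alpha> (axis 1 1) (axis 1 1) = 0" using v by (simp add: p_def)
    then have "axis 1 1 = (0 :: complex^2)" by (rule overlap_self_eq_0[OF V])
    then show False by (simp add: axis_eq_0_iff)
  qed
  then show ?thesis unfolding \<alpha>_def[symmetric]
    by (rule lower_bound_from_identity[OF cont _ arg_cong[where f = cmod, OF e, unfolded norm_mult norm_power]]) simp_all
qed

section \<open>Eigenspaces and kernels\<close>

lemma square_integrable01_continuous:
  fixes f :: "real \<Rightarrow> 'a::euclidean_space"
  assumes "continuous_on {0..1} f"
  shows "square_integrable01 f"
  unfolding square_integrable01_def
proof
  show "f \<in> borel_measurable (lebesgue_on {0..1})"
    by (rule continuous_imp_measurable_on_sets_lebesgue[OF assms]) simp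
  show "integrable (lebesgue_on {0..1}) (\<lambda>x. (norm (f x))\<^sup>2)"
    by (intro continuous_imp_integrable_real continuous_intros assms)
qed

lemma eigenspace_eq_image:
  fixes V :: "real \<Rightarrow> complex^'n^'n"
  assumes V: "hermitian_potential V"
  shows "eigenspace V \<mu> = (\<lambda>h x. fundamental_solution V \<mu> x *v h) ` kernel_subspace V \<mu>"
proof (intro set_eqI iffI)
  fix \<psi> assume "\<psi> \<in> eigenspace V \<mu>"
  then obtain \<psi>' \<psi>'' where out: "\<And>x. x \<notin> {0..1} \<Longrightarrow> \<psi> x = 0" and bc: "\<psi> 0 = 0" "\<psi> 1 = 0"
    and ac: "ac_deriv \<psi> \<psi>'" "ac_deriv \<psi>' \<psi>''"
    and ae: "AE x in lebesgue. x \<in> {0<..<1} \<longrightarrow> \<mu> *s \<psi> x = - \<psi>'' x + V x *v \<psi> x"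
    unfolding eigenspace_def schrodinger_op_def by blast
  have "AE x in lebesgue. x \<in> {0<..<1} \<longrightarrow> \<psi>'' x = V x *v \<psi> x - \<mu> *s \<psi> x - 0"
    using ae by eventually_elim (auto simp: algebra_simps)
  then have sol: "schrodinger_solution V \<mu> (\<lambda>x. 0) \<psi> \<psi>' \<psi>''" using ac by (simp add: schrodinger_solution_def)
  have col: "\<psi> x = fundamental_solution V \<mu> x *v \<psi>' 0" if "x \<in> {0..1}" for x
    by (rule solution_eq_fundamental_column[OF V sol bc(1) that])
  have "\<psi> x = fundamental_solution V \<mu> x *v \<psi>' 0" for x
    using col[of x] out[of x] fundamental_solution_pair(2)[OF V, of x \<mu>] by (cases "x \<in> {0..1}") simp_all
  then have "\<psi> = (\<lambda>x. fundamental_solution V \<mu> x *v \<psi>' 0)" by (rule ext)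
  moreover have "\<psi>' 0 \<in> kernel_subspace V \<mu>" using col[of 1] bc(2) by (simp add: kernel_subspace_def)
  ultimately show "\<psi> \<in> (\<lambda>h x. fundamental_solution V \<mu> x *v h) ` kernel_subspace V \<mu>" by blast
next
  fix \<psi> assume "\<psi> \<in> (\<lambda>h x. fundamental_solution V \<mu> x *v h) ` kernel_subspace V \<mu>"
  then obtain h where h: "fundamental_solution V \<mu> 1 *v h = 0" and \<psi>: "\<psi> = (\<lambda>x. fundamental_solution V \<mu> x *v h)"
    by (auto simp: kernel_subspace_def)
  obtain y'' where y: "schrodinger_solution V \<mu> (\<lambda>x. 0) \<psi> (\<lambda>x. fundamental_derivative V \<mu> x *v h) y''"
    unfolding \<psi> using fundamental_solution_column[OF V, of \<mu> h] by blast
  have cont: "continuous_on {0..1} \<psi>" unfolding \<psi> by (rule continuous_on_fundamental_column[OF V])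
  have "continuous_on {0..1} (\<lambda>x. \<mu> *s \<psi> x)"
    by (intro bounded_bilinear.continuous_on[OF bounded_bilinear_vector_smult] continuous_on_const cont)
  note sq = square_integrable01_continuous[OF cont] square_integrable01_continuous[OF this]
  have ae: "AE x in lebesgue. x \<in> {0<..<1} \<longrightarrow> \<mu> *s \<psi> x = - y'' x + V x *v \<psi> x"
    using y[unfolded schrodinger_solution_def, THEN conjunct2, THEN conjunct2]
    by eventually_elim (auto simp: algebra_simps)
  have "\<psi> x = 0" if "x \<notin> {0..1}" for x
    unfolding \<psi> fundamental_solution_pair(2)[OF V that] by simp
  moreover have "\<psi> 0 = 0" "\<psi> 1 = 0" by (simp_all add: \<psi> h fundamental_solution_initial[OF V])
  ultimately show "\<psi> \<in> eigenspace V \<mu>"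
    using sq ae y unfolding eigenspace_def schrodinger_op_def schrodinger_solution_def by blast
qed

lemma eigenvalue_iff_det:
  fixes V :: "real \<Rightarrow> complex^'n^'n"
  assumes V: "hermitian_potential V"
  shows "\<mu> \<in> eigenvalues V \<longleftrightarrow> det (fundamental_solution V \<mu> 1) = 0"
proof -
  have "\<mu> \<in> eigenvalues V \<longleftrightarrow> (\<exists>h. fundamental_solution V \<mu> 1 *v h = 0 \<and> h \<noteq> 0)"
  proof
    assume "\<mu> \<in> eigenvalues V"
    then obtain h where "fundamental_solution V \<mu> 1 *v h = 0" "(\<lambda>x. fundamental_solution V \<mu> x *v h) \<noteq> (\<lambda>x. 0)"
      unfolding eigenvalues_def eigenspace_eq_image[OF V] kernel_subspace_def by blast
    then show "\<exists>h. fundamental_solution V \<mu> 1 *v h = 0 \<and> h \<noteq> 0" by (intro exI[of _ h]) auto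
  next
    assume "\<exists>h. fundamental_solution V \<mu> 1 *v h = 0 \<and> h \<noteq> 0"
    then obtain h where h: "fundamental_solution V \<mu> 1 *v h = 0" "h \<noteq> 0" by blast
    then have "(\<lambda>x. fundamental_solution V \<mu> x *v h) \<noteq> (\<lambda>x. 0)"
      using fundamental_column_injective[OF V, of \<mu> h] by (metis (no_types))
    then show "\<mu> \<in> eigenvalues V"
      unfolding eigenvalues_def eigenspace_eq_image[OF V] kernel_subspace_def using h(1) by blast
  qed
  also have "\<dots> \<longleftrightarrow> \<not> (\<exists>B. B ** fundamental_solution V \<mu> 1 = mat 1)"
    unfolding matrix_left_invertible_ker by blast
  also have "\<dots> \<longleftrightarrow> det (fundamental_solution V \<mu> 1) = 0"
    by (metis invertible_det_nz invertible_left_inverse)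
  finally show ?thesis .
qed

text \<open>The map \<open>h \<mapsto> \<phi>(\<cdot>,\<mu>) h\<close> is a complex linear bijection from the kernel onto the eigenspace.\<close>

lemma eigenvalue_multiplicity_eq_dim_kernel:
  fixes V :: "real \<Rightarrow> complex^'n^'n"
  assumes V: "hermitian_potential V"
  shows "eigenvalue_multiplicity V \<mu> = vec.dim (kernel_subspace V \<mu>)"
proof -
  interpret fs: vector_space "fun_scale :: complex \<Rightarrow> (real \<Rightarrow> complex^'n) \<Rightarrow> _" by (rule vector_space_fun_scale)
  interpret p: finite_dimensional_vector_space_pair_1 "(*s) :: complex \<Rightarrow> complex^'n \<Rightarrow> complex^'n"
    cart_basis "fun_scale :: complex \<Rightarrow> (real \<Rightarrow> complex^'n) \<Rightarrow> _" ..
  define F where "F h = (\<lambda>x. fundamental_solution V \<mu> x *v h)" for h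
  have lin: "Vector_Spaces.linear (*s) fun_scale F"
    by unfold_locales
      (auto simp: F_def fun_scale_def fun_eq_iff matrix_vector_right_distrib vector_scalar_commute)
  have "inj F"
  proof (rule injI)
    fix h k assume "F h = F k"
    then have "fundamental_solution V \<mu> x *v (h - k) = 0" for x
      by (simp add: F_def fun_eq_iff matrix_vector_mult_diff_distrib)
    then have "h - k = 0" by (rule fundamental_column_injective[OF V])
    then show "h = k" by simp
  qed
  then have "inj_on F (vec.span (kernel_subspace V \<mu>))" by (rule inj_on_subset) simp
  from p.dim_image_eq[OF lin this] show ?thesis
    unfolding eigenvalue_multiplicity_def eigenspace_eq_image[OF V] F_def .
qed

lemma kernel_subspace_subspace: "vec.subspace (kernel_subspace V \<mu>)"
  by (auto simp: vec.subspace_def kernel_subspace_def matrix_vector_right_distrib vector_scalar_commute)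

lemma multiplicity_one_kernel:
  fixes V :: "real \<Rightarrow> complex^'n^'n"
  assumes V: "hermitian_potential V" and m: "eigenvalue_multiplicity V \<mu> = 1"
  obtains h where "h \<noteq> 0" "kernel_subspace V \<mu> = range (\<lambda>c. c *s h)"
proof -
  obtain B where B: "B \<subseteq> kernel_subspace V \<mu>" "vec.independent B" "kernel_subspace V \<mu> \<subseteq> vec.span B"
    "card B = vec.dim (kernel_subspace V \<mu>)" by (rule vec.basis_exists)
  then have "card B = 1" using m by (simp add: eigenvalue_multiplicity_eq_dim_kernel[OF V])
  then obtain h where h: "B = {h}" by (auto simp: card_1_singleton_iff)
  have "h \<noteq> 0" using B(2) vec.dependent_zero[of B] by (auto simp: h)
  moreover have "vec.span B \<subseteq> kernel_subspace V \<mu>" by (rule vec.span_minimal[OF B(1) kernel_subspace_subspace])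
  then have "kernel_subspace V \<mu> = range (\<lambda>c. c *s h)" using B(3) by (auto simp: h vec.span_singleton)
  ultimately show ?thesis by (rule that)
qed

lemma multiplicity_full_vanishing:
  fixes V :: "real \<Rightarrow> complex^'n^'n"
  assumes V: "hermitian_potential V" and m: "eigenvalue_multiplicity V \<mu> = CARD('n)"
  shows "fundamental_solution V \<mu> 1 = 0"
proof -
  have "vec.dim (kernel_subspace V \<mu>) = vec.dim (UNIV :: (complex^'n) set)"
    using m by (simp only: eigenvalue_multiplicity_eq_dim_kernel[OF V] vec_dim_card)
  then have "kernel_subspace V \<mu> = UNIV"
    by (intro vec.subspace_dim_equal kernel_subspace_subspace vec.subspace_UNIV) simp_all
  then have "\<forall>h. fundamental_solution V \<mu> 1 *v h = 0 *v h" by (auto simp: kernel_subspace_def)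
  then show ?thesis unfolding matrix_eq .
qed

section \<open>The forbidden subspaces\<close>

text \<open>If \<open>q \<noteq> 0\<close>, the left-hand side vanishes at \<open>a\<close> to first order at most and the right-hand side to third
  order at least.\<close>

lemma vanishing_by_order:
  fixes e :: "complex \<Rightarrow> complex"
  assumes eq: "\<And>z. q * ((z - b) * e z) = (z - a)^3 * t z" and t: "isCont t a" and ab: "a \<noteq> b"
    and low: "\<exists>c>0. \<exists>r>0. \<forall>z\<in>ball a r. c * cmod (z - a) \<le> cmod (e z)"
  shows "q = 0"
proof -
  obtain c r where c: "c > 0" "r > 0" "\<And>z. z \<in> ball a r \<Longrightarrow> c * cmod (z - a) \<le> cmod (e z)" using low by blast
  have "cmod q * cmod (a - b) * c \<le> 0"
  proof (rule tendsto_le)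
    show "((\<lambda>z. cmod q * cmod (z - b) * c) \<longlongrightarrow> cmod q * cmod (a - b) * c) (at a)" by (intro tendsto_intros)
    have "((\<lambda>z. (cmod (z - a))\<^sup>2 * cmod (t z)) \<longlongrightarrow> (cmod (a - a))\<^sup>2 * cmod (t a)) (at a)"
      using t unfolding isCont_def by (intro tendsto_intros)
    then show "((\<lambda>z. (cmod (z - a))\<^sup>2 * cmod (t z)) \<longlongrightarrow> 0) (at a)" by simp
    have "\<forall>\<^sub>F z in at a. z \<noteq> a \<and> dist z a < r" using c(2) by (auto simp: eventually_at intro: exI[of _ r])
    then show "\<forall>\<^sub>F z in at a. cmod q * cmod (z - b) * c \<le> (cmod (z - a))\<^sup>2 * cmod (t z)"
    proof eventually_elim
      case (elim z)
      then have pos: "cmod (z - a) > 0" by simp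
      have "cmod q * cmod (z - b) * (c * cmod (z - a)) \<le> cmod q * cmod (z - b) * cmod (e z)"
        using c(3)[of z] elim by (intro mult_left_mono) (auto simp: dist_commute)
      also have "\<dots> = cmod (z - a) ^ 3 * cmod (t z)"
        using arg_cong[where f = cmod, OF eq[of z]] by (simp add: norm_mult norm_power mult_ac)
      finally have "(cmod q * cmod (z - b) * c) * cmod (z - a) \<le> ((cmod (z - a))\<^sup>2 * cmod (t z)) * cmod (z - a)"
        by (simp add: power3_eq_cube power2_eq_square mult_ac)
      then show ?case using pos by (rule mult_right_le_imp_le)
    qed
  qed simp
  then have "cmod q * (cmod (a - b) * c) \<le> 0 * (cmod (a - b) * c)" by (simp add: mult_ac)
  then have "cmod q \<le> 0" using c(1) ab by (intro mult_right_le_imp_le[of _ "cmod (a - b) * c" 0]) auto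
  then show ?thesis by simp
qed

text \<open>The comparison of orders of vanishing at \<open>a\<close> described at the beginning. The statement is asymmetric in
  \<open>a\<close> and \<open>b\<close> and is applied to the two simple eigenvalues in both orders.\<close>

lemma forbidden_subspace_of_simple_pair:
  fixes V :: "real \<Rightarrow> complex^2^2"
  assumes V: "hermitian_potential V" and ab: "a \<noteq> b"
    and mult: "eigenvalue_multiplicity V (of_real a) = 1" "eigenvalue_multiplicity V (of_real b) = 1"
    and rest: "\<And>\<mu>. \<mu> \<in> eigenvalues V \<Longrightarrow> \<mu> \<noteq> of_real a \<Longrightarrow> \<mu> \<noteq> of_real b \<Longrightarrow>
      \<mu> \<in> \<real> \<and> eigenvalue_multiplicity V \<mu> = 2"
  shows "kernel_subspace V (of_real a) \<inter> kernel_subspace V (of_real b) = {0}"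
    and "forbidden_subspace V (of_real a) = kernel_subspace V (of_real b)"
proof -
  interpret c: bounded_bilinear "cinner :: complex^2 \<Rightarrow> complex^2 \<Rightarrow> complex" by (rule bounded_bilinear_cinner)
  define D where "D \<mu> = fundamental_solution V \<mu> 1" for \<mu>
  define \<alpha> where "\<alpha> = complex_of_real a"
  define \<beta> where "\<beta> = complex_of_real b"
  have \<alpha>\<beta>: "\<alpha> \<noteq> \<beta>" using ab by (simp add: \<alpha>_def \<beta>_def)
  obtain h where h: "h \<noteq> 0" "kernel_subspace V \<alpha> = range (\<lambda>c. c *s h)"
    using multiplicity_one_kernel[OF V mult(1)] unfolding \<alpha>_def by blast
  obtain k where k: "k \<noteq> 0" "kernel_subspace V \<beta> = range (\<lambda>c. c *s k)"
    using multiplicity_one_kernel[OF V mult(2)] unfolding \<beta>_def by blast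
  have "1 *s h \<in> kernel_subspace V \<alpha>" "1 *s k \<in> kernel_subspace V \<beta>" unfolding h(2) k(2) by (intro rangeI)+
  then have Dh: "D \<alpha> *v h = 0" and Dk: "D \<beta> *v k = 0" by (simp_all add: kernel_subspace_def D_def)
  have nz: "fundamental_solution V \<mu> 1 \<noteq> 0" if "eigenvalue_multiplicity V \<mu> = 1" for \<mu>
  proof
    assume "fundamental_solution V \<mu> 1 = 0"
    then have "kernel_subspace V \<mu> = UNIV" by (simp add: kernel_subspace_def)
    then show False using that vec_dim_card[where 'a = complex and 'n = 2]
      by (simp only: eigenvalue_multiplicity_eq_dim_kernel[OF V]) simp
  qed
  have simple_a: "\<exists>c>0. \<exists>r>0. \<forall>z\<in>ball \<alpha> r. c * cmod (z - \<alpha>) \<le> cmod (det (D z))"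
    unfolding D_def \<alpha>_def
    by (rule det_simple_zero_bound[OF V _ h(1) nz[OF mult(1)]]) (use Dh in \<open>simp add: D_def \<alpha>_def\<close>)
  have simple_b: "\<exists>c>0. \<exists>r>0. \<forall>z\<in>ball \<beta> r. c * cmod (z - \<beta>) \<le> cmod (det (D z))"
    unfolding D_def \<beta>_def
    by (rule det_simple_zero_bound[OF V _ k(1) nz[OF mult(2)]]) (use Dk in \<open>simp add: D_def \<beta>_def\<close>)
  have double: "D \<mu> = 0 \<and> (\<exists>c>0. \<exists>r>0. \<forall>z\<in>ball \<mu> r. c * (cmod (z - \<mu>))\<^sup>2 \<le> cmod (det (D z)))"
    if \<mu>: "\<mu> \<noteq> \<alpha>" "\<mu> \<noteq> \<beta>" "det (D \<mu>) = 0" for \<mu>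
  proof -
    have "\<mu> \<in> eigenvalues V" using \<mu>(3) by (simp add: eigenvalue_iff_det[OF V] D_def)
    then have r: "\<mu> \<in> \<real>" "eigenvalue_multiplicity V \<mu> = 2" using rest \<mu>(1,2) by (auto simp: \<alpha>_def \<beta>_def)
    then have D0: "D \<mu> = 0" unfolding D_def by (intro multiplicity_full_vanishing[OF V]) simp
    obtain x where x: "\<mu> = of_real x" using r(1) by (auto elim: Reals_cases)
    show ?thesis using D0 det_double_zero_bound[OF V, of x] unfolding D_def x by blast
  qed
  obtain n0 where circle: "\<And>n \<mu> h. n \<ge> n0 \<Longrightarrow> cmod \<mu> = (pi * (real n + 1/2))\<^sup>2 \<Longrightarrow>
    det (D \<mu>) \<noteq> 0 \<and> (norm (D \<mu> *v h))\<^sup>2 \<le> 72 * (norm h)\<^sup>2 * cmod (det (D \<mu>))"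
    unfolding D_def using fundamental_solution_circle_bound[OF V] by blast
  have hol: "(\<lambda>\<mu>. (D \<mu> *v h) $ i) holomorphic_on UNIV" for h i
    unfolding D_def by (rule holomorphic_fundamental_solution[OF V])
  define u where "u \<mu> = D \<mu> *v k" for \<mu>
  have "\<exists>c. \<forall>\<mu>. u \<mu> $ i * u \<mu> $ j * (\<mu> - \<alpha>) = c * ((\<mu> - \<beta>) * det (D \<mu>))" for i j
  proof -
    show ?thesis
    proof (rule quadratic_column_identity[where i = i and j = j, OF hol circle \<alpha>\<beta> Dk _ double])
      fix c assume "\<And>\<mu>. (D \<mu> *v k) $ i * (D \<mu> *v k) $ j * (\<mu> - \<alpha>) = c * ((\<mu> - \<beta>) * det (D \<mu>))"
      then show ?thesis unfolding u_def by blast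
    next
      show "\<exists>c>0. \<exists>r>0. \<forall>z\<in>ball \<mu> r. c * cmod (z - \<mu>) \<le> cmod (det (D z))" if "\<mu> = \<alpha> \<or> \<mu> = \<beta>" for \<mu>
        using that simple_a simple_b by blast
    qed
  qed
  then obtain C where C: "\<And>i j \<mu>. u \<mu> $ i * u \<mu> $ j * (\<mu> - \<alpha>) = C i j * ((\<mu> - \<beta>) * det (D \<mu>))" by metis
  define w where "w = fundamental_derivative V \<alpha> 1 *v h"
  define L where "L \<mu> = overlap V \<mu> \<alpha> k h" for \<mu>
  have L_cont: "isCont L \<alpha>" unfolding L_def[abs_def] by (rule overlap_isCont[OF V])
  have lag: "cinner (u \<mu>) w = (\<mu> - \<alpha>) * L \<mu>" for \<mu>
    unfolding u_def D_def w_def L_def \<alpha>_def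
    by (rule lagrange_overlap[OF V]) (use Dh in \<open>simp add: D_def \<alpha>_def\<close>)
  have "L \<alpha> = 0"
  proof -
    \<comment> \<open>The quadratic form with coefficients \<open>C i j\<close>, evaluated at the conjugate of \<open>w\<close>.\<close>
    define q where "q = C 1 1 * cnj (w $ 1) * cnj (w $ 1) + 2 * C 1 2 * cnj (w $ 1) * cnj (w $ 2)
      + C 2 2 * cnj (w $ 2) * cnj (w $ 2)"
    have qX: "q * X = (C 1 1 * X) * cnj (w $ 1) * cnj (w $ 1) + 2 * (C 1 2 * X) * cnj (w $ 1) * cnj (w $ 2)
        + (C 2 2 * X) * cnj (w $ 2) * cnj (w $ 2)" for X
      by (simp add: q_def algebra_simps)
    have sq: "q * ((\<mu> - \<beta>) * det (D \<mu>)) = (cinner (u \<mu>) w)\<^sup>2 * (\<mu> - \<alpha>)" for \<mu>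
    proof -
      have "q * ((\<mu> - \<beta>) * det (D \<mu>)) = (C 1 1 * ((\<mu> - \<beta>) * det (D \<mu>))) * cnj (w $ 1) * cnj (w $ 1)
        + 2 * (C 1 2 * ((\<mu> - \<beta>) * det (D \<mu>))) * cnj (w $ 1) * cnj (w $ 2)
        + (C 2 2 * ((\<mu> - \<beta>) * det (D \<mu>))) * cnj (w $ 2) * cnj (w $ 2)"
        by (rule qX)
      then show ?thesis unfolding C[symmetric]
        by (simp add: cinner_def sum_2 power2_eq_square algebra_simps)
    qed
    have "q = 0"
    proof (rule vanishing_by_order[where t = "\<lambda>\<mu>. (L \<mu>)\<^sup>2", OF _ _ \<alpha>\<beta> simple_a])
      show "q * ((z - \<beta>) * det (D z)) = (z - \<alpha>) ^ 3 * (L z)\<^sup>2" for z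
        unfolding sq lag by (simp add: power2_eq_square power3_eq_cube)
      show "isCont (\<lambda>\<mu>. (L \<mu>)\<^sup>2) \<alpha>" by (intro continuous_intros L_cont)
    qed
    then have "L \<mu> = 0" if "\<mu> \<noteq> \<alpha>" for \<mu> using sq[of \<mu>] that by (simp add: lag)
    then have "\<forall>\<^sub>F \<mu> in at \<alpha>. L \<mu> = 0" by (auto simp: eventually_at intro: exI[of _ 1])
    then have "(L \<longlongrightarrow> 0) (at \<alpha>)" by (rule tendsto_eventually)
    moreover have "(L \<longlongrightarrow> L \<alpha>) (at \<alpha>)" using L_cont by (simp add: isCont_def)
    ultimately show ?thesis by (intro tendsto_unique[of "at \<alpha>" L]) auto
  qed
  have u\<alpha>: "u \<alpha> \<noteq> 0"
  proof
    assume u0: "u \<alpha> = 0"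
    have C0: "C i i = 0" for i
    proof -
      have "((\<lambda>\<mu>. u \<mu> $ i) has_field_derivative deriv (\<lambda>\<mu>. u \<mu> $ i) \<alpha>) (at \<alpha>)"
        unfolding u_def by (rule holomorphic_derivI[OF hol]) auto
      then obtain t where t: "\<And>z. u z $ i - u \<alpha> $ i = t z * (z - \<alpha>)" "isCont t \<alpha>"
        unfolding CARAT_DERIV by blast
      have "u z $ i = (z - \<alpha>) * t z" for z using t(1)[of z] u0 by (simp add: mult.commute)
      then have "C i i * ((z - \<beta>) * det (D z)) = (z - \<alpha>) ^ 3 * (t z)\<^sup>2" for z
        unfolding C[symmetric] by (simp add: power2_eq_square power3_eq_cube)
      then show ?thesis
        by (rule vanishing_by_order[where t = "\<lambda>z. (t z)\<^sup>2", OF _ _ \<alpha>\<beta> simple_a]) (intro continuous_intros t(2))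
    qed
    \<comment> \<open>Any point of one of the circles shows that \<open>det D\<close> is not identically zero.\<close>
    define \<mu> where "\<mu> = complex_of_real ((pi * (real n0 + 1/2))\<^sup>2)"
    have "cmod \<mu> = (pi * (real n0 + 1/2))\<^sup>2" unfolding \<mu>_def norm_of_real by simp
    then have det: "det (D \<mu>) \<noteq> 0" using circle[OF order_refl] by blast
    have "det (D \<alpha>) = 0" using eigenvalue_iff_det[OF V, of \<alpha>] Dh h(1)
      by (metis D_def invertible_det_nz invertible_left_inverse matrix_left_invertible_ker)
    then have "\<mu> \<noteq> \<alpha>" using det by auto
    then have "u \<mu> $ i = 0" for i using C[of \<mu> i i] by (simp add: C0)
    then have "D \<mu> *v k = 0" by (simp add: vec_eq_iff u_def)
    then have "k = 0" using det by (metis invertible_det_nz invertible_left_inverse matrix_left_invertible_ker)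
    then show False using k(1) by simp
  qed
  show "kernel_subspace V (of_real a) \<inter> kernel_subspace V (of_real b) = {0}"
    unfolding \<alpha>_def[symmetric] \<beta>_def[symmetric]
  proof (intro equalityI subsetI)
    fix x assume x: "x \<in> kernel_subspace V \<alpha> \<inter> kernel_subspace V \<beta>"
    then obtain c where c: "x = c *s k" using k(2) by blast
    have "c *s u \<alpha> = 0" using x by (simp add: c u_def D_def kernel_subspace_def vector_scalar_commute)
    then show "x \<in> {0}" using u\<alpha> by (simp add: c)
  qed (simp add: kernel_subspace_def)
  define s where "s = gram_matrix V \<alpha> *v h"
  have ks: "cinner k s = 0" using \<open>L \<alpha> = 0\<close> cinner_gram_matrix[OF V, of k \<alpha> h] by (simp add: s_def L_def)
  have "cinner h s \<noteq> 0"
    using overlap_self_eq_0[OF V, of \<alpha> h] h(1) cinner_gram_matrix[OF V, of h \<alpha> h] by (auto simp: s_def)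
  then have s0: "s \<noteq> 0" by (auto simp: c.zero_right)
  have F: "v \<in> forbidden_subspace V \<alpha> \<longleftrightarrow> cinner v s = 0" for v
  proof -
    have "v \<in> forbidden_subspace V \<alpha> \<longleftrightarrow> (\<forall>c. cinner v (c *s s) = 0)"
      unfolding forbidden_subspace_def hermitian_comp_def h(2) s_def by (auto simp: vector_scalar_commute cinner_def)
    also have "\<dots> \<longleftrightarrow> cinner v s = 0"
      unfolding cinner_smult_right by (metis complex_cnj_one mult_1 mult_zero_right)
    finally show ?thesis .
  qed
  show "forbidden_subspace V (of_real a) = kernel_subspace V (of_real b)"
    unfolding \<alpha>_def[symmetric] \<beta>_def[symmetric]
  proof (intro set_eqI iffI)
    fix v assume "v \<in> forbidden_subspace V \<alpha>"
    then have "v $ 1 * cnj (s $ 1) + v $ 2 * cnj (s $ 2) = 0" by (simp add: F cinner_def sum_2)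
    moreover have "k $ 1 * cnj (s $ 1) + k $ 2 * cnj (s $ 2) = 0" using ks by (simp add: cinner_def sum_2)
    moreover have "s $ 1 \<noteq> 0 \<or> s $ 2 \<noteq> 0" using s0 by (auto simp: vec_eq_iff forall_2)
    ultimately have par: "v $ 1 * k $ 2 = v $ 2 * k $ 1"
    proof -
      assume e: "v $ 1 * cnj (s $ 1) + v $ 2 * cnj (s $ 2) = 0" "k $ 1 * cnj (s $ 1) + k $ 2 * cnj (s $ 2) = 0"
        and s: "s $ 1 \<noteq> 0 \<or> s $ 2 \<noteq> 0"
      have "(v $ 1 * k $ 2 - v $ 2 * k $ 1) * cnj (s $ 1) =
        k $ 2 * (v $ 1 * cnj (s $ 1) + v $ 2 * cnj (s $ 2)) - v $ 2 * (k $ 1 * cnj (s $ 1) + k $ 2 * cnj (s $ 2))"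
        "(v $ 1 * k $ 2 - v $ 2 * k $ 1) * cnj (s $ 2) =
        v $ 1 * (k $ 1 * cnj (s $ 1) + k $ 2 * cnj (s $ 2)) - k $ 1 * (v $ 1 * cnj (s $ 1) + v $ 2 * cnj (s $ 2))"
        by (simp_all add: algebra_simps)
      then show ?thesis using s unfolding e by auto
    qed
    have "v \<in> range (\<lambda>c. c *s k)"
    proof (cases "k $ 1 = 0")
      case False
      then have "v = (v $ 1 / k $ 1) *s k" using par by (simp add: vec_eq_iff forall_2 field_simps)
      then show ?thesis by (rule range_eqI)
    next
      case True
      then have "k $ 2 \<noteq> 0" using k(1) by (auto simp: vec_eq_iff forall_2)
      then have "v = (v $ 2 / k $ 2) *s k" using par True by (simp add: vec_eq_iff forall_2 field_simps)
      then show ?thesis by (rule range_eqI)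
    qed
    then show "v \<in> kernel_subspace V \<beta>" by (simp add: k(2))
  next
    fix v assume "v \<in> kernel_subspace V \<beta>"
    then obtain c where "v = c *s k" using k(2) by blast
    then show "v \<in> forbidden_subspace V \<alpha>" by (simp add: F cinner_smult_left ks)
  qed
qed

theorem proposition1p5:
  fixes V :: "real \<Rightarrow> complex^2^2" and lam :: "nat \<Rightarrow> real"
  assumes V: "hermitian_potential V"
    and lam_mono: "strict_mono_on {1..} lam"
    and lam_eigenvalues: "eigenvalues V = (\<lambda>\<alpha>. complex_of_real (lam \<alpha>)) ` {1..}"
    and mult_1: "eigenvalue_multiplicity V (lam 1) = 1"
    and mult_2: "eigenvalue_multiplicity V (lam 2) = 1"
    and mult_ge_3: "\<And>\<alpha>. \<alpha> \<ge> 3 \<Longrightarrow> eigenvalue_multiplicity V (lam \<alpha>) = 2"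
  shows "kernel_subspace V (lam 1) \<inter> kernel_subspace V (lam 2) = {0} \<and>
    forbidden_subspace V (lam 1) = kernel_subspace V (lam 2) \<and>
    forbidden_subspace V (lam 2) = kernel_subspace V (lam 1)"
proof -
  have "lam 1 < lam 2" by (rule strict_mono_onD[OF lam_mono]) auto
  then have ne: "lam 1 \<noteq> lam 2" "lam 2 \<noteq> lam 1" by auto
  have rest: "\<mu> \<in> \<real> \<and> eigenvalue_multiplicity V \<mu> = 2"
    if \<mu>: "\<mu> \<in> eigenvalues V" "\<mu> \<noteq> lam 1" "\<mu> \<noteq> lam 2" for \<mu>
  proof -
    obtain \<alpha> where \<alpha>: "\<alpha> \<ge> 1" "\<mu> = lam \<alpha>" using \<mu>(1) unfolding lam_eigenvalues by auto
    then have "\<alpha> \<noteq> 1" "\<alpha> \<noteq> 2" using \<mu>(2,3) by auto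
    then have "\<alpha> \<ge> 3" using \<alpha>(1) by linarith
    then show ?thesis using mult_ge_3 \<alpha>(2) by simp
  qed
  show ?thesis
    using forbidden_subspace_of_simple_pair[OF V ne(1) mult_1 mult_2 rest]
      forbidden_subspace_of_simple_pair(2)[OF V ne(2) mult_2 mult_1 rest] by blast
qed

end
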